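(* Let $N=3$ and let $\mu\in H^3((0,1),\mathbb{R})$ be such that $$\begin{aligned}\mathcal{B}:=&\big(\langle\mu\varphi_3,\varphi_3\rangle-\langle\mu\varphi_2,\varphi_2\rangle\big)\langle(\mu')^2\varphi_1,\varphi_1\rangle+\big(\langle\mu\varphi_1,\varphi_1\rangle-\langle\mu\varphi_3,\varphi_3\rangle\big)\langle(\mu')^2\varphi_2,\varphi_2\rangle\\&+\big(\langle\mu\varphi_2,\varphi_2\rangle-\langle\mu\varphi_1,\varphi_1\rangle\big)\langle(\mu')^2\varphi_3,\varphi_3\rangle\neq0\end{aligned}$$ and $\langle\mu\varphi_1,\varphi_1\rangle\neq\langle\mu\varphi_2,\varphi_2\rangle$. Let $\beta:=\operatorname{sign}\big(\mathcal{B}(\langle\mu\varphi_2,\varphi_2\rangle-\langle\mu\varphi_1,\varphi_1\rangle)\big)\in\{-1,1\}$. There exist $T_*>0$ and $\varepsilon>0$ such that for any $T\in(0,T_* )$ and every $u\in L^2((0,T),\mathbb{R})$ with $\|u\|_{L^2(0,T)}<\varepsilon$, the solution $(\psi^1,\psi^2,\psi^3)$ of $$i\partial_t\psi^j=-\partial^2_{xx}\psi^j-u(t)\mu(x)\psi^j,\quad \psi^j(t,0)=\psi^j(t,1)=0,\quad \psi^j(0,\cdot)=\varphi_j,\qquad j=1,2,3,$$ on $(0,T)\times(0,1)$ satisfies, for every $\delta\in(0,1]$ and every $\nu\in\mathbb{R}$, $$\big(\psi^1(T),\psi^2(T),\psi^3(T)\big)\neq e^{i\nu}\Big(\Phi_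1(T),\Phi_2(T),\big(\sqrt{1-\delta^2}+i\beta\delta\big)\Phi_3(T)\Big).$$
   Context: $\langle f,g\rangle=\int_0^1 f(x)\overline{g(x)}\,dx$ on $L^2((0,1),\mathbb{C})$. $A\varphi:=-\partial_{xx}^2\varphi$ with domain $H^2\cap H^1_0((0,1),\mathbb{C})$; $\lambda_k:=(k\pi)^2$, $\varphi_k(x):=\sqrt2\sin(k\pi x)$, $\Phi_k(t,x):=\varphi_k(x)e^{-i\lambda_kt}$ for $k\in\mathbb{N}^*=\{1,2,\dots\}$. $H^3_{(0)}((0,1),\mathbb{C}):=\mathcal{D}(A^{3/2})$, with norm $\|\varphi\|_{H^3_{(0)}}=\big(\sum_k|k^3\langle\varphi,\varphi_k\rangle|^2\big)^{1/2}$. Solutions are weak (mild) solutions: for $\mu\in H^3((0,1),\mathbb R)$, $u\in L^2((0,T),\mathbb R)$ and $\psi_0\in H^3_{(0)}$, the solution of $i\partial_t\psi=-\partial_{xx}^2\psi-u\mu\psi$ with Dirichlet boundary conditions and $\psi(0)=\psi_0$ is the unique $\psi\in C^0([0,T],H^3_{(0)})$ with $\psi(t)=e^{-iAt}\psi_0+i\int_0^te^{-iA(t-\tau)}u(\tau)\mu\psi(\tau)\,d\tau$ in $H^3_{(0)}$ for all $t\in[0,T]$. *)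

theory Defs
  imports "HOL-Analysis.Analysis"
begin

(* Functions on an interval are total functions on the reals that are only looked at on that
   interval. Elements of L^2 are represented by functions, and equality in L^2 is L2_eq. *)

definition L2 :: "real set \<Rightarrow> (real \<Rightarrow> 'a::real_normed_vector) set" where
  "L2 S = {f \<in> borel_measurable (lebesgue_on S). integrable (lebesgue_on S) (\<lambda>x. (norm (f x))\<^sup>2)}"

definition L2_norm :: "real set \<Rightarrow> (real \<Rightarrow> 'a::real_normed_vector) \<Rightarrow> real" where
  "L2_norm S f = sqrt (\<integral>x. (norm (f x))\<^sup>2 \<partial>lebesgue_on S)"

abbreviation I01 :: "real set" where
  "I01 \<equiv> {0<..<1}"

definition L2_inner :: "(real \<Rightarrow> complex) \<Rightarrow> (real \<Rightarrow> complex) \<Rightarrow> complex" where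
  "L2_inner f g = (\<integral>x. f x * cnj (g x) \<partial>lebesgue_on I01)"

definition L2_eq :: "(real \<Rightarrow> complex) \<Rightarrow> (real \<Rightarrow> complex) \<Rightarrow> bool" where
  "L2_eq f g \<longleftrightarrow> (AE x in lebesgue_on I01. f x = g x)"


definition test_functions :: "(real \<Rightarrow> real) set" where
  "test_functions = {\<theta>. (\<forall>n x. (deriv ^^ n) \<theta> differentiable (at x)) \<and>
     (\<exists>K. compact K \<and> K \<subseteq> I01 \<and> (\<forall>x. x \<notin> K \<longrightarrow> \<theta> x = 0))}"

(* g is the weak derivative of order k of f on (0,1), both functions being in L^2. *)
definition has_weak_deriv :: "nat \<Rightarrow> (real \<Rightarrow> real) \<Rightarrow> (real \<Rightarrow> real) \<Rightarrow> bool" where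
  "has_weak_deriv k f g \<longleftrightarrow> f \<in> L2 I01 \<and> g \<in> L2 I01 \<and>
     (\<forall>\<theta>\<in>test_functions. (\<integral>x. f x * (deriv ^^ k) \<theta> x \<partial>lebesgue_on I01)
        = (- 1) ^ k * (\<integral>x. g x * \<theta> x \<partial>lebesgue_on I01))"

definition sobolev_H :: "nat \<Rightarrow> (real \<Rightarrow> real) set" where
  "sobolev_H m = {f \<in> L2 I01. \<forall>k\<le>m. \<exists>g. has_weak_deriv k f g}"


(* Eigenvalues and orthonormal eigenbasis (k = 1, 2, ...) of the Dirichlet Laplacian
   A = -d^2/dx^2 with domain (H^2 cap H^1_0)((0,1),C). Functions of A, that is its powers and
   exp (-i A t), are defined by the spectral calculus in this basis. *)

definition eig :: "nat \<Rightarrow> real" where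
  "eig k = (real k * pi)\<^sup>2"

definition phi :: "nat \<Rightarrow> real \<Rightarrow> complex" where
  "phi k x = complex_of_real (sqrt 2 * sin (real k * pi * x))"

definition Phi :: "nat \<Rightarrow> real \<Rightarrow> real \<Rightarrow> complex" where
  "Phi k t x = phi k x * exp (- \<i> * complex_of_real (eig k * t))"

definition A_power_domain :: "real \<Rightarrow> (real \<Rightarrow> complex) set" where
  "A_power_domain s = {f \<in> L2 I01.
     (\<lambda>k. (cmod (complex_of_real (eig k powr s) * L2_inner f (phi k)))\<^sup>2) summable_on {1..}}"

definition H3_0 :: "(real \<Rightarrow> complex) set" where
  "H3_0 = A_power_domain (3 / 2)"

definition H3_0_norm :: "(real \<Rightarrow> complex) \<Rightarrow> real" where
  "H3_0_norm f = sqrt (\<Sum>\<^sub>\<infinity>k\<in>{1..}. (cmod (of_nat k ^ 3 * L2_inner f (phi k)))\<^sup>2)"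

definition L2_sums :: "(nat \<Rightarrow> real \<Rightarrow> complex) \<Rightarrow> (real \<Rightarrow> complex) \<Rightarrow> bool" where
  "L2_sums F h \<longleftrightarrow> h \<in> L2 I01 \<and>
     (\<lambda>n. L2_norm I01 (\<lambda>x. (\<Sum>k=1..n. F k x) - h x)) \<longlonglongrightarrow> 0"

(* free_prop t f is a representative of exp (-i A t) f, which is determined up to L2_eq. *)
definition free_prop :: "real \<Rightarrow> (real \<Rightarrow> complex) \<Rightarrow> real \<Rightarrow> complex" where
  "free_prop t f = (SOME h. L2_sums
     (\<lambda>k x. exp (- \<i> * complex_of_real (eig k * t)) * L2_inner f (phi k) * phi k x) h)"

(* h is the integral over S of the L^2-valued function F, defined by duality with L^2 (for Bochner
   integrable F this is the Bochner integral). In the mild formulation below the integrand need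
   not take values in H3_0: mu * psi satisfies the first-order boundary conditions only.
   The integral is therefore taken in L^2. *)
definition has_L2_integral ::
    "(real \<Rightarrow> real \<Rightarrow> complex) \<Rightarrow> (real \<Rightarrow> complex) \<Rightarrow> real set \<Rightarrow> bool" where
  "has_L2_integral F h S \<longleftrightarrow> h \<in> L2 I01 \<and>
     (\<forall>g\<in>L2 I01. has_bochner_integral (lebesgue_on S) (\<lambda>\<tau>. L2_inner (F \<tau>) g) (L2_inner h g))"

definition continuous_H3_0 :: "real \<Rightarrow> (real \<Rightarrow> real \<Rightarrow> complex) \<Rightarrow> bool" where
  "continuous_H3_0 T \<psi> \<longleftrightarrow> (\<forall>t\<in>{0..T}. \<psi> t \<in> H3_0 \<and>
     ((\<lambda>s. H3_0_norm (\<lambda>x. \<psi> s x - \<psi> t x)) \<longlongrightarrow> 0) (at t within {0..T}))"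

(* The boundary conditions psi(t,0) = psi(t,1) = 0 are contained in the membership in H3_0. *)
definition mild_solution ::
    "(real \<Rightarrow> real) \<Rightarrow> (real \<Rightarrow> real) \<Rightarrow> real \<Rightarrow> (real \<Rightarrow> complex) \<Rightarrow> (real \<Rightarrow> real \<Rightarrow> complex) \<Rightarrow> bool" where
  "mild_solution \<mu> u T \<psi>0 \<psi> \<longleftrightarrow> continuous_H3_0 T \<psi> \<and>
     (\<forall>t\<in>{0..T}. \<exists>J.
        has_L2_integral
          (\<lambda>\<tau>. free_prop (t - \<tau>) (\<lambda>x. complex_of_real (u \<tau> * \<mu> x) * \<psi> \<tau> x)) J {0..t} \<and>
        L2_eq (\<psi> t) (\<lambda>x. free_prop t \<psi>0 x + \<i> * J x))"


(* The inner product is real here because g and phi k are real-valued. *)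
definition diag :: "(real \<Rightarrow> real) \<Rightarrow> nat \<Rightarrow> real" where
  "diag g k = Re (L2_inner (\<lambda>x. complex_of_real (g x) * phi k x) (phi k))"

(* The second argument is the (weak) derivative of the first. *)
definition B_coeff :: "(real \<Rightarrow> real) \<Rightarrow> (real \<Rightarrow> real) \<Rightarrow> real" where
  "B_coeff \<mu> \<mu>' =
     (diag \<mu> 3 - diag \<mu> 2) * diag (\<lambda>x. (\<mu>' x)\<^sup>2) 1
   + (diag \<mu> 1 - diag \<mu> 3) * diag (\<lambda>x. (\<mu>' x)\<^sup>2) 2
   + (diag \<mu> 2 - diag \<mu> 1) * diag (\<lambda>x. (\<mu>' x)\<^sup>2) 3"

end

theory Submission
  imports Defs
begin

text \<open>Put \<open>s(t) = \<integral>\<^sub>0\<^sup>t u\<close>, \<open>\<sigma> = \<integral>\<^sub>0\<^sup>T s\<^sup>2\<close>, \<open>a\<^sub>j = \<langle>\<mu> \<phi>\<^sub>j, \<phi>\<^sub>j\<rangle>\<close>, \<open>m\<^sub>j = \<langle>\<mu>'\<^sup>2 \<phi>\<^sub>j, \<phi>\<^sub>j\<rangle>\<close>,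
  and compare \<open>\<psi>\<^sup>j\<close> with the gauged profile \<open>\<chi>\<^sub>j = e\<^bsup>i s \<mu>\<^esup> \<Phi>\<^sub>j\<close>. The latter solves the controlled equation up
  to the source \<open>R\<^sub>j = (A - \<lambda>\<^sub>j) \<chi>\<^sub>j\<close>, which contains \<open>s\<close> but not \<open>u\<close> and is bounded by a multiple of
  \<open>|s|\<close> in \<open>L\<^sup>2\<close>. An energy estimate gives \<open>\<parallel>\<psi>\<^sup>j - \<chi>\<^sub>j\<parallel> = O(\<integral>|s|)\<close>, and since
  \<open>\<langle>\<chi>\<^sub>j, R\<^sub>j\<rangle> = s\<^sup>2 m\<^sub>j\<close>, pairing \<open>\<psi>\<^sup>j\<close> with \<open>\<chi>\<^sub>j\<close> yields
  \<open>\<langle>\<psi>\<^sup>j(T), \<chi>\<^sub>j(T)\<rangle> = 1 - i m\<^sub>j \<sigma> + O(T \<sigma>)\<close>. At a target with phases \<open>c\<^sub>1 = c\<^sub>2\<close> and \<open>c\<^sub>3 = c\<^sub>1 \<rho>\<close> the left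
  side is \<open>c\<^sub>j (1 - i s(T) a\<^sub>j + O(s(T)\<^sup>2))\<close>. The cases \<open>j = 1, 2\<close> and \<open>a\<^sub>1 \<noteq> a\<^sub>2\<close> force \<open>s(T) = O(\<sigma>)\<close>;
  the combination of the three imaginary parts that cancels the terms linear in \<open>s(T)\<close> then equals
  \<open>- B \<sigma> + o(\<sigma>)\<close>, whereas the choice of \<open>\<beta>\<close> makes it nonzero with the sign of \<open>B\<close>.\<close>

text \<open>The control is small only in \<open>L^2\<close>, and \<open>\<sigma>\<close> can be far
  smaller than the squared norm of \<open>u\<close>, since an oscillating control has a small
  primitive. Remainders of an expansion in powers of \<open>u\<close> need not be dominated by
  \<open>\<sigma>\<close>; the gauge factor absorbs \<open>u\<close> into \<open>s\<close>, and all
  errors are then measured by \<open>s\<close> alone. Two estimates are combined because the energy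
  bound is only of size \<open>sqrt (T * \<sigma>)\<close>; paired once more with a source that is
  itself linear in \<open>s\<close> it becomes quadratic, and the factor \<open>T\<close> produced
  by Cauchy-Schwarz is what makes a short horizon help. The gauged profile vanishes at the end
  points but need not satisfy the higher boundary conditions of \<open>H3_0\<close>. The equations
  are therefore read off on single Fourier coefficients, where Green's formula against
  \<open>phi k\<close> suffices, and are reassembled by Parseval. In time \<open>u\<close> is merely
  integrable, so derivatives are replaced by integral identities.\<close>

lemma square_integrable_mult:
  fixes f g :: "'a \<Rightarrow> 'b::{real_normed_div_algebra, banach, second_countable_topology}"
  assumes [measurable]: "f \<in> borel_measurable M" "g \<in> borel_measurable M"
    and f: "integrable M (\<lambda>x. (norm (f x))\<^sup>2)" and g: "integrable M (\<lambda>x. (norm (g x))\<^sup>2)"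
  shows "integrable M (\<lambda>x. f x * g x)"
proof (rule Bochner_Integration.integrable_bound)
  show "integrable M (\<lambda>x. (norm (f x))\<^sup>2 + (norm (g x))\<^sup>2)"
    using f g by simp
  have "norm (f x) * norm (g x) \<le> (norm (f x))\<^sup>2 + (norm (g x))\<^sup>2" for x
    using sum_squares_bound[of "norm (f x)" "norm (g x)"]
      mult_nonneg_nonneg[OF norm_ge_zero[of "f x"] norm_ge_zero[of "g x"]] by linarith
  then show "AE x in M. norm (f x * g x) \<le> norm ((norm (f x))\<^sup>2 + (norm (g x))\<^sup>2)"
    by (auto simp: norm_mult)
qed simp

text \<open>Evaluate at the minimiser \<open>B / C\<close>. The case \<open>C = 0\<close> has to be
  kept, since \<open>C\<close> becomes the squared norm of a function that may vanish almost
  everywhere.\<close>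

lemma discriminant_nonpos:
  fixes A B C :: real
  assumes "\<And>t. 0 \<le> A - 2 * t * B + t\<^sup>2 * C" "0 \<le> C"
  shows "B\<^sup>2 \<le> A * C"
proof (cases "C = 0")
  case True
  have "B = 0"
  proof (rule ccontr)
    assume "B \<noteq> 0"
    \<comment> \<open>With \<open>C = 0\<close> this argument turns the expression into
      \<open>A - (A + 1) = -1\<close>.\<close>
    then show False using assms(1)[of "(A + 1) / (2 * B)"] True by (simp add: field_simps)
  qed
  then show ?thesis using True by simp
next
  case False
  then have "0 < C" using assms(2) by simp
  then show ?thesis using assms(1)[of "B / C"] by (simp add: field_simps power2_eq_square)
qed

text \<open>The discriminant of the nonnegative polynomial that maps \<open>t\<close> to the
  integral of \<open>(norm f - t * norm g)^2\<close>. Norms stand under the integral so that one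
  version serves the complex inner product in space and real functions of time.\<close>

lemma cauchy_schwarz_integral:
  fixes f g :: "'a \<Rightarrow> 'b::{real_normed_div_algebra, banach, second_countable_topology}"
  assumes [measurable]: "f \<in> borel_measurable M" "g \<in> borel_measurable M"
    and f: "integrable M (\<lambda>x. (norm (f x))\<^sup>2)" and g: "integrable M (\<lambda>x. (norm (g x))\<^sup>2)"
  shows "(\<integral>x. norm (f x) * norm (g x) \<partial>M) \<le>
    sqrt (\<integral>x. (norm (f x))\<^sup>2 \<partial>M) * sqrt (\<integral>x. (norm (g x))\<^sup>2 \<partial>M)"
proof -
  have fg: "integrable M (\<lambda>x. norm (f x) * norm (g x))"
    using integrable_norm[OF square_integrable_mult[OF assms]] by (simp add: norm_mult)
  have "(\<integral>x. norm (f x) * norm (g x) \<partial>M)\<^sup>2 \<le> (\<integral>x. (norm (f x))\<^sup>2 \<partial>M) * (\<integral>x. (norm (g x))\<^sup>2 \<partial>M)"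
  proof (rule discriminant_nonpos)
    fix t :: real
    have "0 \<le> (\<integral>x. (norm (f x) - t * norm (g x))\<^sup>2 \<partial>M)" by simp
    also have "\<dots> = (\<integral>x. (norm (f x))\<^sup>2 - 2 * t * (norm (f x) * norm (g x)) + t\<^sup>2 * (norm (g x))\<^sup>2 \<partial>M)"
      by (intro Bochner_Integration.integral_cong) (auto simp: power2_eq_square algebra_simps)
    also have "\<dots> = (\<integral>x. (norm (f x))\<^sup>2 \<partial>M) - 2 * t * (\<integral>x. norm (f x) * norm (g x) \<partial>M)
      + t\<^sup>2 * (\<integral>x. (norm (g x))\<^sup>2 \<partial>M)"
      using f g fg by simp
    finally show "0 \<le> (\<integral>x. (norm (f x))\<^sup>2 \<partial>M) - 2 * t * (\<integral>x. norm (f x) * norm (g x) \<partial>M)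
      + t\<^sup>2 * (\<integral>x. (norm (g x))\<^sup>2 \<partial>M)" .
  qed simp
  then show ?thesis
    by (metis real_le_rsqrt real_sqrt_mult)
qed

subsection \<open>Square integrable functions on the unit interval\<close>

abbreviation leb :: "real \<Rightarrow> real measure" where "leb t \<equiv> lebesgue_on {0..t}"

abbreviation M01 :: "real measure" where "M01 \<equiv> lebesgue_on I01"

lemma finite_measure_M01: "finite_measure M01"
  by (rule finite_measure_lebesgue_on) simp

lemma measure_M01: "measure M01 I01 = 1"
  by (simp add: measure_restrict_space)

lemma integrable_const_M01 [simp]: "integrable M01 (\<lambda>x. c)"
  by (rule finite_measure.integrable_const[OF finite_measure_M01])

lemma L2_measurable: "f \<in> L2 S \<Longrightarrow> f \<in> borel_measurable (lebesgue_on S)"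
  by (simp add: L2_def)

lemma L2_square_integrable: "f \<in> L2 S \<Longrightarrow> integrable (lebesgue_on S) (\<lambda>x. (norm (f x))\<^sup>2)"
  by (simp add: L2_def)

lemma L2_bound:
  assumes [measurable]: "f \<in> borel_measurable (lebesgue_on S)" and g: "g \<in> L2 S"
    and le: "AE x in lebesgue_on S. norm (f x) \<le> c * norm (g x)"
  shows "f \<in> L2 S"
proof -
  have "integrable (lebesgue_on S) (\<lambda>x. (norm (f x))\<^sup>2)"
  proof (rule Bochner_Integration.integrable_bound)
    show "integrable (lebesgue_on S) (\<lambda>x. c\<^sup>2 * (norm (g x))\<^sup>2)"
      using g by (simp add: L2_def)
    show "AE x in lebesgue_on S. norm ((norm (f x))\<^sup>2) \<le> norm (c\<^sup>2 * (norm (g x))\<^sup>2)"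
      using le
    proof eventually_elim
      case (elim x)
      then have "(norm (f x))\<^sup>2 \<le> (c * norm (g x))\<^sup>2" by (intro power_mono) auto
      then show ?case by (simp add: power_mult_distrib)
    qed
  qed simp
  then show ?thesis by (simp add: L2_def)
qed

lemma L2_add:
  fixes f g :: "real \<Rightarrow> 'a::{real_normed_vector, second_countable_topology}"
  assumes f: "f \<in> L2 S" and g: "g \<in> L2 S"
  shows "(\<lambda>x. f x + g x) \<in> L2 S"
proof -
  have [measurable]: "f \<in> borel_measurable (lebesgue_on S)" "g \<in> borel_measurable (lebesgue_on S)"
    using f g by (auto intro: L2_measurable)
  have "integrable (lebesgue_on S) (\<lambda>x. (norm (f x + g x))\<^sup>2)"
  proof (rule Bochner_Integration.integrable_bound)
    show "integrable (lebesgue_on S) (\<lambda>x. 2 * (norm (f x))\<^sup>2 + 2 * (norm (g x))\<^sup>2)"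
      using f g by (simp add: L2_def)
    have "(norm (f x + g x))\<^sup>2 \<le> 2 * (norm (f x))\<^sup>2 + 2 * (norm (g x))\<^sup>2" for x
    proof -
      have "(norm (f x + g x))\<^sup>2 \<le> (norm (f x) + norm (g x))\<^sup>2"
        by (intro power_mono norm_triangle_ineq) simp
      also have "\<dots> \<le> 2 * (norm (f x))\<^sup>2 + 2 * (norm (g x))\<^sup>2"
        using sum_squares_bound[of "norm (f x)" "norm (g x)"] by (simp add: power2_sum)
      finally show ?thesis .
    qed
    then show "AE x in lebesgue_on S. norm ((norm (f x + g x))\<^sup>2) \<le> norm (2 * (norm (f x))\<^sup>2 + 2 * (norm (g x))\<^sup>2)"
      by auto
  qed simp
  then show ?thesis by (simp add: L2_def)
qed

lemma L2_mult_bounded: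
  fixes f h :: "real \<Rightarrow> 'a::{real_normed_div_algebra, second_countable_topology}"
  assumes f: "f \<in> L2 S" and h: "h \<in> borel_measurable (lebesgue_on S)"
    and le: "AE x in lebesgue_on S. norm (h x) \<le> c"
  shows "(\<lambda>x. h x * f x) \<in> L2 S"
proof (rule L2_bound[OF _ f, where c = c])
  have [measurable]: "f \<in> borel_measurable (lebesgue_on S)" "h \<in> borel_measurable (lebesgue_on S)"
    using f h by (auto intro: L2_measurable)
  show "(\<lambda>x. h x * f x) \<in> borel_measurable (lebesgue_on S)" by measurable
  show "AE x in lebesgue_on S. norm (h x * f x) \<le> c * norm (f x)"
    using le by eventually_elim (auto simp: norm_mult intro: mult_right_mono)
qed

lemma L2_scale:
  fixes f :: "real \<Rightarrow> 'a::{real_normed_div_algebra, second_countable_topology}"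
  shows "f \<in> L2 S \<Longrightarrow> (\<lambda>x. c * f x) \<in> L2 S"
  using L2_mult_bounded[of f S "\<lambda>x. c" "norm c"] by simp

lemma L2_diff:
  fixes f g :: "real \<Rightarrow> 'a::{real_normed_div_algebra, second_countable_topology}"
  assumes f: "f \<in> L2 S" and g: "g \<in> L2 S"
  shows "(\<lambda>x. f x - g x) \<in> L2 S"
  using L2_add[OF f L2_scale[OF g, of "-1"]] by simp

lemma L2_zero [simp]: "(\<lambda>x. 0) \<in> L2 S"
  by (simp add: L2_def)

lemma L2_sum:
  fixes f :: "'b \<Rightarrow> real \<Rightarrow> 'a::{real_normed_vector, second_countable_topology}"
  shows "(\<And>k. k \<in> A \<Longrightarrow> f k \<in> L2 S) \<Longrightarrow> (\<lambda>x. \<Sum>k\<in>A. f k x) \<in> L2 S"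
  by (induction A rule: infinite_finite_induct) (auto intro!: L2_add)

lemma L2_bounded:
  assumes [measurable]: "f \<in> borel_measurable M01" and "AE x in M01. norm (f x) \<le> c"
  shows "f \<in> L2 I01"
proof (rule L2_bound)
  show "(\<lambda>x. 1::real) \<in> L2 I01" by (simp add: L2_def)
qed (use assms in auto)

lemma L2_of_real: "f \<in> L2 S \<Longrightarrow> (\<lambda>x. complex_of_real (f x)) \<in> L2 S"
  by (auto simp: L2_def)

lemma L2_cong_AE:
  fixes f g :: "real \<Rightarrow> complex"
  assumes "f \<in> L2 S" "g \<in> borel_measurable (lebesgue_on S)" "AE x in lebesgue_on S. f x = g x"
  shows "g \<in> L2 S"
  by (rule L2_bound[OF assms(2,1), where c = 1]) (use assms(3) in auto)

lemma continuous_on_measurable_M01: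
  fixes f :: "real \<Rightarrow> 'a::euclidean_space"
  assumes "continuous_on {0..1} f"
  shows "f \<in> borel_measurable M01"
  by (intro continuous_imp_measurable_on_sets_lebesgue continuous_on_subset[OF assms]) auto

lemma continuous_on_L2:
  fixes f :: "real \<Rightarrow> 'a::euclidean_space"
  assumes "continuous_on {0..1} f"
  shows "f \<in> L2 I01"
proof -
  have "bounded (f ` {0..1})"
    using assms by (intro compact_imp_bounded compact_continuous_image) auto
  then obtain c where "\<And>x. x \<in> {0..1} \<Longrightarrow> norm (f x) \<le> c" unfolding bounded_iff by blast
  then show ?thesis
    using assms by (intro L2_bounded[where c = c] continuous_on_measurable_M01 AE_I2) auto
qed

lemma L2_integrable_mult:
  fixes f g :: "real \<Rightarrow> 'b::{real_normed_div_algebra, banach, second_countable_topology}"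
  assumes "f \<in> L2 S" "g \<in> L2 S"
  shows "integrable (lebesgue_on S) (\<lambda>x. f x * g x)"
  using assms by (intro square_integrable_mult) (auto simp: L2_def)

lemma L2_integrable:
  fixes f :: "real \<Rightarrow> 'b::{real_normed_div_algebra, banach, second_countable_topology}"
  assumes "f \<in> L2 I01"
  shows "integrable M01 f"
  using L2_integrable_mult[OF assms, of "\<lambda>x. 1"] by (auto simp: L2_def)

lemma borel_measurable_cnj [measurable (raw)]:
  "f \<in> borel_measurable M \<Longrightarrow> (\<lambda>x. cnj (f x)) \<in> borel_measurable M"
  by (rule borel_measurable_continuous_on[where f = cnj]) (auto intro: continuous_intros)

lemma L2_cnj: "f \<in> L2 S \<Longrightarrow> (\<lambda>x. cnj (f x)) \<in> L2 S"
  by (auto simp: L2_def)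

lemma L2_inner_integrable:
  "f \<in> L2 I01 \<Longrightarrow> g \<in> L2 I01 \<Longrightarrow> integrable M01 (\<lambda>x. f x * cnj (g x))"
  by (intro L2_integrable_mult L2_cnj)

lemma L2_inner_cong_AE:
  assumes "AE x in M01. f x = f' x" "AE x in M01. g x = g' x"
    and "f \<in> borel_measurable M01" "g \<in> borel_measurable M01"
        "f' \<in> borel_measurable M01" "g' \<in> borel_measurable M01"
  shows "L2_inner f g = L2_inner f' g'"
  unfolding L2_inner_def
  by (rule integral_cong_AE) (use assms in auto)

lemma L2_inner_add_left:
  "f \<in> L2 I01 \<Longrightarrow> g \<in> L2 I01 \<Longrightarrow> h \<in> L2 I01 \<Longrightarrow>
    L2_inner (\<lambda>x. f x + g x) h = L2_inner f h + L2_inner g h"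
  unfolding L2_inner_def using L2_inner_integrable[of f h] L2_inner_integrable[of g h]
  by (simp add: distrib_right)

lemma L2_inner_diff_left:
  "f \<in> L2 I01 \<Longrightarrow> g \<in> L2 I01 \<Longrightarrow> h \<in> L2 I01 \<Longrightarrow>
    L2_inner (\<lambda>x. f x - g x) h = L2_inner f h - L2_inner g h"
  unfolding L2_inner_def using L2_inner_integrable[of f h] L2_inner_integrable[of g h]
  by (simp add: left_diff_distrib)

lemma L2_inner_scale_left: "L2_inner (\<lambda>x. c * f x) h = c * L2_inner f h"
  unfolding L2_inner_def by (simp add: mult.assoc)

lemma L2_inner_zero_left [simp]: "L2_inner (\<lambda>x. 0) h = 0"
  unfolding L2_inner_def by simp

lemma L2_inner_commute: "L2_inner f g = cnj (L2_inner g f)"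
  unfolding L2_inner_def by (simp flip: Bochner_Integration.integral_cnj add: mult.commute)

lemma L2_inner_add_right:
  "f \<in> L2 I01 \<Longrightarrow> g \<in> L2 I01 \<Longrightarrow> h \<in> L2 I01 \<Longrightarrow>
    L2_inner h (\<lambda>x. f x + g x) = L2_inner h f + L2_inner h g"
  by (subst (1 2 3) L2_inner_commute) (simp add: L2_inner_add_left)

lemma L2_inner_diff_right:
  "f \<in> L2 I01 \<Longrightarrow> g \<in> L2 I01 \<Longrightarrow> h \<in> L2 I01 \<Longrightarrow>
    L2_inner h (\<lambda>x. f x - g x) = L2_inner h f - L2_inner h g"
  by (subst (1 2 3) L2_inner_commute) (simp add: L2_inner_diff_left)

lemma L2_inner_scale_right: "L2_inner h (\<lambda>x. c * f x) = cnj c * L2_inner h f"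
  by (subst (1 2) L2_inner_commute) (simp add: L2_inner_scale_left)

lemma L2_inner_sum_left:
  assumes "\<And>k. k \<in> A \<Longrightarrow> f k \<in> L2 I01" "h \<in> L2 I01"
  shows "L2_inner (\<lambda>x. \<Sum>k\<in>A. f k x) h = (\<Sum>k\<in>A. L2_inner (f k) h)"
  using assms
  by (induction A rule: infinite_finite_induct) (auto simp: L2_inner_add_left L2_sum)

lemma L2_norm_nonneg [simp]: "0 \<le> L2_norm S f"
  by (simp add: L2_norm_def)

lemma L2_inner_self: "L2_inner f f = of_real ((L2_norm I01 f)\<^sup>2)"
proof -
  have "L2_inner f f = (\<integral>x. complex_of_real ((cmod (f x))\<^sup>2) \<partial>M01)"
    unfolding L2_inner_def by (intro Bochner_Integration.integral_cong) (auto simp flip: complex_norm_square)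
  also have "\<dots> = of_real (\<integral>x. (cmod (f x))\<^sup>2 \<partial>M01)"
    by (rule integral_complex_of_real)
  also have "\<dots> = of_real ((L2_norm I01 f)\<^sup>2)" by (simp add: L2_norm_def)
  finally show ?thesis .
qed

lemma L2_cauchy_schwarz:
  assumes "f \<in> L2 I01" "g \<in> L2 I01"
  shows "cmod (L2_inner f g) \<le> L2_norm I01 f * L2_norm I01 g"
proof -
  have "cmod (L2_inner f g) \<le> (\<integral>x. cmod (f x) * cmod (g x) \<partial>M01)"
    unfolding L2_inner_def
    by (rule order_trans[OF integral_norm_bound]) (simp add: norm_mult)
  also have "\<dots> \<le> L2_norm I01 f * L2_norm I01 g"
    unfolding L2_norm_def using assms by (intro cauchy_schwarz_integral) (auto simp: L2_def)
  finally show ?thesis .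
qed

lemma L2_norm_triangle:
  assumes f: "f \<in> L2 I01" and g: "g \<in> L2 I01"
  shows "L2_norm I01 (\<lambda>x. f x + g x :: complex) \<le> L2_norm I01 f + L2_norm I01 g"
proof (rule power2_le_imp_le)
  have "complex_of_real ((L2_norm I01 (\<lambda>x. f x + g x))\<^sup>2)
    = of_real ((L2_norm I01 f)\<^sup>2) + of_real ((L2_norm I01 g)\<^sup>2) + L2_inner f g + cnj (L2_inner f g)"
    using f g unfolding L2_inner_self[symmetric] L2_inner_commute[of g f, symmetric]
    by (simp add: L2_inner_add_left L2_inner_add_right L2_add)
  then have "(L2_norm I01 (\<lambda>x. f x + g x))\<^sup>2
    = (L2_norm I01 f)\<^sup>2 + (L2_norm I01 g)\<^sup>2 + 2 * Re (L2_inner f g)"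
    by (simp add: complex_eq_iff)
  also have "\<dots> \<le> (L2_norm I01 f + L2_norm I01 g)\<^sup>2"
    using L2_cauchy_schwarz[OF f g] complex_Re_le_cmod[of "L2_inner f g"] by (simp add: power2_sum)
  finally show "(L2_norm I01 (\<lambda>x. f x + g x))\<^sup>2 \<le> (L2_norm I01 f + L2_norm I01 g)\<^sup>2" .
qed simp

lemma L2_norm_scale: "L2_norm S (\<lambda>x. c * f x :: complex) = cmod c * L2_norm S f"
  unfolding L2_norm_def by (simp add: norm_mult power_mult_distrib real_sqrt_mult)

lemma L2_norm_minus_commute: "L2_norm S (\<lambda>x. f x - g x) = L2_norm S (\<lambda>x. g x - f x)"
  unfolding L2_norm_def by (simp add: norm_minus_commute)

lemma L2_norm_mult_bounded:
  assumes f: "f \<in> L2 I01" and h: "h \<in> borel_measurable M01"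
    and le: "AE x in M01. cmod (h x) \<le> c" and c: "0 \<le> c"
  shows "L2_norm I01 (\<lambda>x. h x * f x) \<le> c * L2_norm I01 f"
proof -
  have "(\<integral>x. (cmod (h x * f x))\<^sup>2 \<partial>M01) \<le> (\<integral>x. c\<^sup>2 * (cmod (f x))\<^sup>2 \<partial>M01)"
  proof (rule integral_mono_AE)
    show "integrable M01 (\<lambda>x. (cmod (h x * f x))\<^sup>2)"
      using L2_mult_bounded[OF f h le] by (simp add: L2_def)
    show "integrable M01 (\<lambda>x. c\<^sup>2 * (cmod (f x))\<^sup>2)" using f by (simp add: L2_def)
    show "AE x in M01. (cmod (h x * f x))\<^sup>2 \<le> c\<^sup>2 * (cmod (f x))\<^sup>2"
      using le by eventually_elim (auto simp: norm_mult power_mult_distrib intro!: mult_right_mono power_mono)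
  qed
  then have "L2_norm I01 (\<lambda>x. h x * f x) \<le> sqrt (c\<^sup>2 * (\<integral>x. (cmod (f x))\<^sup>2 \<partial>M01))"
    unfolding L2_norm_def by simp
  also have "\<dots> = c * L2_norm I01 f"
    using c by (simp add: L2_norm_def real_sqrt_mult)
  finally show ?thesis .
qed

subsection \<open>The Dirichlet eigenbasis\<close>

lemma integral_M01_eq:
  fixes f :: "real \<Rightarrow> 'a::euclidean_space"
  assumes "integrable M01 f"
  shows "(\<integral>x. f x \<partial>M01) = integral {0..1} f"
  using lebesgue_integral_eq_integral[OF assms] integral_open_interval_real[of 0 1 f] by simp

lemma integral_M01_FTC:
  fixes F :: "real \<Rightarrow> 'a::euclidean_space"
  assumes "\<And>x. x \<in> {0..1} \<Longrightarrow> (F has_vector_derivative f x) (at x within {0..1})"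
    and "continuous_on {0..1} f"
  shows "(\<integral>x. f x \<partial>M01) = F 1 - F 0"
proof -
  have "integrable M01 f"
  proof (rule absolutely_integrable_imp_integrable)
    have "f absolutely_integrable_on {0..1}"
      by (rule absolutely_integrable_continuous_real[OF assms(2)])
    then show "f absolutely_integrable_on I01"
      by (simp add: absolutely_integrable_on_Icc_iff_Ioo)
  qed simp
  then show ?thesis
    using fundamental_theorem_of_calculus[of 0 1 F f] assms(1)
    by (simp add: integral_M01_eq integral_unique)
qed

lemma continuous_on_phi [continuous_intros]: "continuous_on A (phi k)"
  unfolding phi_def by (intro continuous_intros)

lemma phi_L2 [simp]: "phi k \<in> L2 I01"
  by (intro continuous_on_L2 continuous_intros)

lemma phi_measurable [measurable]: "phi k \<in> borel_measurable M01"
  by (rule L2_measurable) simp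

lemma cnj_phi [simp]: "cnj (phi k x) = phi k x"
  by (simp add: phi_def)

lemma norm_phi_le: "cmod (phi k x) \<le> sqrt 2"
  unfolding phi_def norm_of_real by (simp add: abs_mult)

text \<open>\<open>m\<close> is an integer because orthogonality needs the frequency
  \<open>j - k\<close> as well as \<open>j + k\<close>. For \<open>m \<noteq> 0\<close> the sine
  primitive vanishes at both end points.\<close>

lemma integral_cos_M01:
  "(\<integral>x. cos (of_int m * pi * x) \<partial>M01) = (if m = 0 then 1 else 0)"
proof (cases "m = 0")
  case False
  have "(\<integral>x. cos (of_int m * pi * x) \<partial>M01)
    = sin (of_int m * pi * 1) / (of_int m * pi) - sin (of_int m * pi * 0) / (of_int m * pi)"
  proof (rule integral_M01_FTC)
    fix x :: real
    show "((\<lambda>x. sin (of_int m * pi * x) / (of_int m * pi)) has_vector_derivative cos (of_int m * pi * x))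
      (at x within {0..1})"
      unfolding has_real_derivative_iff_has_vector_derivative[symmetric]
      by (auto intro!: derivative_eq_intros simp: False)
  qed (intro continuous_intros)
  then show ?thesis using False by (simp add: mult.commute[of _ pi])
qed (simp add: measure_M01)

text \<open>By \<open>2 sin x sin y = cos (x - y) - cos (x + y)\<close> only integrals of cosines
  remain; the frequency \<open>j + k\<close> is never zero, and \<open>j - k\<close> only on the
  diagonal.\<close>

lemma phi_orthonormal:
  assumes "j \<ge> 1" "k \<ge> 1"
  shows "L2_inner (phi j) (phi k) = (if j = k then 1 else 0)"
proof -
  have *: "phi j x * cnj (phi k x) =
    of_real (cos (of_int (int j - int k) * pi * x) - cos (of_int (int j + int k) * pi * x))" for x
  proof -
    have "sqrt 2 * sin (real j * pi * x) * (sqrt 2 * sin (real k * pi * x)) =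
       2 * (sin (real j * pi * x) * sin (real k * pi * x))"
      using real_sqrt_mult_self[of 2] by (simp add: mult_ac)
    also have "\<dots> = cos (real j * pi * x - real k * pi * x) - cos (real j * pi * x + real k * pi * x)"
      by (simp add: cos_add cos_diff)
    finally have "complex_of_real (sqrt 2 * sin (real j * pi * x) * (sqrt 2 * sin (real k * pi * x)))
      = of_real (cos (real j * pi * x - real k * pi * x) - cos (real j * pi * x + real k * pi * x))"
      by (rule arg_cong)
    then show ?thesis by (simp add: phi_def ring_distribs)
  qed
  have int: "integrable M01 (\<lambda>x. cos (of_int m * pi * x))" for m
    by (intro L2_integrable continuous_on_L2 continuous_intros)
  show ?thesis
    unfolding L2_inner_def * integral_complex_of_real
    using assms int by (simp only: integral_cos_M01 Bochner_Integration.integral_diff) auto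
qed

lemma L2_inner_sum_phi:
  assumes "finite A" "A \<subseteq> {1..}" "k \<ge> 1"
  shows "L2_inner (\<lambda>x. \<Sum>j\<in>A. c j * phi j x) (phi k) = (if k \<in> A then c k else 0)"
proof -
  have "L2_inner (\<lambda>x. \<Sum>j\<in>A. c j * phi j x) (phi k) = (\<Sum>j\<in>A. c j * L2_inner (phi j) (phi k))"
    by (subst L2_inner_sum_left) (auto simp: L2_inner_scale_left intro: L2_scale)
  also have "\<dots> = (\<Sum>j\<in>A. if j = k then c j else 0)"
    using assms by (intro sum.cong) (auto simp: phi_orthonormal)
  finally show ?thesis using assms by simp
qed

lemma sum_phi_L2: "(\<lambda>x. \<Sum>j\<in>A. c j * phi j x) \<in> L2 I01"
  by (intro L2_sum L2_scale) simp

lemma L2_inner_sum_phi_right: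
  "L2_inner g (\<lambda>x. \<Sum>j\<in>A. c j * phi j x) = (\<Sum>j\<in>A. cnj (c j) * L2_inner g (phi j))" 
  if "g \<in> L2 I01"
proof -
  have "L2_inner (\<lambda>x. \<Sum>j\<in>A. c j * phi j x) g = (\<Sum>j\<in>A. c j * L2_inner (phi j) g)"
    using that by (subst L2_inner_sum_left) (auto simp: L2_inner_scale_left intro: L2_scale)
  then show ?thesis
    by (subst L2_inner_commute) (simp add: L2_inner_commute[of g])
qed

lemma L2_norm_sum_phi:
  assumes "finite A" "A \<subseteq> {1..}"
  shows "(L2_norm I01 (\<lambda>x. \<Sum>j\<in>A. c j * phi j x))\<^sup>2 = (\<Sum>j\<in>A. (cmod (c j))\<^sup>2)"
proof -
  have "complex_of_real ((L2_norm I01 (\<lambda>x. \<Sum>j\<in>A. c j * phi j x))\<^sup>2) 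
    = (\<Sum>k\<in>A. cnj (c k) * L2_inner (\<lambda>x. \<Sum>j\<in>A. c j * phi j x) (phi k))"
    unfolding L2_inner_self[symmetric] by (rule L2_inner_sum_phi_right[OF sum_phi_L2])
  also have "\<dots> = (\<Sum>k\<in>A. cnj (c k) * c k)"
    using assms by (intro sum.cong refl) (subst L2_inner_sum_phi, auto)
  also have "\<dots> = of_real (\<Sum>j\<in>A. (cmod (c j))\<^sup>2)"
    unfolding of_real_sum by (intro sum.cong refl) (simp only: complex_norm_square mult.commute)
  finally show ?thesis by (simp only: of_real_eq_iff)
qed

text \<open>Expand the squared norm of \<open>f - S\<close>, where \<open>S\<close> is the
  projection of \<open>f\<close>. The products of \<open>f\<close> with \<open>S\<close> and of
  \<open>S\<close> with itself both equal \<open>B\<close>, so the squared norm of \<open>f\<close>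
  minus \<open>B\<close> is left, and it is nonnegative.\<close>

lemma L2_bessel:
  assumes f: "f \<in> L2 I01" and A: "finite A" "A \<subseteq> {1..}"
  shows "(\<Sum>k\<in>A. (cmod (L2_inner f (phi k)))\<^sup>2) \<le> (L2_norm I01 f)\<^sup>2"
proof -
  define S where "S = (\<lambda>x. \<Sum>k\<in>A. L2_inner f (phi k) * phi k x)"
  define B where "B = (\<Sum>k\<in>A. (cmod (L2_inner f (phi k)))\<^sup>2)"
  have S: "S \<in> L2 I01" unfolding S_def by (rule sum_phi_L2)
  have "L2_inner f S = (\<Sum>k\<in>A. cnj (L2_inner f (phi k)) * L2_inner f (phi k))"
    unfolding S_def by (rule L2_inner_sum_phi_right[OF f])
  also have "\<dots> = of_real B"
    unfolding B_def of_real_sum by (intro sum.cong refl) (simp only: complex_norm_square mult.commute)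
  finally have fS: "L2_inner f S = of_real B" .
  have SS: "L2_inner S S = of_real B"
    unfolding L2_inner_self S_def B_def using A by (subst L2_norm_sum_phi) auto
  have "of_real ((L2_norm I01 (\<lambda>x. f x - S x))\<^sup>2) = complex_of_real ((L2_norm I01 f)\<^sup>2 - B)"
    unfolding L2_inner_self[symmetric] of_real_diff
    using f S by (simp add: L2_inner_diff_left L2_inner_diff_right L2_diff fS SS L2_inner_commute[of S f])
  then have "(L2_norm I01 (\<lambda>x. f x - S x))\<^sup>2 = (L2_norm I01 f)\<^sup>2 - B" by (simp only: of_real_eq_iff)
  moreover have "0 \<le> (L2_norm I01 (\<lambda>x. f x - S x))\<^sup>2" by simp
  ultimately show ?thesis unfolding B_def by linarith
qed

section \<open>Completeness of the sine system\<close>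

text \<open>Lebesgue differentiation: off a negligible set \<open>h x\<close> is the limit of the
  means of \<open>h\<close> over \<open>[x, x + r]\<close>, and each such mean comes from a
  difference of two vanishing integrals.\<close>

lemma integral_zero_imp_AE_zero:
  fixes h :: "real \<Rightarrow> complex"
  assumes h: "integrable M01 h"
    and 0: "\<And>a. 0 < a \<Longrightarrow> a < 1 \<Longrightarrow> integral {0..a} h = 0"
  shows "AE x in M01. h x = 0"
proof -
  \<comment> \<open>Extension by zero: the differentiation result asks for integrability over every
    bounded interval.\<close>
  define h0 where "h0 = (\<lambda>x. if x \<in> {0..1} then h x else 0)"
  have h01: "h integrable_on {0..1}"
    using integrable_on_lebesgue_on[OF h] integrable_on_open_interval_real[of h 0 1] by simp
  then have "h0 integrable_on UNIV"
    unfolding h0_def using integrable_restrict_UNIV by blast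
  then have "h0 integrable_on cbox a b" for a b
    by (rule integrable_on_subcbox) auto
  then obtain N where N: "negligible N"
    and lim: "\<And>x e. \<lbrakk>x \<notin> N; 0 < e\<rbrakk> \<Longrightarrow> \<exists>d>0. \<forall>r. 0 < r \<and> r < d \<longrightarrow>
      norm (integral (cbox x (x + r *\<^sub>R One)) h0 /\<^sub>R r ^ DIM(real) - h0 x) < e"
    using integrable_ccontinuous_explicit by blast
  have hz: "h x = 0" if x: "x \<in> I01" "x \<notin> N" for x
  proof (rule ccontr)
    assume "h x \<noteq> 0"
    then obtain d where d: "d > 0"
      "\<And>r. 0 < r \<and> r < d \<Longrightarrow> norm (integral (cbox x (x + r *\<^sub>R One)) h0 /\<^sub>R r ^ DIM(real) - h0 x) < norm (h x)"
      using lim[of x "norm (h x)"] x by auto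
    \<comment> \<open>Halving keeps \<open>r\<close> below \<open>d\<close> and \<open>x + r\<close>
      below 1, so that the hypothesis applies at \<open>x + r\<close>.\<close>
    define r where "r = min (d / 2) ((1 - x) / 2)"
    have r: "0 < r" "r < d" "x + r < 1" using d x by (auto simp: r_def min_def field_simps)
    have "integral {x..x + r} h0 = integral {x..x + r} h"
      using r x by (intro integral_cong) (auto simp: h0_def)
    also have "integral {0..x} h + integral {x..x+r} h = integral {0..x + r} h"
      using r x by (intro Henstock_Kurzweil_Integration.integral_combine
        integrable_on_subinterval[OF h01]) auto
    then have "integral {x..x + r} h = 0" using 0 r x by simp
    finally have "norm (h0 x) < norm (h x)" using d(2)[of r] r by simp
    then show False using x by (simp add: h0_def)
  qed
  have "AE x in M01. x \<notin> N"
  proof -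
    have "AE x in lebesgue. x \<notin> N"
      by (rule AE_not_in) (use N in \<open>simp add: negligible_iff_null_sets\<close>)
    then have "AE x in lebesgue. x \<in> I01 \<longrightarrow> x \<notin> N" by eventually_elim simp
    then show ?thesis by (subst AE_restrict_space_iff) auto
  qed
  moreover have "AE x in M01. x \<in> I01" using AE_space[of M01] by simp
  ultimately show ?thesis
    by eventually_elim (rule hz)
qed

text \<open>Continuous functions approximate the indicator of an initial interval boundedly and
  pointwise, so dominated convergence reduces the claim to vanishing integrals over initial
  intervals.\<close>

lemma integral_zero_continuous_imp_AE_zero:
  fixes h :: "real \<Rightarrow> complex"
  assumes h: "integrable M01 h"
    and 0: "\<And>q. continuous_on {0..1} q \<Longrightarrow> (\<integral>x. of_real (q x) * h x \<partial>M01) = 0"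
  shows "AE x in M01. h x = 0"
proof -
  have hm [measurable]: "h \<in> borel_measurable M01" using h by auto
  have ind: "(\<lambda>x. if x \<in> {0<..a} then h x else 0) \<in> borel_measurable M01" if "0 < a" "a < 1" for a
    by (rule measurable_If_set) (use that in \<open>auto simp: sets_restrict_space intro!: image_eqI[where x = "{0<..a}"] hm\<close>)
  have 0: "(\<integral>x. (if x \<in> {0<..a} then h x else 0) \<partial>M01) = 0" if a: "0 < a" "a < 1" for a
  proof -
    \<comment> \<open>Equal to 1 up to and including \<open>a\<close>, then falling with slope
      \<open>n\<close> to 0. Since the value at \<open>a\<close> is always 1, the limit is the
      indicator of the half-open interval \<open>{0<..a}\<close>.\<close>
    define q where "q = (\<lambda>n::nat. \<lambda>x::real. min 1 (max 0 (1 - real n * (x - a))))"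
    have "(\<lambda>n. \<integral>x. of_real (q n x) * h x \<partial>M01) \<longlonglongrightarrow> (\<integral>x. (if x \<in> {0<..a} then h x else 0) \<partial>M01)"
    proof (rule integral_dominated_convergence)
      show "(\<lambda>x. if x \<in> {0<..a} then h x else 0) \<in> borel_measurable M01"
        by (rule ind[OF a])
      show "(\<lambda>x. of_real (q n x) * h x) \<in> borel_measurable M01" for n
        unfolding q_def by (intro borel_measurable_times hm continuous_on_measurable_M01 continuous_intros)
      show "integrable M01 (\<lambda>x. cmod (h x))" using h by simp
      show "AE x in M01. (\<lambda>n. of_real (q n x) * h x) \<longlonglongrightarrow> (if x \<in> {0<..a} then h x else 0)"
      proof (rule AE_I2)
        fix x assume "x \<in> space M01"
        then have x: "0 < x" "x < 1" by auto
        show "(\<lambda>n. of_real (q n x) * h x) \<longlonglongrightarrow> (if x \<in> {0<..a} then h x else 0)"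
        proof (cases "x \<le> a")
          case True
          then have "q n x = 1" for n
            using mult_nonneg_nonpos[of "real n" "x - a"] by (simp add: q_def)
          then show ?thesis using True x by simp
        next
          case False
          obtain N :: nat where N: "1 / (x - a) < real N" using reals_Archimedean2 by blast
          have "q n x = 0" if "n \<ge> N" for n
          proof -
            have "1 / (x - a) < real n" using N that by simp
            then have "1 \<le> real n * (x - a)" using False by (simp add: field_simps)
            then show ?thesis by (simp add: q_def)
          qed
          then have "\<forall>\<^sub>F n in sequentially. of_real (q n x) * h x = 0"
            by (auto simp: eventually_sequentially)
          then show ?thesis using False by (simp add: tendsto_eventually)
        qed
      qed
      show "AE x in M01. cmod (of_real (q n x) * h x) \<le> cmod (h x)" for n
        by (auto simp: norm_mult q_def intro!: AE_I2 mult_left_le_one_le)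
    qed
    moreover have "continuous_on {0..1} (q n)" for n
      unfolding q_def by (intro continuous_intros)
    ultimately show ?thesis by (simp add: 0 LIMSEQ_const_iff)
  qed
  show ?thesis
  proof (rule integral_zero_imp_AE_zero[OF h])
    fix a :: real assume a: "0 < a" "a < 1"
    have "integral {0..a} h = integral {0<..<1} (\<lambda>x. if x \<in> {0<..a} then h x else 0)"
    proof -
      have "integral {0<..<1} (\<lambda>x. if x \<in> {0<..a} then h x else 0) = integral ({0<..a} \<inter> {0<..<1}) h"
        using Henstock_Kurzweil_Integration.integral_restrict_Int[of "{0<..<1}" "{0<..a}" h] by simp
      also have "{0<..a} \<inter> {0<..<1} = {0<..a}" using a by auto
      also have "integral {0<..a} h = integral {0..a} h"
        by (rule integral_spike_set) (auto intro: negligible_subset[of "{0}"])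
      finally show ?thesis ..
    qed
    also have "\<dots> = (\<integral>x. (if x \<in> {0<..a} then h x else 0) \<partial>M01)"
    proof (rule lebesgue_integral_eq_integral[symmetric])
      show "integrable M01 (\<lambda>x. if x \<in> {0<..a} then h x else 0)"
      proof (rule Bochner_Integration.integrable_bound[OF h])
        show "(\<lambda>x. if x \<in> {0<..a} then h x else 0) \<in> borel_measurable M01"
          by (rule ind[OF a])
      qed auto
    qed simp
    finally show "integral {0..a} h = 0" using 0[OF a] by simp
  qed
qed

text \<open>The functions \<open>sin (pi * x)\<close> times a polynomial in
  \<open>cos (pi * x)\<close> are combinations of the \<open>phi k\<close>, and by Weierstrass such
  polynomials approximate every continuous function of \<open>x\<close> uniformly. Hence
  \<open>sin (pi * x) * f x\<close> integrates to zero against every continuous function, and the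
  sine is positive inside the interval.\<close>

lemma phi_complete:
  assumes f: "f \<in> L2 I01" and 0: "\<And>k. k \<ge> 1 \<Longrightarrow> L2_inner f (phi k) = 0"
  shows "AE x in M01. f x = 0"
proof -
  note [measurable] = L2_measurable[OF f]
  have half: "2 * a = b \<Longrightarrow> a = b / 2" for a b :: real by simp
  have fm: "integrable M01 (\<lambda>x. of_real (q x) * f x)" if "continuous_on {0..1} q" for q :: "real \<Rightarrow> real"
    using L2_integrable_mult[OF L2_of_real[OF continuous_on_L2[OF that]] f] .
  \<comment> \<open>Index 0 is included because the induction on the power of the cosine reaches it
    through \<open>k - 1\<close>.\<close>
  have sin0: "(\<integral>x. of_real (sin (real k * pi * x)) * f x \<partial>M01) = 0" for k
  proof (cases "k = 0")
    case False
    have "L2_inner f (phi k) = complex_of_real (sqrt 2) * (\<integral>x. of_real (sin (real k * pi * x)) * f x \<partial>M01)"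
      unfolding L2_inner_def cnj_phi phi_def
      by (simp flip: integral_mult_right_zero add: mult_ac)
    then show ?thesis using 0[of k] False by auto
  qed simp
  have cos0: "(\<integral>x. of_real (sin (real k * pi * x) * cos (pi * x) ^ n) * f x \<partial>M01) = 0" for k n
  proof (induction n arbitrary: k)
    case 0
    then show ?case using sin0 by simp
  next
    case (Suc n)
    show ?case
    proof (cases "k = 0")
      case False
      \<comment> \<open>A product of sine and cosine is half a sum of sines: one power of the cosine
        is traded for the neighbouring frequencies \<open>k + 1\<close> and
        \<open>k - 1\<close>.\<close>
      have eq: "sin (real k * pi * x) * cos (pi * x) ^ Suc n =
        (sin (real (k + 1) * pi * x) * cos (pi * x) ^ n + sin (real (k - 1) * pi * x) * cos (pi * x) ^ n) / 2" for x
      proof -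
        have "sin (real (k + 1) * pi * x) = sin (real k * pi * x + pi * x)"
             "sin (real (k - 1) * pi * x) = sin (real k * pi * x - pi * x)"
          using False by (simp_all add: of_nat_diff algebra_simps)
        then have "2 * (sin (real k * pi * x) * cos (pi * x)) = sin (real (k + 1) * pi * x) + sin (real (k - 1) * pi * x)"
          by (simp add: sin_add sin_diff)
        then have e: "sin (real k * pi * x) * cos (pi * x) = (sin (real (k + 1) * pi * x) + sin (real (k - 1) * pi * x)) / 2"
          by (rule half)
        have "sin (real k * pi * x) * cos (pi * x) ^ Suc n = (sin (real k * pi * x) * cos (pi * x)) * cos (pi * x) ^ n"
          by simp
        then show ?thesis unfolding e by (simp only: distrib_right times_divide_eq_left)
      qed
      have "(\<integral>x. of_real (sin (real k * pi * x) * cos (pi * x) ^ Suc n) * f x \<partial>M01)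
        = (\<integral>x. (of_real (sin (real (k + 1) * pi * x) * cos (pi * x) ^ n) * f x
          + of_real (sin (real (k - 1) * pi * x) * cos (pi * x) ^ n) * f x) / 2 \<partial>M01)"
        unfolding eq by (simp add: field_simps)
      also have "\<dots> = 0"
        unfolding integral_divide_zero
        using Suc.IH[of "k + 1"] Suc.IH[of "k - 1"]
        by (subst Bochner_Integration.integral_add) (auto intro!: fm continuous_intros simp del: of_real_mult of_nat_add of_nat_diff)
      finally show ?thesis .
    qed simp
  qed
  have poly0: "(\<integral>x. of_real (sin (pi * x) * p (cos (pi * x))) * f x \<partial>M01) = 0"
    if rp: "real_polynomial_function p" for p
  proof -
    obtain a n where p: "p = (\<lambda>x. \<Sum>i\<le>n. a i * x ^ i)"
      using rp unfolding real_polynomial_function_iff_sum by blast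
    have "(\<integral>x. of_real (sin (pi * x) * p (cos (pi * x))) * f x \<partial>M01)
      = (\<integral>x. (\<Sum>i\<le>n. of_real (a i) * (of_real (sin (real 1 * pi * x) * cos (pi * x) ^ i) * f x)) \<partial>M01)"
    proof (intro Bochner_Integration.integral_cong refl)
      fix x
      have "sin (pi * x) * p (cos (pi * x)) = (\<Sum>i\<le>n. a i * (sin (real 1 * pi * x) * cos (pi * x) ^ i))"
        unfolding p sum_distrib_left by (intro sum.cong) auto
      then show "of_real (sin (pi * x) * p (cos (pi * x))) * f x =
        (\<Sum>i\<le>n. of_real (a i) * (of_real (sin (real 1 * pi * x) * cos (pi * x) ^ i) * f x))"
        by (simp only: of_real_sum sum_distrib_right of_real_mult mult.assoc)
    qed
    also have "\<dots> = 0"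
    proof (subst Bochner_Integration.integral_sum)
      show "integrable M01 (\<lambda>x. of_real (a i) * (of_real (sin (real 1 * pi * x) * cos (pi * x) ^ i) * f x))" for i
        by (intro integrable_mult_right fm continuous_intros)
    next
      show "(\<Sum>i\<le>n. \<integral>x. of_real (a i) * (of_real (sin (real 1 * pi * x) * cos (pi * x) ^ i) * f x) \<partial>M01) = 0"
        by (simp only: integral_mult_right_zero cos0) simp
    qed
    finally show ?thesis .
  qed
  define h where "h = (\<lambda>x. of_real (sin (pi * x)) * f x)"
  have h: "integrable M01 h" unfolding h_def by (intro fm continuous_intros)
  have csin: "continuous_on {0..1} (\<lambda>x. sin (pi * x))" by (intro continuous_intros)
  have "AE x in M01. h x = 0"
  proof (rule integral_zero_continuous_imp_AE_zero[OF h])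
    fix q :: "real \<Rightarrow> real" assume q: "continuous_on {0..1} q"
    \<comment> \<open>\<open>q\<close> expressed in the variable \<open>cos (pi * x)\<close>, which
      maps the unit interval homeomorphically onto \<open>[-1, 1]\<close>.\<close>
    define Q where "Q = (\<lambda>y. q (arccos y / pi))"
    have Qcos: "Q (cos (pi * x)) = q x" if "x \<in> I01" for x
      using that by (simp add: Q_def arccos_cos)
    have Q: "continuous_on {-1..1} Q"
      unfolding Q_def
    proof (rule continuous_on_compose2[OF q])
      show "continuous_on {-1..1} (\<lambda>y. arccos y / pi)" by (intro continuous_intros) auto
      show "(\<lambda>y. arccos y / pi) ` {-1..1} \<subseteq> {0..1}"
        using arccos_ubound arccos_lbound by (auto simp: field_simps)
    qed
    have qh: "integrable M01 (\<lambda>x. of_real (q x) * h x)"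
      using fm[OF continuous_on_mult[OF q csin]] by (simp add: h_def mult_ac)
    have "cmod (\<integral>x. of_real (q x) * h x \<partial>M01) \<le> e" if e: "e > 0" for e
    proof -
      define I where "I = (\<integral>x. cmod (h x) \<partial>M01)"
      have I: "I \<ge> 0" by (simp add: I_def)
      \<comment> \<open>The tolerance is divided by \<open>I + 1\<close> because \<open>I\<close>
        may be zero.\<close>
      obtain p where p: "real_polynomial_function p" "\<And>y. y \<in> {-1..1} \<Longrightarrow> \<bar>Q y - p y\<bar> < e / (I + 1)"
        using Stone_Weierstrass_real_polynomial_function[OF compact_Icc Q, of "e / (I + 1)"] e I by auto
      have pc: "continuous_on {0..1} (\<lambda>x. p (cos (pi * x)))"
      proof -
        have "continuous_on UNIV p"
          using continuous_real_polymonial_function[OF p(1)] by (simp add: continuous_at_imp_continuous_on)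
        moreover have "continuous_on {0..1} (\<lambda>x. cos (pi * x))" by (intro continuous_intros)
        ultimately show ?thesis by (rule continuous_on_compose2) simp
      qed
      have ph: "integrable M01 (\<lambda>x. of_real (p (cos (pi * x))) * h x)"
        using fm[OF continuous_on_mult[OF pc csin]] by (simp add: h_def mult_ac)
      have "(\<integral>x. of_real (p (cos (pi * x))) * h x \<partial>M01) = 0"
        using poly0[OF p(1)] unfolding h_def by (simp add: mult_ac)
      then have "(\<integral>x. of_real (q x) * h x \<partial>M01) = (\<integral>x. of_real (q x) * h x - of_real (p (cos (pi * x))) * h x \<partial>M01)"
        using qh ph by simp
      also have "cmod \<dots> \<le> (\<integral>x. e / (I + 1) * cmod (h x) \<partial>M01)"
      proof (rule order_trans[OF integral_norm_bound integral_mono])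
        fix x assume "x \<in> space M01"
        then have x: "x \<in> I01" by simp
        have "cmod (of_real (q x) * h x - of_real (p (cos (pi * x))) * h x) = \<bar>Q (cos (pi * x)) - p (cos (pi * x))\<bar> * cmod (h x)"
          unfolding Qcos[OF x] by (simp flip: left_diff_distrib of_real_diff add: norm_mult)
        also have "\<dots> \<le> e / (I + 1) * cmod (h x)"
          using p(2)[of "cos (pi * x)"] by (intro mult_right_mono) auto
        finally show "cmod (of_real (q x) * h x - of_real (p (cos (pi * x))) * h x) \<le> e / (I + 1) * cmod (h x)" .
      qed (use h qh ph in auto)
      also have "\<dots> = e * (I / (I + 1))" by (simp add: I_def)
      also have "\<dots> \<le> e * 1" using I e by (intro mult_left_mono) (auto simp: field_simps)
      finally show ?thesis by simp
    qed
    then have "cmod (\<integral>x. of_real (q x) * h x \<partial>M01) \<le> 0" by (rule field_le_epsilon[where y = 0, simplified])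
    then show "(\<integral>x. of_real (q x) * h x \<partial>M01) = 0" by simp
  qed
  moreover have "AE x in M01. x \<in> I01" using AE_space[of M01] by simp
  ultimately show ?thesis
  proof eventually_elim
    case (elim x)
    then have "0 < sin (pi * x)" by (intro sin_gt_zero) auto
    then show ?case using elim by (simp add: h_def)
  qed
qed

section \<open>Riesz-Fischer theorem, Fourier expansion and Parseval identity\<close>

text \<open>Partial sums are Cauchy in \<open>L^2\<close>, hence in \<open>L^1\<close> on a space of
  measure one, so a subsequence converges almost everywhere. Fatou's lemma carries the tail bound
  over to this limit, which is therefore the \<open>L^2\<close> limit of the whole sequence.\<close>

lemma riesz_fischer:
  assumes c: "summable (\<lambda>k. (cmod (c k))\<^sup>2)"
  shows "\<exists>h. L2_sums (\<lambda>k x. c k * phi k x) h"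
proof -
  define S where "S = (\<lambda>n x. \<Sum>k=1..n. c k * phi k x)"
  \<comment> \<open>The tail of the series after index \<open>m\<close>. The term of index 0
    cancels, so this is also the tail for sums that start at 1.\<close>
  define e where "e = (\<lambda>m. (\<Sum>k. (cmod (c k))\<^sup>2) - (\<Sum>k\<le>m. (cmod (c k))\<^sup>2))"
  have S2: "S n \<in> L2 I01" for n unfolding S_def by (rule sum_phi_L2)
  have Sm [measurable]: "S n \<in> borel_measurable M01" for n by (rule L2_measurable[OF S2])
  have e0: "e \<longlonglongrightarrow> 0"
    using tendsto_diff[OF tendsto_const summable_LIMSEQ'[OF c], of "\<Sum>k. (cmod (c k))\<^sup>2"] by (simp add: e_def)
  have e_nonneg: "0 \<le> e m" for m
    unfolding e_def using sum_le_suminf[OF c, of "{..m}"] by simp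
  have dS: "(L2_norm I01 (\<lambda>x. S n x - S m x))\<^sup>2 \<le> e m" if "m \<le> n" for m n
  proof -
    have "(\<lambda>x. S n x - S m x) = (\<lambda>x. \<Sum>k\<in>{m+1..n}. c k * phi k x)"
    proof
      fix x
      have "{1..n} = {1..m} \<union> {m+1..n}" using that by auto
      then have "S n x = (\<Sum>k\<in>{1..m} \<union> {m+1..n}. c k * phi k x)" unfolding S_def by simp
      also have "\<dots> = S m x + (\<Sum>k\<in>{m+1..n}. c k * phi k x)"
        unfolding S_def by (subst sum.union_disjoint) auto
      finally show "S n x - S m x = (\<Sum>k\<in>{m+1..n}. c k * phi k x)" by simp
    qed
    then have "(L2_norm I01 (\<lambda>x. S n x - S m x))\<^sup>2 = (\<Sum>k\<in>{m+1..n}. (cmod (c k))\<^sup>2)"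
      by (simp only:) (intro L2_norm_sum_phi, auto)
    moreover have "(\<Sum>k\<in>{..m} \<union> {m+1..n}. (cmod (c k))\<^sup>2) \<le> (\<Sum>k. (cmod (c k))\<^sup>2)"
      by (intro sum_le_suminf c) auto
    then have "(\<Sum>k\<in>{..m}. (cmod (c k))\<^sup>2) + (\<Sum>k\<in>{m+1..n}. (cmod (c k))\<^sup>2) \<le> (\<Sum>k. (cmod (c k))\<^sup>2)"
      by (subst (asm) sum.union_disjoint) auto
    ultimately show ?thesis by (simp add: e_def)
  qed
  have L1: "(\<integral>x. norm (S i x - S j x) \<partial>M01) \<le> sqrt (e (min i j))" for i j
  proof -
    have "(\<integral>x. norm (S i x - S j x) * norm (1::complex) \<partial>M01) \<le>
      sqrt (\<integral>x. (norm (S i x - S j x))\<^sup>2 \<partial>M01) * sqrt (\<integral>x. (norm (1::complex))\<^sup>2 \<partial>M01)"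
      by (rule cauchy_schwarz_integral) (use L2_diff[OF S2 S2] in \<open>auto simp: L2_def\<close>)
    then have "(\<integral>x. norm (S i x - S j x) \<partial>M01) \<le> L2_norm I01 (\<lambda>x. S i x - S j x)"
      by (simp add: L2_norm_def measure_M01)
    also have "\<dots> \<le> sqrt (e (min i j))"
    proof (rule real_le_rsqrt, cases "i \<le> j")
      case True
      then show "(L2_norm I01 (\<lambda>x. S i x - S j x))\<^sup>2 \<le> e (min i j)"
        using dS[of i j] by (simp add: min_def L2_norm_minus_commute[of _ "S i"])
    next
      case False
      then show "(L2_norm I01 (\<lambda>x. S i x - S j x))\<^sup>2 \<le> e (min i j)"
        using dS[of j i] by (simp add: min_def)
    qed
    finally show ?thesis .
  qed
  obtain r where r: "strict_mono r" and ae: "AE x in M01. Cauchy (\<lambda>i. S (r i) x)"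
  proof (rule cauchy_L1_AE_cauchy_subseq)
    show "integrable M01 (S n)" for n by (rule L2_integrable[OF S2])
    fix \<epsilon> :: real assume "\<epsilon> > 0"
    then have "\<forall>\<^sub>F m in sequentially. e m < \<epsilon>\<^sup>2"
      using order_tendstoD(2)[OF e0, of "\<epsilon>\<^sup>2"] by simp
    then obtain N where N: "\<And>m. m \<ge> N \<Longrightarrow> e m < \<epsilon>\<^sup>2" by (auto simp: eventually_sequentially)
    have "(\<integral>x. norm (S i x - S j x) \<partial>M01) < \<epsilon>" if "i \<ge> N" "j \<ge> N" for i j
    proof -
      have "sqrt (e (min i j)) < sqrt (\<epsilon>\<^sup>2)" by (rule real_sqrt_less_mono, rule N) (use that in simp)
      then show ?thesis using L1[of i j] \<open>\<epsilon> > 0\<close> by simp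
    qed
    then show "\<exists>N. \<forall>i\<ge>N. \<forall>j\<ge>N. (\<integral>x. norm (S i x - S j x) \<partial>M01) < \<epsilon>" by blast
  qed
  define h where "h = (\<lambda>x. lim (\<lambda>i. S (r i) x))"
  have hm [measurable]: "h \<in> borel_measurable M01"
    unfolding h_def by (rule borel_measurable_lim_metric) measurable
  have lim: "AE x in M01. (\<lambda>i. S (r i) x) \<longlonglongrightarrow> h x"
    using ae by eventually_elim (simp add: h_def Cauchy_convergent_iff convergent_LIMSEQ_iff)
  have fatou: "(\<integral>\<^sup>+x. ennreal ((cmod (S m x - h x))\<^sup>2) \<partial>M01) \<le> ennreal (e m)" for m
  proof -
    have "(\<integral>\<^sup>+x. ennreal ((cmod (S m x - h x))\<^sup>2) \<partial>M01)
      = (\<integral>\<^sup>+x. liminf (\<lambda>i. ennreal ((cmod (S m x - S (r i) x))\<^sup>2)) \<partial>M01)"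
    proof (rule nn_integral_cong_AE)
      show "AE x in M01. ennreal ((cmod (S m x - h x))\<^sup>2) = liminf (\<lambda>i. ennreal ((cmod (S m x - S (r i) x))\<^sup>2))"
        using lim
      proof eventually_elim
        case (elim x)
        then have "(\<lambda>i. ennreal ((cmod (S m x - S (r i) x))\<^sup>2)) \<longlonglongrightarrow> ennreal ((cmod (S m x - h x))\<^sup>2)"
          by (intro tendsto_intros) auto
        then show ?case using lim_imp_Liminf[of sequentially] by (metis trivial_limit_sequentially)
      qed
    qed
    also have "\<dots> \<le> liminf (\<lambda>i. \<integral>\<^sup>+x. ennreal ((cmod (S m x - S (r i) x))\<^sup>2) \<partial>M01)"
      by (rule nn_integral_liminf) measurable
    also have "\<dots> \<le> liminf (\<lambda>i. ennreal (e m))"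
    proof (rule Liminf_mono)
      have "(\<integral>\<^sup>+x. ennreal ((cmod (S m x - S (r i) x))\<^sup>2) \<partial>M01) \<le> ennreal (e m)" if "i \<ge> m" for i
      proof -
        have "m \<le> r i" using that seq_suble[OF r, of i] by simp
        have "(\<integral>\<^sup>+x. ennreal ((cmod (S m x - S (r i) x))\<^sup>2) \<partial>M01) = ennreal ((L2_norm I01 (\<lambda>x. S m x - S (r i) x))\<^sup>2)"
          using L2_square_integrable[OF L2_diff[OF S2 S2]]
          by (subst nn_integral_eq_integral) (auto simp: L2_norm_def)
        also have "\<dots> \<le> ennreal (e m)"
          using dS[OF \<open>m \<le> r i\<close>] by (intro ennreal_leI) (simp add: L2_norm_minus_commute[of _ "S m"])
        finally show ?thesis .
      qed
      then show "\<forall>\<^sub>F i in sequentially. (\<integral>\<^sup>+x. ennreal ((cmod (S m x - S (r i) x))\<^sup>2) \<partial>M01) \<le> ennreal (e m)"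
        by (auto simp: eventually_sequentially)
    qed
    also have "\<dots> = ennreal (e m)" by (simp add: Liminf_const)
    finally show ?thesis .
  qed
  have dL2: "(\<lambda>x. S m x - h x) \<in> L2 I01" for m
  proof -
    have "integrable M01 (\<lambda>x. (cmod (S m x - h x))\<^sup>2)"
      by (rule integrableI_bounded) (use fatou[of m] in \<open>auto intro: le_less_trans\<close>)
    then show ?thesis by (simp add: L2_def)
  qed
  have norm_le: "L2_norm I01 (\<lambda>x. S m x - h x) \<le> sqrt (e m)" for m
  proof -
    have "ennreal (\<integral>x. (cmod (S m x - h x))\<^sup>2 \<partial>M01) \<le> ennreal (e m)"
      using fatou[of m] L2_square_integrable[OF dL2[of m]]
      by (subst (asm) nn_integral_eq_integral) auto
    then show ?thesis unfolding L2_norm_def using e_nonneg[of m] by (simp add: ennreal_le_iff)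
  qed
  \<comment> \<open>\<open>S 0\<close> is an empty sum; the detour expresses \<open>h\<close>
    through differences already known to lie in \<open>L^2\<close>.\<close>
  have "(\<lambda>x. S 0 x - (S 0 x - h x)) \<in> L2 I01" by (intro L2_diff S2 dL2)
  then have "h \<in> L2 I01" by simp
  moreover have "(\<lambda>n. L2_norm I01 (\<lambda>x. S n x - h x)) \<longlonglongrightarrow> 0"
  proof (rule tendsto_sandwich[of "\<lambda>_. 0" _ _ "\<lambda>n. sqrt (e n)"])
    show "(\<lambda>n. sqrt (e n)) \<longlonglongrightarrow> 0" using tendsto_real_sqrt[OF e0] by simp
  qed (use norm_le in auto)
  ultimately show ?thesis unfolding L2_sums_def S_def by blast
qed

text \<open>The inner product with \<open>phi k\<close> is continuous in \<open>L^2\<close>, and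
  along the partial sums it is constant from \<open>n = k\<close> on.\<close>

lemma L2_sums_coefficient:
  assumes h: "L2_sums (\<lambda>k x. c k * phi k x) h" and k: "k \<ge> 1"
  shows "L2_inner h (phi k) = c k"
proof -
  define S where "S = (\<lambda>n x. \<Sum>k=1..n. c k * phi k x)"
  have S2: "S n \<in> L2 I01" for n unfolding S_def by (rule sum_phi_L2)
  have hL2: "h \<in> L2 I01" and lim: "(\<lambda>n. L2_norm I01 (\<lambda>x. S n x - h x)) \<longlonglongrightarrow> 0"
    using h by (auto simp: L2_sums_def S_def)
  have "(\<lambda>n. L2_inner (S n) (phi k) - L2_inner h (phi k)) \<longlonglongrightarrow> 0"
  proof (rule Lim_null_comparison)
    have "cmod (L2_inner (S n) (phi k) - L2_inner h (phi k)) \<le> L2_norm I01 (\<lambda>x. S n x - h x) * L2_norm I01 (phi k)" for n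
      unfolding L2_inner_diff_left[OF S2 hL2 phi_L2, symmetric] by (rule L2_cauchy_schwarz[OF L2_diff[OF S2 hL2] phi_L2])
    then show "\<forall>\<^sub>F n in sequentially. cmod (L2_inner (S n) (phi k) - L2_inner h (phi k))
      \<le> L2_norm I01 (\<lambda>x. S n x - h x) * L2_norm I01 (phi k)" by simp
    show "(\<lambda>n. L2_norm I01 (\<lambda>x. S n x - h x) * L2_norm I01 (phi k)) \<longlonglongrightarrow> 0"
      using tendsto_mult_right[OF lim] by simp
  qed
  moreover have "\<forall>\<^sub>F n in sequentially. L2_inner (S n) (phi k) - L2_inner h (phi k) = c k - L2_inner h (phi k)"
    unfolding eventually_sequentially S_def using k by (intro exI[of _ k]) (auto simp: L2_inner_sum_phi)
  ultimately have "(\<lambda>n. c k - L2_inner h (phi k)) \<longlonglongrightarrow> 0" by (rule Lim_transform_eventually)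
  then show ?thesis by (simp add: LIMSEQ_const_iff)
qed

text \<open>\<open>phi 0\<close> is the zero function, so series over all indices may be identified
  with series over \<open>k \<ge> 1\<close>.\<close>

lemma L2_inner_phi_0 [simp]: "L2_inner f (phi 0) = 0"
  by (simp add: L2_inner_def phi_def)

lemma summable_coefficients:
  assumes "f \<in> L2 I01"
  shows "summable (\<lambda>k. (cmod (L2_inner f (phi k)))\<^sup>2)"
proof (rule summableI_nonneg_bounded)
  fix n
  have "(\<Sum>k<n. (cmod (L2_inner f (phi k)))\<^sup>2) = (\<Sum>k\<in>{1..<n}. (cmod (L2_inner f (phi k)))\<^sup>2)"
    by (rule sum.mono_neutral_right) (auto simp: not_less_eq_eq)
  also have "\<dots> \<le> (L2_norm I01 f)\<^sup>2"
    by (rule L2_bessel[OF assms]) auto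
  finally show "(\<Sum>k<n. (cmod (L2_inner f (phi k)))\<^sup>2) \<le> (L2_norm I01 f)\<^sup>2" .
qed simp

text \<open>Riesz-Fischer yields some limit with the right coefficients; completeness identifies it
  with \<open>f\<close>.\<close>

lemma L2_sums_fourier:
  assumes f: "f \<in> L2 I01"
  shows "L2_sums (\<lambda>k x. L2_inner f (phi k) * phi k x) f"
proof -
  obtain h where h: "L2_sums (\<lambda>k x. L2_inner f (phi k) * phi k x) h"
    using riesz_fischer[OF summable_coefficients[OF f]] by blast
  then have hL2: "h \<in> L2 I01" by (simp add: L2_sums_def)
  note [measurable] = L2_measurable[OF f] L2_measurable[OF hL2]
  have "AE x in M01. h x - f x = 0"
    by (rule phi_complete) (use f hL2 in \<open>auto simp: L2_diff L2_inner_diff_left L2_sums_coefficient[OF h]\<close>)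
  then have "L2_norm I01 (\<lambda>x. (\<Sum>k=1..n. L2_inner f (phi k) * phi k x) - h x)
    = L2_norm I01 (\<lambda>x. (\<Sum>k=1..n. L2_inner f (phi k) * phi k x) - f x)" for n
    unfolding L2_norm_def
    by (intro arg_cong[where f = sqrt] integral_cong_AE)
       (auto elim!: eventually_mono)
  then show ?thesis using h f by (simp add: L2_sums_def)
qed

lemma L2_norm_partial_sum_le:
  assumes f: "f \<in> L2 I01"
  shows "L2_norm I01 (\<lambda>x. \<Sum>k=1..n. L2_inner f (phi k) * phi k x) \<le> L2_norm I01 f"
  by (rule power2_le_imp_le) (auto simp: L2_norm_sum_phi intro!: L2_bessel f)

lemma L2_inner_partial_sum:
  assumes f: "f \<in> L2 I01" and g: "g \<in> L2 I01"
  shows "L2_inner (\<lambda>x. \<Sum>k=1..n. L2_inner f (phi k) * phi k x) g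
    = (\<Sum>k=1..n. L2_inner f (phi k) * cnj (L2_inner g (phi k)))"
  using g by (subst L2_inner_sum_left) (auto simp: L2_inner_scale_left L2_inner_commute[of g] intro: L2_scale)

text \<open>Uniform in \<open>n\<close>: this is the majorant that allows the limit in Parseval's
  identity to be taken under a time integral.\<close>

lemma parseval_partial_sum_le:
  assumes f: "f \<in> L2 I01" and g: "g \<in> L2 I01"
  shows "cmod (\<Sum>k=1..n. L2_inner f (phi k) * cnj (L2_inner g (phi k))) \<le> L2_norm I01 f * L2_norm I01 g"
  unfolding L2_inner_partial_sum[OF f g, symmetric]
  by (rule order_trans[OF L2_cauchy_schwarz[OF sum_phi_L2 g]])
     (intro mult_right_mono L2_norm_partial_sum_le f L2_norm_nonneg)

lemma parseval:
  assumes f: "f \<in> L2 I01" and g: "g \<in> L2 I01"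
  shows "(\<lambda>n. \<Sum>k=1..n. L2_inner f (phi k) * cnj (L2_inner g (phi k))) \<longlonglongrightarrow> L2_inner f g"
proof -
  define S where "S = (\<lambda>n x. \<Sum>k=1..n. L2_inner f (phi k) * phi k x)"
  have S2: "S n \<in> L2 I01" for n unfolding S_def by (rule sum_phi_L2)
  have lim: "(\<lambda>n. L2_norm I01 (\<lambda>x. S n x - f x)) \<longlonglongrightarrow> 0"
    using L2_sums_fourier[OF f] by (auto simp: L2_sums_def S_def)
  have "(\<lambda>n. L2_inner (S n) g - L2_inner f g) \<longlonglongrightarrow> 0"
  proof (rule Lim_null_comparison)
    have "cmod (L2_inner (S n) g - L2_inner f g) \<le> L2_norm I01 (\<lambda>x. S n x - f x) * L2_norm I01 g" for n
      unfolding L2_inner_diff_left[OF S2 f g, symmetric] by (rule L2_cauchy_schwarz[OF L2_diff[OF S2 f] g])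
    then show "\<forall>\<^sub>F n in sequentially. cmod (L2_inner (S n) g - L2_inner f g)
      \<le> L2_norm I01 (\<lambda>x. S n x - f x) * L2_norm I01 g" by simp
    show "(\<lambda>n. L2_norm I01 (\<lambda>x. S n x - f x) * L2_norm I01 g) \<longlonglongrightarrow> 0"
      using tendsto_mult_right[OF lim] by simp
  qed
  then show ?thesis
    unfolding S_def L2_inner_partial_sum[OF f g] by (simp add: LIM_zero_cancel)
qed

section \<open>The free propagator on Fourier coefficients\<close>

lemma norm_exp_minus_i: "cmod (exp (- \<i> * complex_of_real a)) = 1"
  by (simp add: norm_exp_eq_Re)

text \<open>\<open>free_prop\<close> is defined by choice, so existence must be supplied: the phases
  have modulus one and preserve square summability.\<close>

lemma free_prop_L2_sums:
  assumes f: "f \<in> L2 I01"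
  shows "L2_sums (\<lambda>k x. exp (- \<i> * complex_of_real (eig k * t)) * L2_inner f (phi k) * phi k x) (free_prop t f)"
  unfolding free_prop_def
proof -
  have "\<exists>h. L2_sums (\<lambda>k x. exp (- \<i> * complex_of_real (eig k * t)) * L2_inner f (phi k) * phi k x) h"
    using riesz_fischer[of "\<lambda>k. exp (- \<i> * complex_of_real (eig k * t)) * L2_inner f (phi k)"]
      summable_coefficients[OF f] unfolding norm_mult norm_exp_minus_i by auto
  from someI_ex[OF this] show "L2_sums (\<lambda>k x. exp (- \<i> * complex_of_real (eig k * t)) * L2_inner f (phi k) * phi k x)
    (SOME h. L2_sums (\<lambda>k x. exp (- \<i> * complex_of_real (eig k * t)) * L2_inner f (phi k) * phi k x) h)" .
qed

lemma free_prop_L2: "f \<in> L2 I01 \<Longrightarrow> free_prop t f \<in> L2 I01"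
  using free_prop_L2_sums[of f t] by (simp add: L2_sums_def)

text \<open>Coefficients do not depend on the chosen representative, so the mild formulation can be
  evaluated through them.\<close>

lemma free_prop_coefficient:
  assumes "f \<in> L2 I01" "k \<ge> 1"
  shows "L2_inner (free_prop t f) (phi k) = exp (- \<i> * complex_of_real (eig k * t)) * L2_inner f (phi k)"
  using L2_sums_coefficient[OF free_prop_L2_sums[OF assms(1)] assms(2)] .

subsection \<open>Indefinite integrals\<close>

text \<open>Encodes absolute continuity of \<open>F\<close> on \<open>[0, T]\<close> with almost
  everywhere derivative \<open>f\<close>. It serves for functions of time and, with
  \<open>T = 1\<close>, for functions of the space variable.\<close>

definition primitive_on :: "real \<Rightarrow> (real \<Rightarrow> complex) \<Rightarrow> (real \<Rightarrow> complex) \<Rightarrow> bool" where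
  "primitive_on T F f \<longleftrightarrow> integrable (leb T) f \<and>
     (\<forall>t\<in>{0..T}. F t = F 0 + (\<integral>x. f x \<partial>leb t))"

lemma primitive_on_integrable: "primitive_on T F f \<Longrightarrow> integrable (leb T) f"
  by (simp add: primitive_on_def)

lemma primitive_on_eq:
  "primitive_on T F f \<Longrightarrow> 0 \<le> t \<Longrightarrow> t \<le> T \<Longrightarrow> F t = F 0 + (\<integral>x. f x \<partial>leb t)"
  unfolding primitive_on_def by (elim conjE) (erule bspec, simp)

lemma integrable_subinterval_Icc:
  fixes f :: "real \<Rightarrow> 'a::euclidean_space"
  assumes "integrable (lebesgue_on {a..b}) f" "a \<le> c" "d \<le> b"
  shows "integrable (lebesgue_on {c..d}) f"
  by (rule integrable_subinterval[OF assms(1)]) (use assms in auto)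

lemma integral_combine_Icc:
  fixes f :: "real \<Rightarrow> 'a::euclidean_space"
  assumes "integrable (leb T) f" "0 \<le> r" "r \<le> t" "t \<le> T"
  shows "(\<integral>x. f x \<partial>leb t) = (\<integral>x. f x \<partial>leb r) + (\<integral>x. f x \<partial>lebesgue_on {r..t})"
  by (rule Equivalence_Measurable_On_Borel.integral_combine)
     (use assms in \<open>auto intro!: integrable_subinterval_Icc[OF assms(1)]\<close>)

lemma primitive_on_increment:
  assumes "primitive_on T F f" "0 \<le> r" "r \<le> t" "t \<le> T"
  shows "F t - F r = (\<integral>x. f x \<partial>lebesgue_on {r..t})"
proof -
  have "F t - F r = (\<integral>x. f x \<partial>leb t) - (\<integral>x. f x \<partial>leb r)"
    using primitive_on_eq[OF assms(1), of t] primitive_on_eq[OF assms(1), of r] assms(2-4) by simp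
  then show ?thesis
    using integral_combine_Icc[OF primitive_on_integrable[OF assms(1)] assms(2-4)] by simp
qed

lemma integral_nonneg_mono_Icc:
  fixes p :: "real \<Rightarrow> real"
  assumes "integrable (leb T) p" "\<And>x. 0 \<le> p x" "0 \<le> r" "r \<le> t" "t \<le> T"
  shows "(\<integral>x. p x \<partial>leb r) \<le> (\<integral>x. p x \<partial>leb t)"
  using integral_combine_Icc[OF assms(1,3-5)] assms(2) by (simp add: integral_nonneg)

text \<open>This takes the place of differentiating indefinite integrals almost everywhere: the product
  and chain rules below hold up to an error that is quadratic in the increments of a continuous
  monotone function, and such an error vanishes.\<close>

lemma quadratic_increments_imp_constant:
  fixes D :: "real \<Rightarrow> complex" and U :: "real \<Rightarrow> real"
  assumes T: "0 \<le> T" and U: "continuous_on {0..T} U"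
    and mono: "\<And>r t. 0 \<le> r \<Longrightarrow> r \<le> t \<Longrightarrow> t \<le> T \<Longrightarrow> U r \<le> U t"
    and D: "\<And>r t. 0 \<le> r \<Longrightarrow> r \<le> t \<Longrightarrow> t \<le> T \<Longrightarrow> cmod (D t - D r) \<le> C * (U t - U r)\<^sup>2"
    and C: "0 \<le> C"
  shows "D T = D 0"
proof -
  have "cmod (D T - D 0) \<le> \<epsilon> * (C * (U T - U 0))" if e: "\<epsilon> > 0" for \<epsilon>
  proof -
    \<comment> \<open>On a partition, the sum of squared increments is at most the largest increment
      times the total one; uniform continuity makes the largest increment smaller than
      \<open>\<epsilon>\<close> on a fine equidistant partition.\<close>
    have "uniformly_continuous_on {0..T} U"
      by (rule compact_uniformly_continuous[OF U]) simp
    then obtain d where d: "d > 0" "\<And>r t. r \<in> {0..T} \<Longrightarrow> t \<in> {0..T} \<Longrightarrow> dist t r < d \<Longrightarrow> dist (U t) (U r) < \<epsilon>"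
      using e by (rule uniformly_continuous_onE) blast
    obtain n :: nat where n: "T / d < real n" using reals_Archimedean2 by blast
    have n0: "0 < n" using n T d by (cases n) (auto simp: divide_less_0_iff)
    define \<tau> where "\<tau> = (\<lambda>i::nat. real i * T / real n)"
    have \<tau>: "\<tau> i \<in> {0..T}" if "i \<le> n" for i
    proof -
      have "real i * T \<le> real n * T" using that T by (intro mult_right_mono) auto
      then show ?thesis using n0 T by (auto simp: \<tau>_def divide_simps mult.commute)
    qed
    have step: "cmod (D (\<tau> (Suc i)) - D (\<tau> i)) \<le> \<epsilon> * C * (U (\<tau> (Suc i)) - U (\<tau> i))" if i: "i < n" for i
    proof -
      have ii: "\<tau> i \<in> {0..T}" "\<tau> (Suc i) \<in> {0..T}" using \<tau> i by auto
      have diff: "\<tau> (Suc i) = \<tau> i + T / real n"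
        by (simp add: \<tau>_def distrib_right add_divide_distrib)
      have Tn: "0 \<le> T / real n" "T / real n < d" using n d n0 T by (simp_all add: field_simps)
      have le: "\<tau> i \<le> \<tau> (Suc i)" using diff Tn by simp
      have "dist (\<tau> (Suc i)) (\<tau> i) < d"
        using diff Tn by (simp add: dist_real_def)
      then have u: "U (\<tau> (Suc i)) - U (\<tau> i) < \<epsilon>" using d(2)[OF ii] by (simp add: dist_real_def)
      have u0: "0 \<le> U (\<tau> (Suc i)) - U (\<tau> i)" using mono[of "\<tau> i" "\<tau> (Suc i)"] ii le by simp
      have "cmod (D (\<tau> (Suc i)) - D (\<tau> i)) \<le> C * (U (\<tau> (Suc i)) - U (\<tau> i))\<^sup>2"
        by (rule D) (use ii le in auto)
      also have "\<dots> = C * ((U (\<tau> (Suc i)) - U (\<tau> i)) * (U (\<tau> (Suc i)) - U (\<tau> i)))" by (simp add: power2_eq_square)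
      also have "\<dots> \<le> C * (\<epsilon> * (U (\<tau> (Suc i)) - U (\<tau> i)))"
        using u u0 C by (intro mult_left_mono mult_right_mono) auto
      finally show ?thesis by (simp add: mult_ac)
    qed
    have "D T - D 0 = (\<Sum>i<n. D (\<tau> (Suc i)) - D (\<tau> i))"
      using n0 by (subst sum_lessThan_telescope) (simp add: \<tau>_def)
    also have "cmod \<dots> \<le> (\<Sum>i<n. \<epsilon> * C * (U (\<tau> (Suc i)) - U (\<tau> i)))"
      by (rule sum_norm_le) (use step in auto)
    also have "\<dots> = \<epsilon> * C * (U T - U 0)"
      unfolding sum_distrib_left[symmetric] using n0 by (subst sum_lessThan_telescope) (simp add: \<tau>_def)
    finally show ?thesis by (simp add: mult_ac)
  qed
  \<comment> \<open>Adding 1 makes the factor positive even if \<open>C\<close> or the total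
    increment of \<open>U\<close> vanishes, so that it can be divided out.\<close>
  then have small: "cmod (D T - D 0) \<le> \<epsilon> * (C * (U T - U 0) + 1)" if "\<epsilon> > 0" for \<epsilon>
    by (rule order_trans) (use that in auto)
  have pos: "0 < C * (U T - U 0) + 1" using C mono[of 0 T] T by (simp add: add_nonneg_pos)
  have "cmod (D T - D 0) \<le> 0 + \<epsilon>" if "\<epsilon> > 0" for \<epsilon>
    using small[of "\<epsilon> / (C * (U T - U 0) + 1)"] that pos by simp
  then have "cmod (D T - D 0) \<le> 0" by (rule field_le_epsilon)
  then show ?thesis by simp
qed

lemma primitive_on_continuous:
  assumes "primitive_on T F f"
  shows "continuous_on {0..T} F"
proof -
  have "continuous_on {0..T} (\<lambda>t. F 0 + (\<integral>x. f x \<partial>leb t))"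
    by (intro continuous_intros indefinite_integral_continuous_real primitive_on_integrable[OF assms])
  then show ?thesis
    by (rule continuous_on_eq) (rule primitive_on_eq[OF assms, symmetric], auto)
qed

lemma continuous_on_measurable_Icc:
  fixes f :: "real \<Rightarrow> 'a::euclidean_space"
  assumes "continuous_on {a..b} f"
  shows "f \<in> borel_measurable (lebesgue_on {a..b})"
  using assms by (intro continuous_imp_measurable_on_sets_lebesgue) auto

lemma integrable_mult_continuous:
  fixes f F :: "real \<Rightarrow> complex"
  assumes f: "integrable (lebesgue_on {a..b}) f" and F: "continuous_on {a..b} F"
  shows "integrable (lebesgue_on {a..b}) (\<lambda>x. f x * F x)"
proof -
  have "bounded (F ` {a..b})"
    using F by (intro compact_imp_bounded compact_continuous_image) auto
  then obtain c where c: "\<And>x. x \<in> {a..b} \<Longrightarrow> cmod (F x) \<le> c" unfolding bounded_iff by blast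
  show ?thesis
  proof (rule Bochner_Integration.integrable_bound)
    show "integrable (lebesgue_on {a..b}) (\<lambda>x. c * cmod (f x))" using f by simp
    show "(\<lambda>x. f x * F x) \<in> borel_measurable (lebesgue_on {a..b})"
      using f continuous_on_measurable_Icc[OF F] by (intro borel_measurable_times) auto
    show "AE x in lebesgue_on {a..b}. cmod (f x * F x) \<le> norm (c * cmod (f x))"
    proof (rule AE_I2)
      fix x assume "x \<in> space (lebesgue_on {a..b})"
      then have "cmod (F x) \<le> c" using c by simp
      then have "cmod (f x) * cmod (F x) \<le> cmod (f x) * \<bar>c\<bar>" by (intro mult_left_mono) auto
      then show "cmod (f x * F x) \<le> norm (c * cmod (f x))" by (simp add: norm_mult abs_mult mult.commute)
    qed
  qed
qed

lemma integrable_continuous_Icc: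
  fixes f :: "real \<Rightarrow> 'a::euclidean_space"
  shows "continuous_on {a..b} f \<Longrightarrow> integrable (lebesgue_on {a..b}) f"
  by (rule continuous_imp_integrable_real)

lemma primitive_on_vector_derivative:
  assumes "\<And>x. x \<in> {0..T} \<Longrightarrow> (F has_vector_derivative f x) (at x within {0..T})"
    and "continuous_on {0..T} f"
  shows "primitive_on T F f"
  unfolding primitive_on_def
proof (intro conjI ballI)
  show "integrable (leb T) f" by (rule integrable_continuous_Icc[OF assms(2)])
  fix t assume t: "t \<in> {0..T}"
  have "integrable (leb t) f"
    using t by (intro integrable_continuous_Icc continuous_on_subset[OF assms(2)]) auto
  then have "(\<integral>x. f x \<partial>leb t) = integral {0..t} f"
    by (rule lebesgue_integral_eq_integral) simp
  moreover have "(f has_integral F t - F 0) {0..t}"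
    using t by (intro fundamental_theorem_of_calculus has_vector_derivative_within_subset[OF assms(1)]) auto
  ultimately show "F t = F 0 + (\<integral>x. f x \<partial>leb t)" by (simp add: integral_unique)
qed

text \<open>The constant \<open>c\<close> need not be recognised beforehand as the initial value:
  \<open>t = 0\<close> identifies it, the integral over a single point being zero.\<close>

lemma primitive_on_indefinite_integral:
  assumes "integrable (leb T) f"
    and F: "\<And>t. 0 \<le> t \<Longrightarrow> t \<le> T \<Longrightarrow> F t = c + (\<integral>x. f x \<partial>leb t)"
  shows "primitive_on T F f"
  unfolding primitive_on_def
proof (intro conjI ballI)
  fix t assume t: "t \<in> {0..T}"
  have "(\<integral>x. f x \<partial>lebesgue_on {0..0}) = 0"
    using integral_combine_Icc[OF assms(1), of 0 0] t by simp
  then have "F 0 = c" using F[of 0] t by simp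
  then show "F t = F 0 + (\<integral>x. f x \<partial>leb t)" using F[of t] t by simp
qed (rule assms(1))

lemma primitive_on_cnj:
  assumes F: "primitive_on T F f"
  shows "primitive_on T (\<lambda>t. cnj (F t)) (\<lambda>t. cnj (f t))"
  unfolding primitive_on_def
proof (intro conjI ballI)
  show "integrable (leb T) (\<lambda>t. cnj (f t))"
    using primitive_on_integrable[OF F] by simp
  fix t assume t: "t \<in> {0..T}"
  have "cnj (F t) = cnj (F 0 + (\<integral>x. f x \<partial>leb t))"
    using primitive_on_eq[OF F, of t] t by simp
  then show "cnj (F t) = cnj (F 0) + (\<integral>x. cnj (f x) \<partial>leb t)"
    by (simp only: complex_cnj_add Bochner_Integration.integral_cnj)
qed

lemma primitive_on_diff:
  assumes F: "primitive_on T F f" and G: "primitive_on T G g"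
  shows "primitive_on T (\<lambda>t. F t - G t) (\<lambda>t. f t - g t)"
  unfolding primitive_on_def
proof (intro conjI ballI)
  show "integrable (leb T) (\<lambda>t. f t - g t)"
    by (intro Bochner_Integration.integrable_diff primitive_on_integrable[OF F] primitive_on_integrable[OF G])
  fix t assume t: "t \<in> {0..T}"
  have "integrable (leb t) f" "integrable (leb t) g"
    using t by (auto intro!: integrable_subinterval_Icc[OF primitive_on_integrable[OF F]]
      integrable_subinterval_Icc[OF primitive_on_integrable[OF G]])
  then show "F t - G t = F 0 - G 0 + (\<integral>x. f x - g x \<partial>leb t)"
    using primitive_on_eq[OF F, of t] primitive_on_eq[OF G, of t] t by simp
qed

lemma norm_integral_le_increment:
  fixes f :: "real \<Rightarrow> 'a::euclidean_space" and p :: "real \<Rightarrow> real"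
  assumes f: "integrable (lebesgue_on {r..t}) f" and p: "integrable (lebesgue_on {r..t}) p"
    and le: "\<And>x. x \<in> {r..t} \<Longrightarrow> norm (f x) \<le> p x"
  shows "norm (\<integral>x. f x \<partial>lebesgue_on {r..t}) \<le> (\<integral>x. p x \<partial>lebesgue_on {r..t})"
  by (rule order_trans[OF integral_norm_bound integral_mono]) (use f p le in auto)

text \<open>The criterion behind the product and chain rules: the defect of \<open>F\<close> from
  the integral of \<open>f\<close> has increments quadratic in those of the integral of
  \<open>p\<close>, so it is constant.\<close>

lemma primitive_onI_quadratic:
  fixes p :: "real \<Rightarrow> real"
  assumes f: "integrable (leb T) f" and p: "integrable (leb T) p"
    and p0: "\<And>x. 0 \<le> p x" and C: "0 \<le> C"
    and le: "\<And>r t. 0 \<le> r \<Longrightarrow> r \<le> t \<Longrightarrow> t \<le> T \<Longrightarrow>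
      cmod (F t - F r - (\<integral>x. f x \<partial>lebesgue_on {r..t})) \<le> C * (\<integral>x. p x \<partial>lebesgue_on {r..t})\<^sup>2"
  shows "primitive_on T F f"
  unfolding primitive_on_def
proof (intro conjI ballI f)
  fix s assume s: "s \<in> {0..T}"
  define U where "U = (\<lambda>t. \<integral>x. p x \<partial>leb t)"
  define D where "D = (\<lambda>t. F t - (\<integral>x. f x \<partial>leb t))"
  have "D s = D 0"
  proof (rule quadratic_increments_imp_constant[where U = U and C = C])
    have "continuous_on {0..T} U"
      unfolding U_def by (rule indefinite_integral_continuous_real[OF p])
    then show "continuous_on {0..s} U" by (rule continuous_on_subset) (use s in auto)
    fix r t assume rt: "0 \<le> r" "r \<le> t" "t \<le> s"
    then have rt': "0 \<le> r" "r \<le> t" "t \<le> T" using s by auto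
    show "U r \<le> U t" unfolding U_def by (rule integral_nonneg_mono_Icc[OF p p0 rt'])
    have "D t - D r = F t - F r - (\<integral>x. f x \<partial>lebesgue_on {r..t})"
      unfolding D_def using integral_combine_Icc[OF f rt'] by simp
    moreover have "U t - U r = (\<integral>x. p x \<partial>lebesgue_on {r..t})"
      unfolding U_def using integral_combine_Icc[OF p rt'] by simp
    ultimately show "cmod (D t - D r) \<le> C * (U t - U r)\<^sup>2" using le[OF rt'] by simp
  qed (use s C in auto)
  moreover have "(\<integral>x. f x \<partial>lebesgue_on {0..0}) = 0"
    using integral_combine_Icc[OF f, of 0 0] s by simp
  ultimately show "F s = F 0 + (\<integral>x. f x \<partial>leb s)" by (auto simp: D_def diff_eq_eq add.commute)
qed

text \<open>On a short interval \<open>G\<close> is frozen at its right end and \<open>F\<close> at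
  its left end. The error is a density times an increment of the other function, and both are
  controlled by the integral of \<open>cmod (f x) + cmod (g x)\<close>.\<close>

lemma primitive_on_mult:
  assumes F: "primitive_on T F f" and G: "primitive_on T G g"
  shows "primitive_on T (\<lambda>t. F t * G t) (\<lambda>t. f t * G t + F t * g t)"
proof (rule primitive_onI_quadratic[where C = 2 and p = "\<lambda>x. cmod (f x) + cmod (g x)"])
  note fi = primitive_on_integrable[OF F] and gi = primitive_on_integrable[OF G]
  note Fc = primitive_on_continuous[OF F] and Gc = primitive_on_continuous[OF G]
  have fG: "integrable (leb T) (\<lambda>t. f t * G t)" by (rule integrable_mult_continuous[OF fi Gc])
  have Fg: "integrable (leb T) (\<lambda>t. F t * g t)"
    using integrable_mult_continuous[OF gi Fc] by (simp add: mult.commute)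
  show "integrable (leb T) (\<lambda>t. f t * G t + F t * g t)"
    using fG Fg by simp
  show pi: "integrable (leb T) (\<lambda>x. cmod (f x) + cmod (g x))" using fi gi by simp
  fix r t assume rt: "0 \<le> r" "r \<le> t" "t \<le> T"
  define P where "P = (\<integral>x. cmod (f x) + cmod (g x) \<partial>lebesgue_on {r..t})"
  have sub: "integrable (lebesgue_on {r..t}) f" "integrable (lebesgue_on {r..t}) g"
    "integrable (lebesgue_on {r..t}) (\<lambda>t. f t * G t)" "integrable (lebesgue_on {r..t}) (\<lambda>t. F t * g t)"
    using rt by (auto intro!: integrable_subinterval_Icc[OF fi] integrable_subinterval_Icc[OF gi]
      integrable_subinterval_Icc[OF fG] integrable_subinterval_Icc[OF Fg])
  have bf: "cmod (F y - F x) \<le> P" "cmod (G y - G x) \<le> P" if "r \<le> x" "x \<le> y" "y \<le> t" for x y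
  proof -
    have int: "integrable (lebesgue_on {x..y}) f" "integrable (lebesgue_on {x..y}) g"
      "integrable (lebesgue_on {x..y}) (\<lambda>x. cmod (f x) + cmod (g x))"
      using rt that by (auto intro!: integrable_subinterval_Icc[OF fi] integrable_subinterval_Icc[OF gi]
        integrable_subinterval_Icc[OF pi])
    have "(\<integral>x. cmod (f x) + cmod (g x) \<partial>lebesgue_on {x..y}) \<le> P"
      unfolding P_def using that rt
      by (intro integral_mono_lebesgue_on_AE) (auto intro: integrable_subinterval_Icc[OF pi])
    moreover have "cmod (F y - F x) \<le> (\<integral>x. cmod (f x) + cmod (g x) \<partial>lebesgue_on {x..y})"
    proof -
      have "F y - F x = (\<integral>x. f x \<partial>lebesgue_on {x..y})"
        by (rule primitive_on_increment[OF F]) (use that rt in auto)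
      then show ?thesis using int by (simp only:) (rule norm_integral_le_increment, auto)
    qed
    moreover have "cmod (G y - G x) \<le> (\<integral>x. cmod (f x) + cmod (g x) \<partial>lebesgue_on {x..y})"
    proof -
      have "G y - G x = (\<integral>x. g x \<partial>lebesgue_on {x..y})"
        by (rule primitive_on_increment[OF G]) (use that rt in auto)
      then show ?thesis using int by (simp only:) (rule norm_integral_le_increment, auto)
    qed
    ultimately show "cmod (F y - F x) \<le> P" "cmod (G y - G x) \<le> P" by auto
  qed
  have P0: "0 \<le> P" unfolding P_def by simp
  \<comment> \<open>Exact splitting of the increment of a product; the comparison with the integral
    leaves \<open>f x * (G t - G x) - g x * (F x - F r)\<close>.\<close>
  have "F t * G t - F r * G r - (\<integral>x. f x * G x + F x * g x \<partial>lebesgue_on {r..t})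
    = (F t - F r) * G t + F r * (G t - G r) - (\<integral>x. f x * G x + F x * g x \<partial>lebesgue_on {r..t})"
    by (simp add: algebra_simps)
  also have "\<dots> = (\<integral>x. f x * G t + F r * g x \<partial>lebesgue_on {r..t}) - (\<integral>x. f x * G x + F x * g x \<partial>lebesgue_on {r..t})"
    using sub by (simp add: primitive_on_increment[OF F rt] primitive_on_increment[OF G rt])
  also have "\<dots> = (\<integral>x. f x * (G t - G x) - g x * (F x - F r) \<partial>lebesgue_on {r..t})"
  proof -
    have "(\<integral>x. f x * G t + F r * g x \<partial>lebesgue_on {r..t}) - (\<integral>x. f x * G x + F x * g x \<partial>lebesgue_on {r..t})
      = (\<integral>x. (f x * G t + F r * g x) - (f x * G x + F x * g x) \<partial>lebesgue_on {r..t})"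
      using sub by (intro Bochner_Integration.integral_diff[symmetric] Bochner_Integration.integrable_add) auto
    then show ?thesis by (simp add: algebra_simps)
  qed
  also have "cmod \<dots> \<le> (\<integral>x. P * (cmod (f x) + cmod (g x)) \<partial>lebesgue_on {r..t})"
  proof (rule norm_integral_le_increment)
    have "integrable (lebesgue_on {r..t}) (\<lambda>x. (f x * G t + F r * g x) - (f x * G x + F x * g x))"
      using sub by (intro Bochner_Integration.integrable_diff Bochner_Integration.integrable_add) auto
    then show "integrable (lebesgue_on {r..t}) (\<lambda>x. f x * (G t - G x) - g x * (F x - F r))"
      by (simp add: algebra_simps)
    show "integrable (lebesgue_on {r..t}) (\<lambda>x. P * (cmod (f x) + cmod (g x)))" using sub by simp
    fix x assume x: "x \<in> {r..t}"
    have "cmod (f x * (G t - G x) - g x * (F x - F r)) \<le> cmod (f x) * cmod (G t - G x) + cmod (g x) * cmod (F x - F r)"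
      by (rule order_trans[OF norm_triangle_ineq4]) (simp add: norm_mult)
    also have "\<dots> \<le> cmod (f x) * P + cmod (g x) * P"
      using bf[of x t] bf[of r x] x by (intro add_mono mult_left_mono) auto
    finally show "cmod (f x * (G t - G x) - g x * (F x - F r)) \<le> P * (cmod (f x) + cmod (g x))"
      by (simp add: algebra_simps)
  qed
  also have "\<dots> = P * P" using P_def by simp
  also have "\<dots> \<le> 2 * P\<^sup>2" by (simp add: power2_eq_square)
  finally show "cmod (F t * G t - F r * G r - (\<integral>x. f x * G x + F x * g x \<partial>lebesgue_on {r..t}))
    \<le> 2 * (\<integral>x. cmod (f x) + cmod (g x) \<partial>lebesgue_on {r..t})\<^sup>2"
    unfolding P_def .
qed auto

text \<open>A Taylor bound and a Lipschitz bound replace differentiability of \<open>H\<close>,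
  because both can be checked directly when \<open>H\<close> is a Fourier coefficient regarded as a
  function of the gauge parameter.\<close>

lemma primitive_on_chain:
  fixes s u :: "real \<Rightarrow> real" and H H' :: "real \<Rightarrow> complex"
  assumes u: "integrable (leb T) u"
    and s: "\<And>t. t \<in> {0..T} \<Longrightarrow> s t = (\<integral>x. u x \<partial>leb t)"
    and C: "0 \<le> C"
    and H: "\<And>p q. cmod (H p - H q - of_real (p - q) * H' q) \<le> C * (p - q)\<^sup>2"
    and H': "\<And>p q. cmod (H' p - H' q) \<le> C * \<bar>p - q\<bar>"
  shows "primitive_on T (\<lambda>t. H (s t)) (\<lambda>t. of_real (u t) * H' (s t))"
proof (rule primitive_onI_quadratic[where C = "2 * C" and p = "\<lambda>x. \<bar>u x\<bar>"])
  have "continuous_on {0..T} s"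
    by (rule continuous_on_eq[OF indefinite_integral_continuous_real[OF u]]) (use s in auto)
  moreover have "continuous_on UNIV H'"
  proof (rule continuous_on_iff[THEN iffD2], intro ballI allI impI)
    fix q e :: real assume "e > 0"
    then show "\<exists>d>0. \<forall>p\<in>UNIV. dist p q < d \<longrightarrow> dist (H' p) (H' q) < e"
    proof (intro exI[of _ "e / (C + 1)"] conjI ballI impI)
      fix p assume "dist p q < e / (C + 1)"
      then have "(C + 1) * \<bar>p - q\<bar> < e" using C by (simp add: dist_real_def field_simps)
      moreover have "C * \<bar>p - q\<bar> \<le> (C + 1) * \<bar>p - q\<bar>" by (intro mult_right_mono) auto
      ultimately show "dist (H' p) (H' q) < e" using H'[of p q] by (simp add: dist_norm)
    qed (use C in auto)
  qed
  ultimately have Hc: "continuous_on {0..T} (\<lambda>t. H' (s t))"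
    by (intro continuous_on_compose2[of UNIV H' _ s]) auto
  show int: "integrable (leb T) (\<lambda>t. of_real (u t) * H' (s t))"
    using u by (intro integrable_mult_continuous Hc) auto
  show au: "integrable (leb T) (\<lambda>x. \<bar>u x\<bar>)" using u by simp
  fix r t assume rt: "0 \<le> r" "r \<le> t" "t \<le> T"
  define P where "P = (\<integral>x. \<bar>u x\<bar> \<partial>lebesgue_on {r..t})"
  have sub: "integrable (lebesgue_on {r..t}) u" "integrable (lebesgue_on {r..t}) (\<lambda>t. of_real (u t) * H' (s t))"
    using rt by (auto intro!: integrable_subinterval_Icc[OF u] integrable_subinterval_Icc[OF int])
  have incr: "s x - s r = (\<integral>x. u x \<partial>lebesgue_on {r..x})" if "r \<le> x" "x \<le> t" for x
    using integral_combine_Icc[OF u, of r x] s[of x] s[of r] rt that by simp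
  have bs: "\<bar>s x - s r\<bar> \<le> P" if "r \<le> x" "x \<le> t" for x
  proof -
    have "\<bar>s x - s r\<bar> \<le> (\<integral>x. \<bar>u x\<bar> \<partial>lebesgue_on {r..x})"
      unfolding incr[OF that] real_norm_def[symmetric] using rt that
      by (intro norm_integral_le_increment integrable_norm integrable_subinterval_Icc[OF u]) auto
    also have "\<dots> \<le> P"
      unfolding P_def using that rt
      by (intro integral_mono_lebesgue_on_AE) (auto intro: integrable_subinterval_Icc[OF au])
    finally show ?thesis .
  qed
  have P0: "0 \<le> P" unfolding P_def by simp
  \<comment> \<open>The Taylor remainder of \<open>H\<close> at \<open>s r\<close>, minus the error
    of freezing \<open>H'\<close> at \<open>s r\<close>; each is at most
    \<open>C * P^2\<close>.\<close>
  have "H (s t) - H (s r) - (\<integral>x. of_real (u x) * H' (s x) \<partial>lebesgue_on {r..t})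
    = (H (s t) - H (s r) - of_real (s t - s r) * H' (s r))
      - ((\<integral>x. of_real (u x) * H' (s x) \<partial>lebesgue_on {r..t}) - of_real (s t - s r) * H' (s r))" by simp
  also have "of_real (s t - s r) * H' (s r) = (\<integral>x. of_real (u x) * H' (s r) \<partial>lebesgue_on {r..t})"
    using incr[of t] rt by simp
  also have "(\<integral>x. of_real (u x) * H' (s x) \<partial>lebesgue_on {r..t}) - (\<integral>x. of_real (u x) * H' (s r) \<partial>lebesgue_on {r..t})
    = (\<integral>x. of_real (u x) * (H' (s x) - H' (s r)) \<partial>lebesgue_on {r..t})"
    unfolding right_diff_distrib using sub
    by (intro Bochner_Integration.integral_diff[symmetric]) auto
  finally have eq: "H (s t) - H (s r) - (\<integral>x. of_real (u x) * H' (s x) \<partial>lebesgue_on {r..t}) =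
    (H (s t) - H (s r) - (\<integral>x. of_real (u x) * H' (s r) \<partial>lebesgue_on {r..t})) -
    (\<integral>x. of_real (u x) * (H' (s x) - H' (s r)) \<partial>lebesgue_on {r..t})" .
  have "cmod (H (s t) - H (s r) - (\<integral>x. of_real (u x) * H' (s r) \<partial>lebesgue_on {r..t})) \<le> C * P\<^sup>2"
  proof -
    have "cmod (H (s t) - H (s r) - of_real (s t - s r) * H' (s r)) \<le> C * (s t - s r)\<^sup>2" by (rule H)
    also have "\<dots> \<le> C * P\<^sup>2"
      using bs[of t] rt C P0 by (intro mult_left_mono) (auto simp: abs_le_square_iff[symmetric])
    finally show ?thesis using incr[of t] rt by simp
  qed
  moreover have "cmod (\<integral>x. of_real (u x) * (H' (s x) - H' (s r)) \<partial>lebesgue_on {r..t}) \<le> (\<integral>x. C * P * \<bar>u x\<bar> \<partial>lebesgue_on {r..t})"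
  proof (rule norm_integral_le_increment)
    have "integrable (lebesgue_on {r..t}) (\<lambda>x. of_real (u x) * H' (s x) - of_real (u x) * H' (s r))"
      using sub by (intro Bochner_Integration.integrable_diff) auto
    then show "integrable (lebesgue_on {r..t}) (\<lambda>x. of_real (u x) * (H' (s x) - H' (s r)))"
      by (simp add: right_diff_distrib)
    show "integrable (lebesgue_on {r..t}) (\<lambda>x. C * P * \<bar>u x\<bar>)" using sub by simp
    fix x assume x: "x \<in> {r..t}"
    have "cmod (H' (s x) - H' (s r)) \<le> C * P"
      using H'[of "s x" "s r"] mult_left_mono[OF bs[of x] C] x by auto
    then show "cmod (of_real (u x) * (H' (s x) - H' (s r))) \<le> C * P * \<bar>u x\<bar>"
      by (simp add: norm_mult mult.commute mult_left_mono)
  qed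
  then have "cmod (\<integral>x. of_real (u x) * (H' (s x) - H' (s r)) \<partial>lebesgue_on {r..t}) \<le> C * P\<^sup>2"
    by (simp add: P_def power2_eq_square mult.assoc)
  ultimately have "cmod (H (s t) - H (s r) - (\<integral>x. of_real (u x) * H' (s x) \<partial>lebesgue_on {r..t})) \<le> C * P\<^sup>2 + C * P\<^sup>2"
    unfolding eq by (rule order_trans[OF norm_triangle_ineq4 add_mono])
  then show "cmod (H (s t) - H (s r) - (\<integral>x. of_real (u x) * H' (s x) \<partial>lebesgue_on {r..t}))
    \<le> 2 * C * (\<integral>x. \<bar>u x\<bar> \<partial>lebesgue_on {r..t})\<^sup>2"
    unfolding P_def[symmetric] by simp
qed (use C in auto)

subsection \<open>Pairing of two evolutions\<close>

lemma primitive_onI: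
  assumes "integrable (leb T) f"
    and "\<And>t. 0 \<le> t \<Longrightarrow> t \<le> T \<Longrightarrow> F t = F 0 + (\<integral>x. f x \<partial>leb t)"
  shows "primitive_on T F f"
  unfolding primitive_on_def
proof (intro conjI ballI)
  show "F t = F 0 + (\<integral>x. f x \<partial>leb t)" if "t \<in> {0..T}" for t
    by (rule assms(2)) (use that in auto)
qed (rule assms(1))

lemma primitive_on_add:
  assumes F: "primitive_on T F f" and G: "primitive_on T G g"
  shows "primitive_on T (\<lambda>t. F t + G t) (\<lambda>t. f t + g t)"
proof (rule primitive_onI)
  show "integrable (leb T) (\<lambda>t. f t + g t)"
    by (intro Bochner_Integration.integrable_add primitive_on_integrable[OF F] primitive_on_integrable[OF G])
  fix t assume t: "0 \<le> t" "t \<le> T"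
  have "integrable (leb t) f" "integrable (leb t) g"
    using t by (auto intro!: integrable_subinterval_Icc[OF primitive_on_integrable[OF F]]
      integrable_subinterval_Icc[OF primitive_on_integrable[OF G]])
  then show "F t + G t = F 0 + G 0 + (\<integral>x. f x + g x \<partial>leb t)"
    using primitive_on_eq[OF F t] primitive_on_eq[OF G t] by simp
qed

lemma primitive_on_zero: "primitive_on T (\<lambda>t. 0) (\<lambda>t. 0)"
  by (rule primitive_onI) auto

lemma primitive_on_sum:
  assumes "\<And>k. k \<in> A \<Longrightarrow> primitive_on T (F k) (f k)"
  shows "primitive_on T (\<lambda>t. \<Sum>k\<in>A. F k t) (\<lambda>t. \<Sum>k\<in>A. f k t)"
  using assms
proof (induction A rule: infinite_finite_induct)
  case (insert x A)
  have "primitive_on T (\<lambda>t. F x t + (\<Sum>k\<in>A. F k t)) (\<lambda>t. f x t + (\<Sum>k\<in>A. f k t))"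
    by (rule primitive_on_add) (use insert in auto)
  then show ?case using insert by simp
qed (auto intro: primitive_on_zero)

text \<open>In the rotating frame the free evolution drops out, so that only the forcing terms
  \<open>P\<close> and \<open>Q\<close> contribute to the derivative of the pairing.\<close>

lemma pairing_primitive_on:
  fixes a b P Q :: "real \<Rightarrow> real \<Rightarrow> complex" and p :: "real \<Rightarrow> real"
  assumes L2: "\<And>t. t \<in> {0..T} \<Longrightarrow> a t \<in> L2 I01" "\<And>t. t \<in> {0..T} \<Longrightarrow> b t \<in> L2 I01"
      "\<And>t. t \<in> {0..T} \<Longrightarrow> P t \<in> L2 I01" "\<And>t. t \<in> {0..T} \<Longrightarrow> Q t \<in> L2 I01"
    and K: "\<And>t. t \<in> {0..T} \<Longrightarrow> L2_norm I01 (a t) \<le> K" "\<And>t. t \<in> {0..T} \<Longrightarrow> L2_norm I01 (b t) \<le> K"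
    and p: "\<And>t. t \<in> {0..T} \<Longrightarrow> L2_norm I01 (P t) \<le> p t" "\<And>t. t \<in> {0..T} \<Longrightarrow> L2_norm I01 (Q t) \<le> p t"
    and pint: "integrable (leb T) p"
    and a: "\<And>k. k \<ge> 1 \<Longrightarrow> primitive_on T (\<lambda>t. exp (\<i> * of_real (eig k * t)) * L2_inner (a t) (phi k))
      (\<lambda>t. exp (\<i> * of_real (eig k * t)) * L2_inner (P t) (phi k))"
    and b: "\<And>k. k \<ge> 1 \<Longrightarrow> primitive_on T (\<lambda>t. exp (\<i> * of_real (eig k * t)) * L2_inner (b t) (phi k))
      (\<lambda>t. exp (\<i> * of_real (eig k * t)) * L2_inner (Q t) (phi k))"
  shows "primitive_on T (\<lambda>t. L2_inner (a t) (b t)) (\<lambda>t. L2_inner (P t) (b t) + L2_inner (a t) (Q t))"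
proof -
  define f where "f = (\<lambda>n t. (\<Sum>k=1..n. L2_inner (P t) (phi k) * cnj (L2_inner (b t) (phi k)))
    + (\<Sum>k=1..n. L2_inner (a t) (phi k) * cnj (L2_inner (Q t) (phi k))))"
  define F where "F = (\<lambda>n t. \<Sum>k=1..n. L2_inner (a t) (phi k) * cnj (L2_inner (b t) (phi k)))"
  define l where "l = (\<lambda>t. L2_inner (P t) (b t) + L2_inner (a t) (Q t))"
  \<comment> \<open>The rotating factors of the two coefficients cancel in the sesquilinear
    product.\<close>
  have rot: "exp (\<i> * of_real r) * x * cnj (exp (\<i> * of_real r) * y) = x * cnj y" for r x y
  proof -
    have "exp (\<i> * of_real r) * x * cnj (exp (\<i> * of_real r) * y)
      = (exp (\<i> * of_real r) * cnj (exp (\<i> * of_real r))) * (x * cnj y)" by simp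
    also have "exp (\<i> * of_real r) * cnj (exp (\<i> * of_real r)) = 1"
      by (simp only: complex_norm_square[symmetric] norm_exp_i_times) simp
    finally show ?thesis by simp
  qed
  have Ff: "primitive_on T (F n) (f n)" for n
  proof -
    have "primitive_on T (\<lambda>t. L2_inner (a t) (phi k) * cnj (L2_inner (b t) (phi k)))
      (\<lambda>t. L2_inner (P t) (phi k) * cnj (L2_inner (b t) (phi k)) + L2_inner (a t) (phi k) * cnj (L2_inner (Q t) (phi k)))"
      if "k \<in> {1..n}" for k
      using primitive_on_mult[OF a[of k] primitive_on_cnj[OF b[of k]]] that
      unfolding rot by simp
    from primitive_on_sum[OF this, of "{1..n}"] show ?thesis
      unfolding F_def f_def by (simp add: sum.distrib)
  qed
  have flim: "(\<lambda>n. f n t) \<longlonglongrightarrow> l t" if "t \<in> {0..T}" for t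
    unfolding f_def l_def by (intro tendsto_add parseval L2 that)
  have Flim: "(\<lambda>n. F n t) \<longlonglongrightarrow> L2_inner (a t) (b t)" if "t \<in> {0..T}" for t
    unfolding F_def by (intro parseval L2 that)
  \<comment> \<open>A majorant independent of \<open>n\<close> and integrable in time, for the limit
    under the integral.\<close>
  have fle: "cmod (f n t) \<le> 2 * K * p t" if t: "t \<in> {0..T}" for n t
  proof -
    have K0: "0 \<le> K" by (rule order_trans[OF L2_norm_nonneg K(1)[OF t]])
    have p0: "0 \<le> p t" by (rule order_trans[OF L2_norm_nonneg p(1)[OF t]])
    have "cmod (f n t) \<le> L2_norm I01 (P t) * L2_norm I01 (b t) + L2_norm I01 (a t) * L2_norm I01 (Q t)"
      unfolding f_def by (rule norm_triangle_le, intro add_mono parseval_partial_sum_le L2 t)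
    also have "\<dots> \<le> p t * K + K * p t"
      using K[OF t] p[OF t] K0 p0 by (intro add_mono mult_mono) auto
    finally show ?thesis by simp
  qed
  have DCT: "integrable (leb t) l \<and> (\<lambda>n. \<integral>x. f n x \<partial>leb t) \<longlonglongrightarrow> (\<integral>x. l x \<partial>leb t)"
    if t: "0 \<le> t" "t \<le> T" for t
  proof -
    have fi: "f n \<in> borel_measurable (leb t)" for n
      using integrable_subinterval_Icc[OF primitive_on_integrable[OF Ff[of n]], of 0 t] t by auto
    have lm: "l \<in> borel_measurable (leb t)"
      by (rule borel_measurable_LIMSEQ_metric[OF fi flim]) (use t in auto)
    have w: "integrable (leb t) (\<lambda>x. 2 * K * p x)"
      using integrable_subinterval_Icc[OF pint, of 0 t] t by simp
    have lim: "AE x in leb t. (\<lambda>n. f n x) \<longlonglongrightarrow> l x"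
      by (rule AE_I2, rule flim) (use t in auto)
    have bd: "AE x in leb t. norm (f n x) \<le> 2 * K * p x" for n
      by (rule AE_I2, rule fle) (use t in auto)
    show ?thesis
      using integrable_dominated_convergence[OF lm fi w lim bd] integral_dominated_convergence[OF lm fi w lim bd] by simp
  qed
  show ?thesis
  proof (cases "0 \<le> T")
    case T: True
    show ?thesis
    proof (rule primitive_onI)
      show "integrable (leb T) (\<lambda>t. L2_inner (P t) (b t) + L2_inner (a t) (Q t))"
        using DCT[of T] T unfolding l_def by simp
      fix t assume t: "0 \<le> t" "t \<le> T"
      have "(\<lambda>n. F n 0 + (\<integral>x. f n x \<partial>leb t)) \<longlonglongrightarrow> L2_inner (a 0) (b 0) + (\<integral>x. l x \<partial>leb t)"
        by (intro tendsto_add Flim conjunct2[OF DCT[OF t]]) (use T in auto)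
      moreover have "F n t = F n 0 + (\<integral>x. f n x \<partial>leb t)" for n
        by (rule primitive_on_eq[OF Ff t])
      ultimately have "(\<lambda>n. F n t) \<longlonglongrightarrow> L2_inner (a 0) (b 0) + (\<integral>x. l x \<partial>leb t)"
        by presburger
      with Flim[of t] t show "L2_inner (a t) (b t) = L2_inner (a 0) (b 0) + (\<integral>x. L2_inner (P x) (b x) + L2_inner (a x) (Q x) \<partial>leb t)"
        unfolding l_def by (intro LIMSEQ_unique) auto
    qed
  next
    case False
    show ?thesis by (rule primitive_onI) (use False in auto)
  qed
qed

subsection \<open>Test functions\<close>

text \<open>The differentiability clause of \<open>test_functions\<close>, separated from the
  condition on the support.\<close>

definition smooth :: "(real \<Rightarrow> real) \<Rightarrow> bool" where
  "smooth f \<longleftrightarrow> (\<forall>n x. (deriv ^^ n) f differentiable (at x))"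

lemma smooth_deriv:
  assumes "smooth f"
  shows "smooth (deriv f)"
  unfolding smooth_def
proof (intro allI)
  fix n x
  have "(deriv ^^ n) (deriv f) = (deriv ^^ Suc n) f" by (simp add: funpow_swap1)
  then show "(deriv ^^ n) (deriv f) differentiable (at x)"
    using assms unfolding smooth_def by metis
qed

lemma smooth_antiderivative:
  assumes g: "smooth g" and f: "\<And>x. (f has_field_derivative g x) (at x)"
  shows "smooth f"
  unfolding smooth_def
proof (intro allI)
  fix n x
  have df: "deriv f = g" by (rule ext) (rule DERIV_imp_deriv[OF f])
  show "(deriv ^^ n) f differentiable (at x)"
  proof (cases n)
    case 0
    then show ?thesis using f[of x] by (auto simp: real_differentiable_def)
  next
    case (Suc m)
    have "(deriv ^^ n) f = (deriv ^^ m) g" unfolding Suc by (simp add: funpow_swap1 df)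
    then show ?thesis using g by (simp add: smooth_def)
  qed
qed

text \<open>In a family closed under differentiation every iterated derivative stays in the family
  and is differentiable again, so no formula for the iterated derivatives is required.\<close>

lemma smooth_coinduct:
  assumes "f \<in> S" and S: "\<And>f. f \<in> S \<Longrightarrow> \<exists>f'\<in>S. \<forall>x. (f has_field_derivative f' x) (at x)"
  shows "smooth f"
proof -
  have S': "deriv f \<in> S" "f differentiable (at x)" if fS: "f \<in> S" for f x
  proof -
    obtain f' where f': "f' \<in> S" "\<And>x. (f has_field_derivative f' x) (at x)" using S[OF fS] by blast
    have "deriv f = f'" by (rule ext) (rule DERIV_imp_deriv[OF f'(2)])
    then show "deriv f \<in> S" using f' by simp
    show "f differentiable (at x)" using f'(2)[of x] by (auto simp: real_differentiable_def)
  qed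
  have "(deriv ^^ n) f \<in> S" for n by (induction n) (auto simp: assms(1) S'(1))
  then show ?thesis unfolding smooth_def using S'(2) by blast
qed

section \<open>Smooth bump functions and test functions with prescribed derivative\<close>

text \<open>The flat function \<open>exp (- 1 / y)\<close> with a polynomial in \<open>1 / y\<close>
  in front. Differentiation creates such polynomials, so carrying them along makes the family closed
  under derivatives.\<close>

definition flat_exp :: "real poly \<Rightarrow> real \<Rightarrow> real" where
  "flat_exp p y = (if y > 0 then poly p (inverse y) * exp (- inverse y) else 0)"

lemma poly_exp_tendsto_0: "((\<lambda>z. poly p z * exp (- z)) \<longlongrightarrow> (0::real)) at_top"
proof -
  have "((\<lambda>z. \<Sum>i\<le>degree p. coeff p i * (z ^ i / exp z)) \<longlongrightarrow> (\<Sum>i\<le>degree p. coeff p i * 0)) at_top"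
    by (intro tendsto_sum tendsto_mult tendsto_const tendsto_power_div_exp_0)
  moreover have "(\<Sum>i\<le>degree p. coeff p i * (z ^ i / exp z)) = poly p z * exp (- z)" for z :: real
    by (simp add: poly_altdef exp_minus sum_distrib_right divide_inverse mult.assoc)
  ultimately show ?thesis by simp
qed

text \<open>For positive arguments the product rule gives \<open>p - pderiv p\<close> at
  \<open>1 / y\<close>, times \<open>1 / y^2\<close>, which is the factor
  \<open>[:0, 0, 1:]\<close>. At 0 the exponential beats every power.\<close>

lemma flat_exp_derivative:
  "(flat_exp p has_field_derivative flat_exp ([:0, 0, 1:] * (p - pderiv p)) x) (at x)"
proof -
  consider "x > 0" | "x < 0" | "x = 0" by linarith
  then show ?thesis
  proof cases
    case 1
    have "((\<lambda>y. poly p (inverse y) * exp (- inverse y)) has_field_derivative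
      flat_exp ([:0, 0, 1:] * (p - pderiv p)) x) (at x)"
      using 1 by (auto intro!: derivative_eq_intros simp: flat_exp_def algebra_simps power2_eq_square)
    moreover have "\<forall>\<^sub>F y in nhds x. flat_exp p y = poly p (inverse y) * exp (- inverse y)"
      using eventually_nhds_in_open[of "{0<..}" x] 1 by (auto simp: flat_exp_def elim: eventually_mono)
    ultimately show ?thesis by (subst DERIV_cong_ev[OF refl _ refl])
  next
    case 2
    have "((\<lambda>y. 0) has_field_derivative flat_exp ([:0, 0, 1:] * (p - pderiv p)) x) (at x)"
      using 2 by (auto simp: flat_exp_def)
    moreover have "\<forall>\<^sub>F y in nhds x. flat_exp p y = 0"
      using eventually_nhds_in_open[of "{..<0}" x] 2 by (auto simp: flat_exp_def elim: eventually_mono)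
    ultimately show ?thesis by (subst DERIV_cong_ev[OF refl _ refl])
  next
    case 3
    have "((\<lambda>h. flat_exp p h / h) \<longlongrightarrow> 0) (at_right 0)"
    proof -
      \<comment> \<open>The difference quotient at 0 costs one more power of \<open>1 / h\<close>,
        hence the factor \<open>[:0, 1:]\<close>.\<close>
      have "((\<lambda>z. poly ([:0, 1:] * p) z * exp (- z)) \<longlongrightarrow> 0) at_top" by (rule poly_exp_tendsto_0)
      then have "((\<lambda>h. poly ([:0, 1:] * p) (inverse h) * exp (- inverse h)) \<longlongrightarrow> 0) (at_right 0)"
        by (rule filterlim_compose[OF _ filterlim_inverse_at_top_right])
      then show ?thesis
      proof (rule Lim_transform_eventually)
        show "\<forall>\<^sub>F h in at_right 0. poly ([:0, 1:] * p) (inverse h) * exp (- inverse h) = flat_exp p h / h"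
          unfolding eventually_at_right_field
          by (intro exI[of _ 1]) (auto simp: flat_exp_def divide_inverse)
      qed
    qed
    moreover have "((\<lambda>h. flat_exp p h / h) \<longlongrightarrow> 0) (at_left 0)"
    proof (rule tendsto_eventually)
      show "\<forall>\<^sub>F h in at_left 0. flat_exp p h / h = 0"
        unfolding eventually_at_left_field
        by (intro exI[of _ "-1"]) (auto simp: flat_exp_def)
    qed
    ultimately have "((\<lambda>h. flat_exp p h / h) \<longlongrightarrow> 0) (at 0)"
      by (simp add: filterlim_at_split)
    then show ?thesis unfolding 3 DERIV_def by (simp add: flat_exp_def)
  qed
qed

text \<open>The product rule turns one product into two, hence the closure under sums. For positive
  \<open>n\<close> the factors live to the right of \<open>a\<close> and to the left of
  \<open>b\<close>, and \<open>n\<close> regulates how steeply they rise.\<close>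

inductive_set bump_span :: "real \<Rightarrow> real \<Rightarrow> real \<Rightarrow> (real \<Rightarrow> real) set" for n a b where
  base: "(\<lambda>x. c * flat_exp p (n * (x - a)) * flat_exp q (n * (b - x))) \<in> bump_span n a b"
| add: "f \<in> bump_span n a b \<Longrightarrow> g \<in> bump_span n a b \<Longrightarrow> (\<lambda>x. f x + g x) \<in> bump_span n a b"

lemma bump_span_derivative:
  "f \<in> bump_span n a b \<Longrightarrow> \<exists>f'\<in>bump_span n a b. \<forall>x. (f has_field_derivative f' x) (at x)"
proof (induction rule: bump_span.induct)
  case (base c p q)
  define p' q' where "p' = [:0, 0, 1:] * (p - pderiv p)" and "q' = [:0, 0, 1:] * (q - pderiv q)"
  have "((\<lambda>x. c * flat_exp p (n * (x - a)) * flat_exp q (n * (b - x))) has_field_derivative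
    (c * n) * flat_exp p' (n * (x - a)) * flat_exp q (n * (b - x)) +
    (- c * n) * flat_exp p (n * (x - a)) * flat_exp q' (n * (b - x))) (at x)" for x
  proof -
    have "((\<lambda>x. flat_exp p (n * (x - a))) has_field_derivative flat_exp p' (n * (x - a)) * n) (at x)"
      unfolding p'_def by (rule DERIV_chain2[OF flat_exp_derivative]) (auto intro!: derivative_eq_intros)
    moreover have "((\<lambda>x. flat_exp q (n * (b - x))) has_field_derivative flat_exp q' (n * (b - x)) * (- n)) (at x)"
      unfolding q'_def by (rule DERIV_chain2[OF flat_exp_derivative]) (auto intro!: derivative_eq_intros)
    ultimately show ?thesis
      by (auto intro!: derivative_eq_intros)
  qed
  then show ?case by (intro bexI[OF _ bump_span.add[OF bump_span.base bump_span.base]] allI)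
next
  case (add f g)
  then obtain f' g' where "f' \<in> bump_span n a b" "g' \<in> bump_span n a b"
    "\<forall>x. (f has_field_derivative f' x) (at x)" "\<forall>x. (g has_field_derivative g' x) (at x)" by blast
  then show ?case
    by (intro bexI[OF _ bump_span.add[of f' n a b g']] allI) (auto intro: DERIV_add)
qed

text \<open>A smooth substitute for the indicator of \<open>{a<..<b}\<close>: for positive
  \<open>n\<close> it vanishes outside that interval, it never exceeds 1, and it tends to the
  indicator as \<open>n\<close> grows.\<close>

definition bump :: "real \<Rightarrow> real \<Rightarrow> real \<Rightarrow> real \<Rightarrow> real" where
  "bump n a b x = flat_exp 1 (n * (x - a)) * flat_exp 1 (n * (b - x))"

text \<open>Two intervals occur together because the derivative of a test function has mean zero,
  which is arranged by balancing one bump against another.\<close>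

lemma smooth_bump_combination: "smooth (\<lambda>x. c * bump n a b x + d * bump n a' b' x)"
proof (rule smooth_coinduct[where S = "{\<lambda>x. f x + g x | f g. f \<in> bump_span n a b \<and> g \<in> bump_span n a' b'}"])
  have "(\<lambda>x. c * bump n a b x) \<in> bump_span n a b" for c a b
    unfolding bump_def mult.assoc[symmetric] by (rule bump_span.base)
  then show "(\<lambda>x. c * bump n a b x + d * bump n a' b' x) \<in> {\<lambda>x. f x + g x | f g. f \<in> bump_span n a b \<and> g \<in> bump_span n a' b'}"
    by (intro CollectI exI[of _ "\<lambda>x. c * bump n a b x"] exI[of _ "\<lambda>x. d * bump n a' b' x"]) auto
next
  fix h assume "h \<in> {\<lambda>x. f x + g x | f g. f \<in> bump_span n a b \<and> g \<in> bump_span n a' b'}"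
  then obtain f g where fg: "h = (\<lambda>x. f x + g x)" "f \<in> bump_span n a b" "g \<in> bump_span n a' b'" by auto
  obtain f' where f': "f' \<in> bump_span n a b" "\<forall>x. (f has_field_derivative f' x) (at x)"
    using bump_span_derivative[OF fg(2)] by blast
  obtain g' where g': "g' \<in> bump_span n a' b'" "\<forall>x. (g has_field_derivative g' x) (at x)"
    using bump_span_derivative[OF fg(3)] by blast
  show "\<exists>h'\<in>{\<lambda>x. f x + g x | f g. f \<in> bump_span n a b \<and> g \<in> bump_span n a' b'}. \<forall>x. (h has_field_derivative h' x) (at x)"
  proof (rule bexI[of _ "\<lambda>x. f' x + g' x"])
    show "\<forall>x. (h has_field_derivative f' x + g' x) (at x)"
      unfolding fg(1) using f' g' by (auto intro: DERIV_add)
  qed (use f' g' in blast)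
qed

lemma flat_exp_1_bounds: "0 \<le> flat_exp 1 y" "flat_exp 1 y \<le> 1"
  by (auto simp: flat_exp_def)

lemma bump_bounds: "0 \<le> bump n a b x" "bump n a b x \<le> 1"
  unfolding bump_def using flat_exp_1_bounds by (auto intro: mult_le_one)

lemma bump_eq_0: "0 < n \<Longrightarrow> x \<notin> {a<..<b} \<Longrightarrow> bump n a b x = 0"
  unfolding bump_def flat_exp_def by (auto simp: zero_less_mult_iff)

lemma continuous_on_flat_exp: "continuous_on A (flat_exp p)"
  by (intro continuous_at_imp_continuous_on ballI DERIV_isCont[OF flat_exp_derivative])

lemma continuous_on_bump: "continuous_on A (bump n a b)"
proof -
  have "continuous_on A (\<lambda>x. flat_exp 1 (n * (x - a)))" "continuous_on A (\<lambda>x. flat_exp 1 (n * (b - x)))"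
    by (rule continuous_on_compose2[OF continuous_on_flat_exp[of UNIV]], intro continuous_intros, simp)+
  then show ?thesis unfolding bump_def by (intro continuous_intros)
qed

lemma bump_tendsto:
  "(\<lambda>n. bump (real (Suc n)) a b x) \<longlonglongrightarrow> indicator {a<..<b} x"
proof (cases "x \<in> {a<..<b}")
  case True
  have lim: "(\<lambda>n. flat_exp 1 (real (Suc n) * y)) \<longlonglongrightarrow> 1" if "y > 0" for y
  proof -
    have "(\<lambda>n. exp (- (inverse (real (Suc n)) * inverse y))) \<longlonglongrightarrow> exp (- (0 * inverse y))"
      by (intro tendsto_intros LIMSEQ_inverse_real_of_nat)
    moreover have "flat_exp 1 (real (Suc n) * y) = exp (- (inverse (real (Suc n)) * inverse y))" for n
      using that by (simp add: flat_exp_def zero_less_mult_iff)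
    ultimately show ?thesis by simp
  qed
  have "(\<lambda>n. flat_exp 1 (real (Suc n) * (x - a)) * flat_exp 1 (real (Suc n) * (b - x))) \<longlonglongrightarrow> 1 * 1"
    by (rule tendsto_mult; rule lim) (use True in auto)
  then show ?thesis using True by (simp add: bump_def)
next
  case False
  then have "bump (real (Suc n)) a b x = 0" for n by (intro bump_eq_0) auto
  then show ?thesis using False by simp
qed

text \<open>The primitive from 0 vanishes up to the leftmost end point and is constant beyond the
  rightmost one. The mean-zero condition makes this constant zero, so the support is compact inside
  the open interval.\<close>

lemma test_function_with_derivative:
  assumes n: "0 < n" and ab: "0 < a" "a < b" "b < 1" "0 < a'" "a' < b'" "b' < 1"
    and 0: "integral {0..1} (\<lambda>x. c * bump n a b x + d * bump n a' b' x) = 0"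
  shows "\<exists>\<theta>\<in>test_functions. deriv \<theta> = (\<lambda>x. c * bump n a b x + d * bump n a' b' x)"
proof -
  define \<beta> where "\<beta> = (\<lambda>x. c * bump n a b x + d * bump n a' b' x)"
  define \<alpha> \<gamma> where "\<alpha> = min a a'" and "\<gamma> = max b b'"
  have \<alpha>\<gamma>: "0 < \<alpha>" "\<alpha> < \<gamma>" "\<gamma> < 1" using ab by (auto simp: \<alpha>_def \<gamma>_def)
  have \<beta>0: "\<beta> x = 0" if "x \<le> \<alpha> \<or> \<gamma> \<le> x" for x
    using that bump_eq_0[OF n, of x a b] bump_eq_0[OF n, of x a' b'] by (auto simp: \<beta>_def \<alpha>_def \<gamma>_def)
  have \<beta>c: "continuous_on A \<beta>" for A
    unfolding \<beta>_def by (intro continuous_intros continuous_on_bump)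
  have \<beta>i: "\<beta> integrable_on {x..y}" for x y by (rule integrable_continuous_real[OF \<beta>c])
  define \<theta> where "\<theta> = (\<lambda>x. integral {0..x} \<beta>)"
  have left: "\<theta> x = 0" if "x \<le> \<alpha>" for x
    unfolding \<theta>_def by (rule integral_unique, rule has_integral_is_0) (use \<beta>0 that in auto)
  have tail: "integral {\<gamma>..x} \<beta> = 0" for x
    by (rule integral_unique, rule has_integral_is_0) (use \<beta>0 in auto)
  have comb: "\<theta> x = \<theta> \<gamma>" if "\<gamma> \<le> x" for x
    unfolding \<theta>_def using Henstock_Kurzweil_Integration.integral_combine[of 0 \<gamma> x \<beta>] \<beta>i tail \<alpha>\<gamma> that by simp
  have "\<theta> 1 = 0" using 0 unfolding \<theta>_def \<beta>_def .
  then have right: "\<theta> x = 0" if "\<gamma> \<le> x" for x using comb[OF that] comb[of 1] \<alpha>\<gamma> by simp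
  have deriv: "(\<theta> has_field_derivative \<beta> x) (at x)" for x
  \<comment> \<open>To the left the primitive is identically 0, also at negative arguments, where it
    is an integral over an empty interval; differentiation of an integral is applied at positive
    points only.\<close>
  proof (cases "x < \<alpha>")
    case True
    have "((\<lambda>y. 0) has_field_derivative \<beta> x) (at x)" using \<beta>0[of x] True by simp
    moreover have "\<forall>\<^sub>F y in nhds x. \<theta> y = 0"
      using eventually_nhds_in_open[of "{..<\<alpha>}" x] True left by (auto elim: eventually_mono)
    ultimately show ?thesis by (subst DERIV_cong_ev[OF refl _ refl])
  next
    case False
    then have x: "0 < x" using \<alpha>\<gamma> by simp
    have "(\<theta> has_field_derivative \<beta> x) (at x within {0..x+1})"
      unfolding \<theta>_def by (rule integral_has_real_derivative[OF \<beta>c]) (use x in auto)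
    moreover have "at x within {0..x+1} = at x"
      by (rule at_within_interior) (use x in auto)
    ultimately show ?thesis by simp
  qed
  have "smooth \<theta>"
    by (rule smooth_antiderivative[OF _ deriv]) (unfold \<beta>_def, rule smooth_bump_combination)
  moreover have "\<exists>K. compact K \<and> K \<subseteq> I01 \<and> (\<forall>x. x \<notin> K \<longrightarrow> \<theta> x = 0)"
    by (rule exI[of _ "{\<alpha>..\<gamma>}"]) (use \<alpha>\<gamma> left right in auto)
  ultimately have "\<theta> \<in> test_functions" unfolding test_functions_def smooth_def by blast
  moreover have "deriv \<theta> = \<beta>" by (rule ext) (rule DERIV_imp_deriv[OF deriv])
  ultimately show ?thesis unfolding \<beta>_def by blast
qed

section \<open>From weak derivatives to absolutely continuous representatives\<close>

lemma integrable_Icc_iff_Ioo: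
  fixes f :: "real \<Rightarrow> 'a::euclidean_space"
  shows "integrable (lebesgue_on {a..b}) f \<longleftrightarrow> integrable (lebesgue_on {a<..<b}) f"
proof -
  have *: "integrable (lebesgue_on S) f \<longleftrightarrow> f absolutely_integrable_on S" if "S \<in> sets lebesgue" for S
    using that by (simp add: set_integrable_def integrable_restrict_space)
  show ?thesis by (simp add: * absolutely_integrable_on_Icc_iff_Ioo)
qed

lemma integral_Icc_eq_Ioo:
  fixes f :: "real \<Rightarrow> 'a::euclidean_space"
  assumes "integrable (lebesgue_on {a..b}) f"
  shows "(\<integral>x. f x \<partial>lebesgue_on {a..b}) = (\<integral>x. f x \<partial>lebesgue_on {a<..<b})"
  using assms integrable_Icc_iff_Ioo[of a b f]
  by (simp add: lebesgue_integral_eq_integral integral_open_interval_real)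

lemma indicator_mult_integrable:
  fixes h :: "real \<Rightarrow> complex"
  assumes h: "integrable M01 h"
  shows "integrable M01 (\<lambda>x. of_real (indicator {a<..<b} x) * h x)"
proof (rule Bochner_Integration.integrable_bound[OF h])
  have [measurable]: "h \<in> borel_measurable M01" using h by auto
  have [measurable]: "(indicator {a<..<b} :: real \<Rightarrow> real) \<in> borel_measurable M01"
    by (rule measurable_restrict_space1, rule measurable_completion) simp
  show "(\<lambda>x. of_real (indicator {a<..<b} x) * h x) \<in> borel_measurable M01"
    by measurable
  show "AE x in M01. cmod (of_real (indicator {a<..<b} x) * h x) \<le> cmod (h x)"
    by (auto simp: norm_mult indicator_def)
qed

lemma integral_Icc_0_eq_indicator:
  fixes h :: "real \<Rightarrow> complex"
  assumes h: "integrable M01 h" and a: "0 < a" "a < 1"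
  shows "integral {0..a} h = (\<integral>x. of_real (indicator {0<..<a} x) * h x \<partial>M01)"
proof -
  have "(\<integral>x. of_real (indicator {0<..<a} x) * h x \<partial>M01) = integral I01 (\<lambda>x. of_real (indicator {0<..<a} x) * h x)"
    by (rule lebesgue_integral_eq_integral[OF indicator_mult_integrable[OF h]]) simp
  also have "\<dots> = integral I01 (\<lambda>x. if x \<in> {0<..<a} then h x else 0)"
    by (intro arg_cong[where f = "integral I01"]) (auto simp: indicator_def)
  also have "integral I01 (\<lambda>x. if x \<in> {0<..<a} then h x else 0) = integral ({0<..<a} \<inter> I01) h"
    by (rule Henstock_Kurzweil_Integration.integral_restrict_Int)
  also have "{0<..<a} \<inter> I01 = {0<..<a}" using a by auto
  finally show ?thesis by (simp add: integral_open_interval_real)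
qed

text \<open>Testing with primitives of mean-zero combinations of two bumps shows, as the bumps
  sharpen, that \<open>k\<close> has the same mean over all intervals inside the unit interval.
  Lebesgue differentiation then makes it constant.\<close>

lemma du_bois_reymond:
  fixes k :: "real \<Rightarrow> complex"
  assumes k: "integrable M01 k"
    and 0: "\<And>\<theta>. \<theta> \<in> test_functions \<Longrightarrow> (\<integral>x. of_real (deriv \<theta> x) * k x \<partial>M01) = 0"
  shows "\<exists>m. AE x in M01. k x = m"
proof -
  have km [measurable]: "k \<in> borel_measurable M01" using k by auto
  have bm [measurable]: "bump n a b \<in> borel_measurable M01" for n a b
    by (intro continuous_on_measurable_M01 continuous_on_bump)
  define I where "I = (\<lambda>a b. \<integral>x. of_real (indicator {a<..<b} x) * k x \<partial>M01)"
  define J where "J = (\<lambda>n a b. \<integral>x. of_real (bump (real (Suc n)) a b x) * k x \<partial>M01)"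
  define w where "w = (\<lambda>n a b. \<integral>x. bump (real (Suc n)) a b x \<partial>M01)"
  have bki: "integrable M01 (\<lambda>x. of_real (bump n a b x) * k x)" for n a b
  proof (rule Bochner_Integration.integrable_bound[OF k])
    show "AE x in M01. cmod (of_real (bump n a b x) * k x) \<le> cmod (k x)"
      using bump_bounds[of n a b] by (auto simp: norm_mult intro!: AE_I2 mult_left_le_one_le)
  qed measurable
  have bi: "integrable M01 (bump n a b)" for n a b
    by (intro L2_integrable continuous_on_L2 continuous_on_bump)
  have indm [measurable]: "(indicator {a<..<b} :: real \<Rightarrow> real) \<in> borel_measurable M01" for a b :: real
    by (rule measurable_restrict_space1, rule measurable_completion) simp
  have J: "(\<lambda>n. J n a b) \<longlonglongrightarrow> I a b" for a b
    unfolding J_def I_def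
  proof (rule integral_dominated_convergence)
    show "integrable M01 (\<lambda>x. cmod (k x))" using k by simp
    show "AE x in M01. (\<lambda>n. of_real (bump (real (Suc n)) a b x) * k x) \<longlonglongrightarrow> of_real (indicator {a<..<b} x) * k x"
      by (intro AE_I2 tendsto_mult tendsto_of_real bump_tendsto tendsto_const)
    show "AE x in M01. cmod (of_real (bump (real (Suc n)) a b x) * k x) \<le> cmod (k x)" for n
      using bump_bounds[of "real (Suc n)" a b] by (auto simp: norm_mult intro!: AE_I2 mult_left_le_one_le)
  qed measurable
  have w: "(\<lambda>n. w n a b) \<longlonglongrightarrow> b - a" if ab: "0 < a" "a < b" "b < 1" for a b
  proof -
    have "(\<lambda>n. w n a b) \<longlonglongrightarrow> (\<integral>x. indicator {a<..<b} x \<partial>M01)"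
      unfolding w_def
    proof (rule integral_dominated_convergence)
      show "integrable M01 (\<lambda>x. 1::real)" by simp
      show "AE x in M01. (\<lambda>n. bump (real (Suc n)) a b x) \<longlonglongrightarrow> indicator {a<..<b} x"
        by (intro AE_I2 bump_tendsto)
      show "AE x in M01. norm (bump (real (Suc n)) a b x) \<le> 1" for n
        using bump_bounds[of "real (Suc n)" a b] by auto
    qed measurable
    also have "(\<integral>x. indicator {a<..<b} x \<partial>M01) = measure M01 ({a<..<b} \<inter> space M01)"
      by (rule Bochner_Integration.integral_indicator)
    also have "\<dots> = measure lebesgue {a<..<b}"
    proof -
      have "{a<..<b} \<inter> I01 = {a<..<b}" using ab by auto
      then show ?thesis using ab by (subst measure_restrict_space) auto
    qed
    finally show ?thesis using ab by simp
  qed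
  have key: "of_real (b' - a') * I a b = of_real (b - a) * I a' b'"
    if ab: "0 < a" "a < b" "b < 1" "0 < a'" "a' < b'" "b' < 1" for a b a' b'
  proof -
    have "of_real (w n a' b') * J n a b = of_real (w n a b) * J n a' b'" for n
    proof -
      let ?n = "real (Suc n)"
      \<comment> \<open>Each bump is weighted by the mass of the other one, so the combination has
        mean zero; in the limit the masses become the interval lengths.\<close>
      let ?\<beta> = "\<lambda>x. w n a' b' * bump ?n a b x + (- w n a b) * bump ?n a' b' x"
      have "integral {0..1} ?\<beta> = (\<integral>x. ?\<beta> x \<partial>M01)"
        by (rule integral_M01_eq[symmetric]) (intro Bochner_Integration.integrable_add integrable_mult_right bi)
      also have "\<dots> = w n a' b' * w n a b + (- w n a b) * w n a' b'"
        unfolding w_def using bi by (subst Bochner_Integration.integral_add) auto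
      finally have "integral {0..1} ?\<beta> = 0" by simp
      then obtain \<theta> where \<theta>: "\<theta> \<in> test_functions" "deriv \<theta> = ?\<beta>"
        using test_function_with_derivative[of ?n a b a' b' "w n a' b'" "- w n a b"] ab by auto
      have "0 = (\<integral>x. of_real (?\<beta> x) * k x \<partial>M01)" using 0[OF \<theta>(1)] unfolding \<theta>(2) by simp
      also have "\<dots> = (\<integral>x. of_real (w n a' b') * (of_real (bump ?n a b x) * k x)
        - of_real (w n a b) * (of_real (bump ?n a' b' x) * k x) \<partial>M01)"
        by (intro Bochner_Integration.integral_cong refl) (simp add: algebra_simps)
      also have "\<dots> = of_real (w n a' b') * J n a b - of_real (w n a b) * J n a' b'"
        unfolding J_def using bki
        by (subst Bochner_Integration.integral_diff) (auto simp only: integrable_mult_right integral_mult_right_zero)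
      finally show ?thesis by simp
    qed
    moreover have "(\<lambda>n. of_real (w n a' b') * J n a b) \<longlonglongrightarrow> of_real (b' - a') * I a b"
      by (intro tendsto_mult tendsto_of_real w J ab)
    moreover have "(\<lambda>n. of_real (w n a b) * J n a' b') \<longlonglongrightarrow> of_real (b - a) * I a' b'"
      by (intro tendsto_mult tendsto_of_real w J ab)
    ultimately show ?thesis by (simp only:) (rule LIMSEQ_unique)
  qed
  \<comment> \<open>The mean of \<open>k\<close> over a reference interval of length 1/2.\<close>
  define m where "m = 2 * I (1/4) (3/4)"
  have Iab: "I a b = of_real (b - a) * m" if "0 < a" "a < b" "b < 1" for a b
    using key[OF that, of "1/4" "3/4"] by (simp add: m_def)
  have I0: "I 0 b = of_real b * m" if b: "0 < b" "b < 1" for b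
  proof -
    \<comment> \<open>Left end points that tend to 0 but stay inside \<open>(0, b)\<close>: the
      comparison of means covers intervals compactly contained in the unit interval, whereas initial
      intervals start at 0.\<close>
    define e where "e = (\<lambda>n. b / real (n + 2))"
    have e: "0 < e n" "e n < b" for n
      using b mult_strict_left_mono[of 1 "real (n + 2)" b] by (simp_all add: e_def divide_less_eq mult.commute)
    have e0: "e \<longlonglongrightarrow> 0"
      unfolding e_def using LIMSEQ_ignore_initial_segment[OF lim_const_over_n[of b], of 2] by simp
    have "(\<lambda>n. I (e n) b) \<longlonglongrightarrow> I 0 b"
      unfolding I_def
    proof (rule integral_dominated_convergence)
      show "integrable M01 (\<lambda>x. cmod (k x))" using k by simp
      show "AE x in M01. cmod (of_real (indicator {e n<..<b} x) * k x) \<le> cmod (k x)" for n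
        by (auto simp: norm_mult indicator_def)
      show "AE x in M01. (\<lambda>n. of_real (indicator {e n<..<b} x) * k x) \<longlonglongrightarrow> of_real (indicator {0<..<b} x) * k x"
      proof (rule AE_I2)
        fix x assume "x \<in> space M01"
        then have "0 < x" by simp
        then have "\<forall>\<^sub>F n in sequentially. e n < x" using order_tendstoD(2)[OF e0] by simp
        then have "\<forall>\<^sub>F n in sequentially. of_real (indicator {e n<..<b} x) * k x = of_real (indicator {0<..<b} x) * k x"
          by eventually_elim (use \<open>0 < x\<close> in \<open>auto simp: indicator_def\<close>)
        then show "(\<lambda>n. of_real (indicator {e n<..<b} x) * k x) \<longlonglongrightarrow> of_real (indicator {0<..<b} x) * k x"
          by (rule tendsto_eventually)
      qed
    qed measurable
    moreover have "(\<lambda>n. of_real (b - e n) * m) \<longlonglongrightarrow> of_real (b - 0) * m"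
      by (intro tendsto_intros e0)
    moreover have "I (e n) b = of_real (b - e n) * m" for n by (rule Iab) (use e b in auto)
    ultimately have "I 0 b = of_real (b - 0) * m" by (simp only:) (rule LIMSEQ_unique)
    then show ?thesis by simp
  qed
  have "AE x in M01. k x - m = 0"
  proof (rule integral_zero_imp_AE_zero)
    show "integrable M01 (\<lambda>x. k x - m)" using k by simp
    fix a :: real assume a: "0 < a" "a < 1"
    have "k integrable_on {0..1}"
      using integrable_on_lebesgue_on[OF k] integrable_on_open_interval_real[of k 0 1] by simp
    then have "k integrable_on {0..a}" by (rule integrable_on_subinterval) (use a in auto)
    then have "integral {0..a} (\<lambda>x. k x - m) = integral {0..a} k - of_real a * m"
      using a by (subst integral_diff) (auto simp: scaleR_conv_of_real)
    also have "integral {0..a} k = I 0 a"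
      unfolding I_def by (rule integral_Icc_0_eq_indicator[OF k a])
    finally show "integral {0..a} (\<lambda>x. k x - m) = 0" using I0[OF a] by simp
  qed
  then have "AE x in M01. k x = m" by eventually_elim simp
  then show ?thesis by blast
qed

lemma test_function_C1:
  assumes "\<theta> \<in> test_functions"
  shows "(\<theta> has_field_derivative deriv \<theta> x) (at x)" "continuous_on A (deriv \<theta>)" "\<theta> 0 = 0" "\<theta> 1 = 0"
    "deriv \<theta> \<in> test_functions"
proof -
  obtain K where sm: "smooth \<theta>" and K: "compact K" "K \<subseteq> I01" "\<And>x. x \<notin> K \<Longrightarrow> \<theta> x = 0"
    using assms unfolding test_functions_def smooth_def by blast
  have d: "(deriv ^^ n) \<theta> differentiable (at x)" for n x using sm by (simp add: smooth_def)
  have "deriv \<theta> differentiable (at x)" for x using d[of 1 x] by simp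
  then show "continuous_on A (deriv \<theta>)"
    by (intro continuous_at_imp_continuous_on ballI differentiable_imp_continuous_within) auto
  show "(\<theta> has_field_derivative deriv \<theta> x) (at x)" for x
    using d[of 0 x] by (simp add: DERIV_deriv_iff_real_differentiable)
  have "0 \<notin> K" "1 \<notin> K" using K(2) by auto
  then show "\<theta> 0 = 0" "\<theta> 1 = 0" using K(3) by auto
  have "deriv \<theta> x = 0" if "x \<notin> K" for x
  proof (rule DERIV_imp_deriv)
    have "\<forall>\<^sub>F y in nhds x. \<theta> y = 0"
      using eventually_nhds_in_open[of "- K" x] K(1,3) that by (auto simp: compact_imp_closed open_Compl elim: eventually_mono)
    moreover have "((\<lambda>y. 0) has_field_derivative 0) (at x)" by simp
    ultimately show "(\<theta> has_field_derivative 0) (at x)" by (subst DERIV_cong_ev[OF refl _ refl])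
  qed
  then have "\<exists>K. compact K \<and> K \<subseteq> I01 \<and> (\<forall>x. x \<notin> K \<longrightarrow> deriv \<theta> x = 0)" using K by blast
  then show "deriv \<theta> \<in> test_functions"
    using smooth_deriv[OF sm] unfolding test_functions_def smooth_def by blast
qed

text \<open>Integration by parts shows that \<open>f\<close> minus the primitive of \<open>g\<close>
  has vanishing weak derivative, so it is constant. Complex values give access to the calculus of
  \<open>primitive_on\<close>; the real part leads back.\<close>

lemma weak_deriv_imp_primitive:
  assumes "has_weak_deriv 1 f g"
  shows "\<exists>c. AE x in M01. f x = c + (\<integral>y. g y \<partial>leb x)"
proof -
  have f: "f \<in> L2 I01" and g: "g \<in> L2 I01"
    and wd: "\<And>\<theta>. \<theta> \<in> test_functions \<Longrightarrow> (\<integral>x. f x * deriv \<theta> x \<partial>M01) = - (\<integral>x. g x * \<theta> x \<partial>M01)"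
    using assms by (auto simp: has_weak_deriv_def)
  define G :: "real \<Rightarrow> complex" where "G = (\<lambda>x. \<integral>y. of_real (g y) \<partial>leb x)"
  have gi: "integrable (leb 1) g"
    using L2_integrable[OF g] by (simp add: integrable_Icc_iff_Ioo)
  have cgi: "integrable (leb 1) (\<lambda>x. complex_of_real (g x))" using gi by simp
  have G: "primitive_on 1 G (\<lambda>x. of_real (g x))"
  proof (rule primitive_on_indefinite_integral)
    show "integrable (leb 1) (\<lambda>x. complex_of_real (g x))" by (rule cgi)
  qed (simp add: G_def)
  note Gc = primitive_on_continuous[OF G]
  define k where "k = (\<lambda>x. of_real (f x) - G x)"
  have "\<exists>m. AE x in M01. k x = m"
  proof (rule du_bois_reymond)
    show "integrable M01 k"
      unfolding k_def by (intro Bochner_Integration.integrable_diff L2_integrable L2_of_real f continuous_on_L2 Gc)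
    fix \<theta> assume \<theta>: "\<theta> \<in> test_functions"
    note t = test_function_C1[OF \<theta>]
    have tc: "continuous_on A \<theta>" for A
      by (intro continuous_at_imp_continuous_on ballI DERIV_isCont[OF t(1)])
    have "primitive_on 1 (\<lambda>x. complex_of_real (\<theta> x)) (\<lambda>x. of_real (deriv \<theta> x))"
    proof (rule primitive_on_vector_derivative)
      show "((\<lambda>x. complex_of_real (\<theta> x)) has_vector_derivative of_real (deriv \<theta> x)) (at x within {0..1})" for x
        by (intro has_vector_derivative_of_real has_vector_derivative_at_within)
           (simp flip: has_real_derivative_iff_has_vector_derivative add: t(1))
      show "continuous_on {0..1} (\<lambda>x. complex_of_real (deriv \<theta> x))" by (intro continuous_intros t(2))
    qed
    from primitive_on_mult[OF G this]
    have P: "primitive_on 1 (\<lambda>x. G x * of_real (\<theta> x)) (\<lambda>x. of_real (g x) * of_real (\<theta> x) + G x * of_real (deriv \<theta> x))" .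
    have i1: "integrable M01 (\<lambda>x. complex_of_real (g x) * of_real (\<theta> x))"
      by (intro L2_integrable_mult L2_of_real g continuous_on_L2 tc)
    have i2: "integrable M01 (\<lambda>x. G x * of_real (deriv \<theta> x))"
      by (intro L2_integrable_mult L2_of_real continuous_on_L2 Gc t(2))
    have i3: "integrable M01 (\<lambda>x. complex_of_real (f x) * of_real (deriv \<theta> x))"
      by (intro L2_integrable_mult L2_of_real f continuous_on_L2 t(2))
    \<comment> \<open>Test functions vanish at both end points, so the product rule leaves no
      boundary term.\<close>
    have "0 = (\<integral>x. of_real (g x) * of_real (\<theta> x) + G x * of_real (deriv \<theta> x) \<partial>leb 1)"
      using primitive_on_eq[OF P, of 1] t(3,4) by simp
    also have "\<dots> = (\<integral>x. of_real (g x) * of_real (\<theta> x) + G x * of_real (deriv \<theta> x) \<partial>M01)"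
      by (rule integral_Icc_eq_Ioo[OF primitive_on_integrable[OF P]])
    also have "\<dots> = (\<integral>x. of_real (g x) * of_real (\<theta> x) \<partial>M01) + (\<integral>x. G x * of_real (deriv \<theta> x) \<partial>M01)"
      by (rule Bochner_Integration.integral_add[OF i1 i2])
    also have "(\<integral>x. complex_of_real (g x) * of_real (\<theta> x) \<partial>M01) = of_real (\<integral>x. g x * \<theta> x \<partial>M01)"
      by (simp only: of_real_mult[symmetric] integral_complex_of_real)
    also have "\<dots> = - of_real (\<integral>x. f x * deriv \<theta> x \<partial>M01)" using wd[OF \<theta>] by simp
    also have "\<dots> = - (\<integral>x. of_real (f x) * of_real (deriv \<theta> x) \<partial>M01)"
      by (simp only: of_real_mult[symmetric] integral_complex_of_real)
    finally have "(\<integral>x. of_real (f x) * of_real (deriv \<theta> x) \<partial>M01) - (\<integral>x. G x * of_real (deriv \<theta> x) \<partial>M01) = 0"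
      by (simp add: add_eq_0_iff)
    then have "(\<integral>x. of_real (f x) * of_real (deriv \<theta> x) - G x * of_real (deriv \<theta> x) \<partial>M01) = 0"
      by (simp only: Bochner_Integration.integral_diff[OF i3 i2])
    then show "(\<integral>x. of_real (deriv \<theta> x) * k x \<partial>M01) = 0"
      unfolding k_def by (simp only: right_diff_distrib mult.commute)
  qed
  then obtain m where "AE x in M01. k x = m" by blast
  then have "AE x in M01. f x = Re m + (\<integral>y. g y \<partial>leb x)"
    unfolding k_def G_def integral_complex_of_real by eventually_elim auto
  then show ?thesis by blast
qed

text \<open>\<open>sobolev_H\<close> tests each order directly against higher derivatives. The chain
  of first-order derivatives is recovered because the derivative of a test function is again a test
  function.\<close>

lemma weak_deriv_shift:
  assumes "has_weak_deriv 1 f f1" "has_weak_deriv 2 f f2"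
  shows "has_weak_deriv 1 f1 f2"
  unfolding has_weak_deriv_def
proof (intro conjI ballI)
  show "f1 \<in> L2 I01" "f2 \<in> L2 I01" using assms by (auto simp: has_weak_deriv_def)
  fix \<theta> assume \<theta>: "\<theta> \<in> test_functions"
  have "(\<integral>x. f x * deriv (deriv \<theta>) x \<partial>M01) = - (\<integral>x. f1 x * deriv \<theta> x \<partial>M01)"
    using assms(1) test_function_C1(5)[OF \<theta>] by (auto simp: has_weak_deriv_def)
  moreover have "(\<integral>x. f x * deriv (deriv \<theta>) x \<partial>M01) = (\<integral>x. f2 x * \<theta> x \<partial>M01)"
    using assms(2) \<theta> by (auto simp: has_weak_deriv_def numeral_2_eq_2)
  ultimately show "(\<integral>x. f1 x * (deriv ^^ 1) \<theta> x \<partial>M01) = (- 1) ^ 1 * (\<integral>x. f2 x * \<theta> x \<partial>M01)"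
    by simp
qed

text \<open>Applying the first-order result twice gives a continuously differentiable version
  \<open>M\<close> of the potential whose derivative has the density \<open>g\<close>; the gauge
  factor can then be differentiated pointwise.\<close>

lemma sobolev_representative:
  assumes \<mu>: "\<mu> \<in> sobolev_H m" "2 \<le> m" and \<mu>': "has_weak_deriv 1 \<mu> \<mu>'"
  obtains M N g :: "real \<Rightarrow> real"
  where "AE x in M01. \<mu> x = M x" "AE x in M01. \<mu>' x = N x" "g \<in> L2 I01"
    "\<And>x. x \<in> {0..1} \<Longrightarrow> (M has_vector_derivative N x) (at x within {0..1})"
    "primitive_on 1 (\<lambda>x. of_real (N x)) (\<lambda>x. of_real (g x))"
proof -
  obtain g where g: "has_weak_deriv 2 \<mu> g" using \<mu> by (auto simp: sobolev_H_def)
  then have gL2: "g \<in> L2 I01" by (simp add: has_weak_deriv_def)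
  obtain m0 where m0: "AE x in M01. \<mu> x = m0 + (\<integral>y. \<mu>' y \<partial>leb x)"
    using weak_deriv_imp_primitive[OF \<mu>'] by blast
  obtain n0 where n0: "AE x in M01. \<mu>' x = n0 + (\<integral>y. g y \<partial>leb x)"
    using weak_deriv_imp_primitive[OF weak_deriv_shift[OF \<mu>' g]] by blast
  define N where "N = (\<lambda>x. n0 + (\<integral>y. g y \<partial>leb x))"
  \<comment> \<open>Integrating the continuous \<open>N\<close> instead of \<open>\<mu>'\<close>
    makes the derivative exist at every point; \<open>eq\<close> shows that the integral is the
    same.\<close>
  define M where "M = (\<lambda>x. m0 + integral {0..x} N)"
  have n0': "AE x in M01. \<mu>' x = N x" unfolding N_def by (rule n0)
  have gi: "integrable (leb 1) g"
    using L2_integrable[OF gL2] by (simp add: integrable_Icc_iff_Ioo)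
  have Nc: "continuous_on {0..1} N"
    unfolding N_def by (intro continuous_intros indefinite_integral_continuous_real gi)
  have N: "primitive_on 1 (\<lambda>x. of_real (N x)) (\<lambda>x. complex_of_real (g x))"
  proof (rule primitive_on_indefinite_integral)
    show "integrable (leb 1) (\<lambda>x. complex_of_real (g x))" using gi by simp
  qed (simp add: N_def)
  have M: "(M has_vector_derivative N x) (at x within {0..1})" if "x \<in> {0..1}" for x
    unfolding M_def using integral_has_vector_derivative[OF Nc that]
    by (auto intro!: derivative_eq_intros)
  have eq: "(\<integral>y. \<mu>' y \<partial>leb x) = integral {0..x} N" if x: "x \<in> I01" for x
  proof -
    have m'i: "integrable (leb 1) \<mu>'"
      using \<mu>' L2_integrable[of \<mu>'] by (simp add: integrable_Icc_iff_Ioo has_weak_deriv_def)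
    have i1: "integrable (leb x) \<mu>'"
      by (rule integrable_subinterval_Icc[OF m'i]) (use x in auto)
    have i2: "integrable (leb x) N"
      by (rule integrable_continuous_Icc, rule continuous_on_subset[OF Nc]) (use x in auto)
    have "AE y in lebesgue. y \<in> I01 \<longrightarrow> \<mu>' y = N y"
      using n0' by (subst (asm) AE_restrict_space_iff) auto
    then have "AE y in lebesgue. y \<in> {0<..<x} \<longrightarrow> \<mu>' y = N y"
      by eventually_elim (use x in auto)
    then have ae: "AE y in lebesgue_on {0<..<x}. \<mu>' y = N y"
      by (subst AE_restrict_space_iff) auto
    have "(\<integral>y. \<mu>' y \<partial>leb x) = (\<integral>y. \<mu>' y \<partial>lebesgue_on {0<..<x})"
      by (rule integral_Icc_eq_Ioo[OF i1])
    also have "\<dots> = (\<integral>y. N y \<partial>lebesgue_on {0<..<x})"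
      by (rule integral_cong_AE[OF _ _ ae]) (use i1 i2 in \<open>auto simp: integrable_Icc_iff_Ioo\<close>)
    also have "\<dots> = (\<integral>y. N y \<partial>leb x)"
      by (rule integral_Icc_eq_Ioo[OF i2, symmetric])
    also have "\<dots> = integral {0..x} N" by (rule lebesgue_integral_eq_integral[OF i2]) simp
    finally show ?thesis .
  qed
  have "AE x in M01. x \<in> I01" using AE_space[of M01] by simp
  with m0 have "AE x in M01. \<mu> x = M x"
    by eventually_elim (simp add: eq M_def)
  then show ?thesis by (rule that[OF _ n0' gL2 M N])
qed

subsection \<open>The gauged eigenfunctions\<close>

definition dphi :: "nat \<Rightarrow> real \<Rightarrow> complex" where
  "dphi k x = complex_of_real (sqrt 2 * (real k * pi) * cos (real k * pi * x))"

lemma has_vector_derivative_complex_of_real: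
  assumes "(f has_vector_derivative f') (at x within S)"
  shows "((\<lambda>x. complex_of_real (f x)) has_vector_derivative of_real f') (at x within S)"
  using bounded_linear.has_vector_derivative[OF bounded_linear_of_real assms] by simp

lemma phi_has_vector_derivative: "(phi k has_vector_derivative dphi k x) (at x within S)"
proof -
  have "((\<lambda>x. sqrt 2 * sin (real k * pi * x)) has_vector_derivative sqrt 2 * (real k * pi) * cos (real k * pi * x)) (at x within S)"
    unfolding has_real_derivative_iff_has_vector_derivative[symmetric]
    by (auto intro!: derivative_eq_intros)
  then show ?thesis unfolding phi_def dphi_def by (rule has_vector_derivative_complex_of_real)
qed

lemma dphi_has_vector_derivative:
  "(dphi k has_vector_derivative - of_real (eig k) * phi k x) (at x within S)"
proof -
  have "((\<lambda>x. sqrt 2 * (real k * pi) * cos (real k * pi * x)) has_vector_derivative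
      - eig k * (sqrt 2 * sin (real k * pi * x))) (at x within S)"
    unfolding has_real_derivative_iff_has_vector_derivative[symmetric]
    by (auto intro!: derivative_eq_intros simp: eig_def power2_eq_square)
  then have "((\<lambda>x. complex_of_real (sqrt 2 * (real k * pi) * cos (real k * pi * x))) has_vector_derivative
      of_real (- eig k * (sqrt 2 * sin (real k * pi * x)))) (at x within S)"
    by (rule has_vector_derivative_complex_of_real)
  then show ?thesis unfolding phi_def dphi_def by simp
qed

lemma continuous_on_dphi [continuous_intros]: "continuous_on A (dphi k)"
  unfolding dphi_def by (intro continuous_intros)

lemma phi_boundary [simp]: "phi k 0 = 0" "phi k 1 = 0"
  by (simp_all add: phi_def)

lemma primitive_on_phi: "primitive_on T (phi k) (dphi k)"
  by (rule primitive_on_vector_derivative[OF phi_has_vector_derivative continuous_on_dphi])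

lemma primitive_on_dphi: "primitive_on T (dphi k) (\<lambda>x. - of_real (eig k) * phi k x)"
  by (rule primitive_on_vector_derivative[OF dphi_has_vector_derivative])
     (intro continuous_intros)

lemma has_vector_derivative_exp_i:
  assumes "(f has_vector_derivative f') (at x within S)"
  shows "((\<lambda>x. exp (\<i> * complex_of_real (f x))) has_vector_derivative
    \<i> * of_real f' * exp (\<i> * of_real (f x))) (at x within S)"
proof -
  have "((\<lambda>x. \<i> * complex_of_real (f x)) has_vector_derivative \<i> * of_real f') (at x within S)"
    by (rule has_vector_derivative_mult_right[OF has_vector_derivative_complex_of_real[OF assms]])
  from field_vector_diff_chain_within[OF this DERIV_subset[OF DERIV_exp]]
  show ?thesis by (simp add: o_def)
qed

lemma primitive_on_cong:
  assumes "primitive_on T F f" "\<And>x. F x = F' x" "\<And>x. f x = f' x"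
  shows "primitive_on T F' f'"
proof -
  have "F' = F" "f' = f" using assms(2,3) by auto
  then show ?thesis using assms(1) by simp
qed

lemma exp_i_Taylor1: "cmod (exp (\<i> * of_real y) - 1) \<le> \<bar>y\<bar>"
  using Taylor_exp[of "\<i> * of_real y" 0] by (simp add: norm_mult)

lemma exp_i_Taylor2: "cmod (exp (\<i> * of_real y) - 1 - \<i> * of_real y) \<le> y\<^sup>2"
  using Taylor_exp[of "\<i> * of_real y" 1] by (simp add: norm_mult diff_diff_eq numeral_2_eq_2)

text \<open>A supremum bound on \<open>f\<close> against \<open>cmod (phi k x) \<le> sqrt 2\<close>,
  rounded up to 2. It is uniform in \<open>k\<close>.\<close>

lemma norm_L2_inner_phi_le:
  assumes "f \<in> L2 I01" "\<And>x. x \<in> I01 \<Longrightarrow> cmod (f x) \<le> c"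
  shows "cmod (L2_inner f (phi k)) \<le> 2 * c"
proof -
  have "c \<ge> 0" by (rule order_trans[OF norm_ge_zero assms(2)[of "1/2"]]) simp
  have "cmod (L2_inner f (phi k)) \<le> (\<integral>x. cmod (f x * cnj (phi k x)) \<partial>M01)"
    unfolding L2_inner_def by (rule integral_norm_bound)
  also have "\<dots> \<le> (\<integral>x. c * sqrt 2 \<partial>M01)"
  proof (rule integral_mono)
    show "integrable M01 (\<lambda>x. cmod (f x * cnj (phi k x)))"
      by (intro integrable_norm L2_inner_integrable assms phi_L2)
    show "cmod (f x * cnj (phi k x)) \<le> c * sqrt 2" if "x \<in> space M01" for x
      using assms(2)[of x] that norm_phi_le[of k x] \<open>c \<ge> 0\<close>
      unfolding norm_mult by (intro mult_mono) auto
  qed simp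
  also have "\<dots> = sqrt 2 * c" by (simp add: measure_M01)
  also have "\<dots> \<le> 2 * c" using \<open>c \<ge> 0\<close> sqrt2_less_2 by (intro mult_right_mono) auto
  finally show ?thesis .
qed

text \<open>\<open>M\<close> is the potential, \<open>N\<close> its classical derivative and
  \<open>g\<close> the second derivative, present as a density. Working with a regular
  representative keeps exceptional sets out of the gauge factor.\<close>

locale potential =
  fixes M N g :: "real \<Rightarrow> real"
  assumes M: "\<And>x. x \<in> {0..1} \<Longrightarrow> (M has_vector_derivative N x) (at x within {0..1})"
    and N: "primitive_on 1 (\<lambda>x. of_real (N x)) (\<lambda>x. of_real (g x))"
    and g: "g \<in> L2 I01"
begin

lemma M_continuous: "continuous_on {0..1} M"
  using M by (intro continuous_on_vector_derivative)

lemma N_continuous: "continuous_on {0..1} N"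
proof -
  have "continuous_on {0..1} (\<lambda>x. Re (of_real (N x)))"
    by (intro continuous_intros primitive_on_continuous[OF N])
  then show ?thesis by simp
qed

definition M_bound :: real where
  "M_bound = (SUP x\<in>{0..1}. \<bar>M x\<bar>)"

lemma M_le: "x \<in> {0..1} \<Longrightarrow> \<bar>M x\<bar> \<le> M_bound"
  unfolding M_bound_def
  by (rule cSUP_upper, assumption)
     (intro bounded_imp_bdd_above compact_imp_bounded compact_continuous_image continuous_intros M_continuous, simp)

lemma M_bound_nonneg: "0 \<le> M_bound"
  using M_le[of 0] by simp

text \<open>\<open>resid j s\<close> is \<open>(A - eig j)\<close> applied to \<open>gauged j s\<close>.\<close>

definition gauged :: "nat \<Rightarrow> real \<Rightarrow> real \<Rightarrow> complex" where
  "gauged j s x = exp (\<i> * of_real (s * M x)) * phi j x"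

definition resid :: "nat \<Rightarrow> real \<Rightarrow> real \<Rightarrow> complex" where
  "resid j s x = exp (\<i> * of_real (s * M x)) *
    (of_real (s\<^sup>2) * (of_real ((N x)\<^sup>2) * phi j x)
      - \<i> * of_real s * (2 * of_real (N x) * dphi j x + of_real (g x) * phi j x))"

lemma gauge_continuous: "continuous_on {0..1} (\<lambda>x. exp (\<i> * complex_of_real (s * M x)))"
  by (intro continuous_intros M_continuous)

lemma gauge_measurable: "(\<lambda>x. exp (\<i> * complex_of_real (s * M x))) \<in> borel_measurable M01"
  by (intro continuous_on_measurable_M01 gauge_continuous)

lemma gauged_continuous: "continuous_on {0..1} (gauged j s)"
  unfolding gauged_def by (intro continuous_intros gauge_continuous M_continuous)

lemma gauged_L2: "gauged j s \<in> L2 I01"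
  by (rule continuous_on_L2[OF gauged_continuous])

lemma resid_parts_L2:
  "(\<lambda>x. of_real ((N x)\<^sup>2) * phi j x) \<in> L2 I01"
  "(\<lambda>x. 2 * of_real (N x) * dphi j x + of_real (g x) * phi j x) \<in> L2 I01"
proof -
  show "(\<lambda>x. of_real ((N x)\<^sup>2) * phi j x) \<in> L2 I01"
    by (intro continuous_on_L2 continuous_intros N_continuous)
  have "(\<lambda>x. phi j x * of_real (g x)) \<in> L2 I01"
    by (rule L2_mult_bounded[OF L2_of_real[OF g] phi_measurable, of _ "sqrt 2"]) (simp add: norm_phi_le)
  moreover have "(\<lambda>x. 2 * of_real (N x) * dphi j x) \<in> L2 I01"
    by (intro continuous_on_L2 continuous_intros N_continuous)
  ultimately show "(\<lambda>x. 2 * of_real (N x) * dphi j x + of_real (g x) * phi j x) \<in> L2 I01"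
    by (subst mult.commute[of _ "phi j _"]) (rule L2_add)
qed

lemma resid_L2: "resid j s \<in> L2 I01"
  unfolding resid_def
  by (rule L2_mult_bounded[OF _ gauge_measurable, where c = 1])
     (intro L2_diff L2_scale resid_parts_L2, simp)

definition resid_bound :: "nat \<Rightarrow> real" where
  "resid_bound j = L2_norm I01 (\<lambda>x. of_real ((N x)\<^sup>2) * phi j x) +
    L2_norm I01 (\<lambda>x. 2 * of_real (N x) * dphi j x + of_real (g x) * phi j x)"

lemma resid_bound_nonneg: "0 \<le> resid_bound j"
  by (simp add: resid_bound_def)

text \<open>The gauge factor is unimodular and leaves the norm unchanged;
  \<open>\<bar>s\<bar> \<le> 1\<close> turns the quadratic term into a linear one, so that a single
  constant covers both.\<close>

lemma norm_resid_le:
  assumes "\<bar>s\<bar> \<le> 1"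
  shows "L2_norm I01 (resid j s) \<le> resid_bound j * \<bar>s\<bar>"
proof -
  define f1 f2 where "f1 = (\<lambda>x. of_real ((N x)\<^sup>2) * phi j x)"
    and "f2 = (\<lambda>x. 2 * of_real (N x) * dphi j x + of_real (g x) * phi j x)"
  have f: "f1 \<in> L2 I01" "f2 \<in> L2 I01" unfolding f1_def f2_def by (rule resid_parts_L2)+
  have r: "resid j s = (\<lambda>x. exp (\<i> * of_real (s * M x)) * (of_real (s\<^sup>2) * f1 x + (- \<i> * of_real s) * f2 x))"
    unfolding resid_def f1_def f2_def by simp
  have "L2_norm I01 (resid j s) \<le> 1 * L2_norm I01 (\<lambda>x. of_real (s\<^sup>2) * f1 x + (- \<i> * of_real s) * f2 x)"
    unfolding r
    by (rule L2_norm_mult_bounded[OF L2_add[OF L2_scale[OF f(1)] L2_scale[OF f(2)]] gauge_measurable]) auto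
  also have "\<dots> \<le> L2_norm I01 (\<lambda>x. of_real (s\<^sup>2) * f1 x) + L2_norm I01 (\<lambda>x. (- \<i> * of_real s) * f2 x)"
    by simp (rule L2_norm_triangle[OF L2_scale[OF f(1)] L2_scale[OF f(2)], of "of_real (s\<^sup>2)" "- \<i> * of_real s", simplified])
  also have "\<dots> = s\<^sup>2 * L2_norm I01 f1 + \<bar>s\<bar> * L2_norm I01 f2"
    unfolding L2_norm_scale by (simp add: norm_mult norm_power)
  also have "\<dots> \<le> \<bar>s\<bar> * L2_norm I01 f1 + \<bar>s\<bar> * L2_norm I01 f2"
  proof -
    have "s\<^sup>2 \<le> \<bar>s\<bar>" using mult_left_mono[OF assms, of "\<bar>s\<bar>"] by (simp add: power2_eq_square)
    then show ?thesis by (intro add_right_mono mult_right_mono) auto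
  qed
  finally show ?thesis by (simp add: resid_bound_def f1_def f2_def algebra_simps)
qed

lemma primitive_on_gauge:
  "primitive_on 1 (\<lambda>x. exp (\<i> * of_real (s * M x))) (\<lambda>x. \<i> * of_real (s * N x) * exp (\<i> * of_real (s * M x)))"
proof (rule primitive_on_vector_derivative)
  fix x :: real assume x: "x \<in> {0..1}"
  show "((\<lambda>x. exp (\<i> * of_real (s * M x))) has_vector_derivative \<i> * of_real (s * N x) * exp (\<i> * of_real (s * M x))) (at x within {0..1})"
    by (rule has_vector_derivative_exp_i, rule has_vector_derivative_mult_right[OF M[OF x]])
next
  show "continuous_on {0..1} (\<lambda>x. \<i> * of_real (s * N x) * exp (\<i> * of_real (s * M x)))"
    by (intro continuous_intros M_continuous N_continuous)
qed

text \<open>Green's formula on the unit interval. Both \<open>gauged j s\<close> and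
  \<open>phi k\<close> vanish at 0 and 1, so the boundary terms disappear although
  \<open>gauged j s\<close> need not satisfy further boundary conditions.\<close>

lemma resid_coefficient:
  "L2_inner (resid j s) (phi k) = of_real (eig k - eig j) * L2_inner (gauged j s) (phi k)"
proof -
  define e where "e = (\<lambda>x. exp (\<i> * complex_of_real (s * M x)))"
  define E where "E = (\<lambda>x. e x * phi j x)"
  define E1 where "E1 = (\<lambda>x. \<i> * of_real (s * N x) * e x * phi j x + e x * dphi j x)"
  \<comment> \<open>\<open>E1\<close> is the derivative of \<open>E\<close>, and \<open>E2\<close>
    is the density of \<open>E1\<close>, that is the second derivative, rewritten through the
    residual.\<close>
  define E2 where "E2 = (\<lambda>x. - resid j s x - of_real (eig j) * E x)"
  have e: "primitive_on 1 e (\<lambda>x. \<i> * of_real (s * N x) * e x)" unfolding e_def by (rule primitive_on_gauge)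
  have E: "primitive_on 1 E E1"
    unfolding E_def E1_def by (rule primitive_on_mult[OF e primitive_on_phi])
  have E1: "primitive_on 1 E1 E2"
  proof (rule primitive_on_cong)
    have "primitive_on 1 (\<lambda>x. \<i> * of_real s) (\<lambda>x. 0)" by (rule primitive_onI) auto
    from primitive_on_mult[OF primitive_on_mult[OF this N] E]
    show "primitive_on 1 (\<lambda>x. (\<i> * of_real s * of_real (N x)) * E x + e x * dphi j x)
      (\<lambda>x. ((0 * of_real (N x) + \<i> * of_real s * of_real (g x)) * E x + \<i> * of_real s * of_real (N x) * E1 x)
        + (\<i> * of_real (s * N x) * e x * dphi j x + e x * (- of_real (eig j) * phi j x)))"
      by (rule primitive_on_add[OF _ primitive_on_mult[OF e primitive_on_dphi]])
    show "(\<i> * of_real s * of_real (N x)) * E x + e x * dphi j x = E1 x" for x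
      by (simp add: E_def E1_def)
    show "((0 * of_real (N x) + \<i> * of_real s * of_real (g x)) * E x + \<i> * of_real s * of_real (N x) * E1 x)
        + (\<i> * of_real (s * N x) * e x * dphi j x + e x * (- of_real (eig j) * phi j x)) = E2 x" for x
    proof -
      have "\<i> * (\<i> * z) = - z" for z by (simp flip: mult.assoc)
      then show ?thesis
        unfolding E2_def E1_def E_def resid_def e_def by (simp add: algebra_simps power2_eq_square)
    qed
  qed
  have P: "primitive_on 1 (\<lambda>x. E1 x * phi k x - E x * dphi k x)
    (\<lambda>x. (E2 x * phi k x + E1 x * dphi k x) - (E1 x * dphi k x + E x * (- of_real (eig k) * phi k x)))"
    by (rule primitive_on_diff[OF primitive_on_mult[OF E1 primitive_on_phi] primitive_on_mult[OF E primitive_on_dphi]])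
  have P': "primitive_on 1 (\<lambda>x. E1 x * phi k x - E x * dphi k x)
    (\<lambda>x. of_real (eig k - eig j) * (E x * phi k x) - resid j s x * phi k x)"
    by (rule primitive_on_cong[OF P]) (simp_all add: E2_def algebra_simps)
  have "0 = (\<integral>x. of_real (eig k - eig j) * (E x * phi k x) - resid j s x * phi k x \<partial>leb 1)"
    using primitive_on_eq[OF P', of 1] by (simp add: E_def)
  also have "\<dots> = (\<integral>x. of_real (eig k - eig j) * (E x * phi k x) - resid j s x * phi k x \<partial>M01)"
    by (rule integral_Icc_eq_Ioo[OF primitive_on_integrable[OF P']])
  also have "\<dots> = of_real (eig k - eig j) * (\<integral>x. E x * phi k x \<partial>M01) - (\<integral>x. resid j s x * phi k x \<partial>M01)"
  proof -
    have "integrable M01 (\<lambda>x. E x * phi k x)"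
      using L2_integrable_mult[OF gauged_L2[of j s] phi_L2[of k]] unfolding E_def e_def gauged_def .
    moreover have "integrable M01 (\<lambda>x. resid j s x * phi k x)"
      by (rule L2_integrable_mult[OF resid_L2 phi_L2])
    ultimately show ?thesis
      by (simp only: Bochner_Integration.integral_diff integrable_mult_right integral_mult_right_zero)
  qed
  finally show ?thesis unfolding L2_inner_def gauged_def E_def e_def by simp
qed

text \<open>The gauge phases cancel. The terms linear in \<open>s\<close> form the total derivative
  of \<open>N\<close> times the square of \<open>phi j\<close>, which integrates to zero by the
  boundary values; the quadratic term is what finally produces the \<open>m_j\<close> in
  \<open>B\<close>.\<close>

lemma L2_inner_gauged_resid:
  "L2_inner (gauged j s) (resid j s) = of_real (s\<^sup>2 * diag (\<lambda>x. (N x)\<^sup>2) j)"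
proof -
  have P: "primitive_on 1 (\<lambda>x. of_real (N x) * (phi j x * phi j x))
    (\<lambda>x. of_real (g x) * (phi j x * phi j x) + of_real (N x) * (dphi j x * phi j x + phi j x * dphi j x))"
    by (rule primitive_on_mult[OF N primitive_on_mult[OF primitive_on_phi primitive_on_phi]])
  let ?p = "\<lambda>x. of_real (g x) * (phi j x * phi j x) + of_real (N x) * (dphi j x * phi j x + phi j x * dphi j x)"
  have "(\<integral>x. ?p x \<partial>M01) = (\<integral>x. ?p x \<partial>leb 1)"
    by (rule integral_Icc_eq_Ioo[OF primitive_on_integrable[OF P], symmetric])
  also have "\<dots> = 0"
    using primitive_on_eq[OF P, of 1] by simp
  finally have p0: "(\<integral>x. ?p x \<partial>M01) = 0" .
  have pi: "integrable M01 ?p"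
    using primitive_on_integrable[OF P] by (simp add: integrable_Icc_iff_Ioo)
  let ?q = "\<lambda>x. of_real ((N x)\<^sup>2) * phi j x * cnj (phi j x)"
  have qi: "integrable M01 ?q"
    by (rule L2_inner_integrable[OF resid_parts_L2(1) phi_L2])
  have cd: "cnj (dphi j x) = dphi j x" for x by (simp add: dphi_def)
  have ex: "exp (\<i> * of_real r) * cnj (exp (\<i> * of_real r)) = 1" for r :: real
    by (simp only: complex_norm_square[symmetric] norm_exp_i_times) simp
  have "gauged j s x * cnj (resid j s x) = of_real (s\<^sup>2) * ?q x + \<i> * of_real s * ?p x" for x
  proof -
    have "gauged j s x * cnj (resid j s x) = (exp (\<i> * of_real (s * M x)) * cnj (exp (\<i> * of_real (s * M x)))) *
      (phi j x * (of_real (s\<^sup>2) * (of_real ((N x)\<^sup>2) * phi j x)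
        + \<i> * of_real s * (2 * of_real (N x) * dphi j x + of_real (g x) * phi j x)))"
      unfolding gauged_def resid_def by (simp add: cd)
    then show ?thesis unfolding ex by (simp add: algebra_simps)
  qed
  then have "L2_inner (gauged j s) (resid j s) = (\<integral>x. of_real (s\<^sup>2) * ?q x + \<i> * of_real s * ?p x \<partial>M01)"
    unfolding L2_inner_def by (simp only:)
  also have "\<dots> = of_real (s\<^sup>2) * (\<integral>x. ?q x \<partial>M01)"
    using pi qi p0 by (simp only: Bochner_Integration.integral_add integrable_mult_right integral_mult_right_zero) simp
  also have "(\<integral>x. ?q x \<partial>M01) = of_real (diag (\<lambda>x. (N x)\<^sup>2) j)"
  proof -
    have "?q x = of_real ((N x)\<^sup>2 * (sqrt 2 * sin (real j * pi * x))\<^sup>2)" for x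
      by (simp add: phi_def power2_eq_square)
    then show ?thesis unfolding diag_def L2_inner_def by (simp only: integral_complex_of_real Re_complex_of_real)
  qed
  finally show ?thesis by simp
qed

lemma M_gauged_L2: "(\<lambda>x. \<i> * of_real (M x) * gauged j s x) \<in> L2 I01"
  by (intro continuous_on_L2 continuous_intros M_continuous gauged_continuous)

text \<open>Second-order expansion in the gauge parameter, used for the chain rule in time and, at
  \<open>q = 0\<close>, for the phase at the final time. The constant 4 collects a 2 from the bound
  on \<open>phi j\<close> and a 2 from pairing with \<open>phi k\<close>.\<close>

lemma gauged_coefficient_Taylor:
  "cmod (L2_inner (gauged j p) (phi k) - L2_inner (gauged j q) (phi k)
    - of_real (p - q) * L2_inner (\<lambda>x. \<i> * of_real (M x) * gauged j q x) (phi k)) \<le> 4 * M_bound\<^sup>2 * (p - q)\<^sup>2"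
proof -
  have split: "exp (\<i> * of_real (p * m)) = exp (\<i> * of_real (q * m)) * exp (\<i> * of_real ((p - q) * m))" for p q m :: real
  proof -
    have "\<i> * complex_of_real (p * m) = \<i> * of_real (q * m) + \<i> * of_real ((p - q) * m)"
      by (simp add: algebra_simps)
    then show ?thesis by (simp only: exp_add)
  qed
  have n1: "cmod (exp (\<i> * complex_of_real r)) = 1" for r by simp
  have M2: "(r * M x)\<^sup>2 \<le> M_bound\<^sup>2 * r\<^sup>2" if "x \<in> {0..1}" for r x
  proof -
    have "(M x)\<^sup>2 \<le> M_bound\<^sup>2" using M_le[OF that] M_bound_nonneg by (simp add: abs_le_square_iff[symmetric])
    then show ?thesis by (simp add: power_mult_distrib mult.commute mult_left_mono)
  qed
  show "cmod (L2_inner (gauged j p) (phi k) - L2_inner (gauged j q) (phi k)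
      - of_real (p - q) * L2_inner (\<lambda>x. \<i> * of_real (M x) * gauged j q x) (phi k)) \<le> 4 * M_bound\<^sup>2 * (p - q)\<^sup>2"
  proof -
    let ?f = "\<lambda>x. gauged j p x - gauged j q x - of_real (p - q) * (\<i> * of_real (M x) * gauged j q x)"
    have L: "?f \<in> L2 I01" by (intro L2_diff L2_scale gauged_L2 M_gauged_L2)
    have "L2_inner ?f (phi k) = L2_inner (gauged j p) (phi k) - L2_inner (gauged j q) (phi k)
      - of_real (p - q) * L2_inner (\<lambda>x. \<i> * of_real (M x) * gauged j q x) (phi k)"
      by (simp only: L2_inner_diff_left L2_diff L2_scale gauged_L2 M_gauged_L2 phi_L2 L2_inner_scale_left)
    moreover have "cmod (?f x) \<le> 2 * M_bound\<^sup>2 * (p - q)\<^sup>2" if x: "x \<in> I01" for x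
    proof -
      \<comment> \<open>Factoring out the phase at \<open>q\<close> leaves the scalar Taylor
        remainder of the exponential.\<close>
      have "?f x = exp (\<i> * of_real (q * M x)) * (exp (\<i> * of_real ((p - q) * M x)) - 1 - \<i> * of_real ((p - q) * M x)) * phi j x"
        unfolding gauged_def split[of p _ q] by (simp add: algebra_simps)
      then have "cmod (?f x) = cmod (exp (\<i> * of_real ((p - q) * M x)) - 1 - \<i> * of_real ((p - q) * M x)) * cmod (phi j x)"
        by (simp only: norm_mult n1 mult_1_left)
      also have "\<dots> \<le> ((p - q) * M x)\<^sup>2 * 2"
        using norm_phi_le[of j x] sqrt2_less_2 by (intro mult_mono exp_i_Taylor2) auto
      also have "\<dots> \<le> 2 * M_bound\<^sup>2 * (p - q)\<^sup>2" using M2[of x "p - q"] x by simp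
      finally show ?thesis .
    qed
    ultimately show ?thesis using norm_L2_inner_phi_le[OF L, of "2 * M_bound\<^sup>2 * (p - q)\<^sup>2" k] by simp
  qed
qed

text \<open>Moving along \<open>s\<close> brings down the control times the potential, which is the
  term that reproduces the bilinear control in the equation.\<close>

lemma gauged_coefficient_chain:
  assumes u: "integrable (leb T) u"
    and s: "\<And>t. t \<in> {0..T} \<Longrightarrow> s t = (\<integral>x. u x \<partial>leb t)"
  shows "primitive_on T (\<lambda>t. L2_inner (gauged j (s t)) (phi k))
    (\<lambda>t. of_real (u t) * L2_inner (\<lambda>x. \<i> * of_real (M x) * gauged j (s t) x) (phi k))"
proof (rule primitive_on_chain[OF u s _ gauged_coefficient_Taylor])
  have split: "exp (\<i> * of_real (p * m)) = exp (\<i> * of_real (q * m)) * exp (\<i> * of_real ((p - q) * m))" for p q m :: real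
  proof -
    have "\<i> * complex_of_real (p * m) = \<i> * of_real (q * m) + \<i> * of_real ((p - q) * m)"
      by (simp add: algebra_simps)
    then show ?thesis by (simp only: exp_add)
  qed
  have n1: "cmod (exp (\<i> * complex_of_real r)) = 1" for r by simp
  show "cmod (L2_inner (\<lambda>x. \<i> * of_real (M x) * gauged j p x) (phi k)
      - L2_inner (\<lambda>x. \<i> * of_real (M x) * gauged j q x) (phi k)) \<le> 4 * M_bound\<^sup>2 * \<bar>p - q\<bar>" for p q
  proof -
    let ?f = "\<lambda>x. \<i> * of_real (M x) * gauged j p x - \<i> * of_real (M x) * gauged j q x"
    have L: "?f \<in> L2 I01" by (intro L2_diff M_gauged_L2)
    have "L2_inner ?f (phi k) = L2_inner (\<lambda>x. \<i> * of_real (M x) * gauged j p x) (phi k)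
      - L2_inner (\<lambda>x. \<i> * of_real (M x) * gauged j q x) (phi k)"
      by (simp only: L2_inner_diff_left M_gauged_L2 phi_L2)
    moreover have "cmod (?f x) \<le> 2 * M_bound\<^sup>2 * \<bar>p - q\<bar>" if x: "x \<in> I01" for x
    proof -
      have "?f x = \<i> * of_real (M x) * exp (\<i> * of_real (q * M x)) * (exp (\<i> * of_real ((p - q) * M x)) - 1) * phi j x"
        unfolding gauged_def split[of p _ q] by (simp add: algebra_simps)
      then have "cmod (?f x) = \<bar>M x\<bar> * cmod (exp (\<i> * of_real ((p - q) * M x)) - 1) * cmod (phi j x)"
        by (simp only: norm_mult n1 mult_1_left mult_1_right norm_ii norm_of_real)
      also have "\<dots> \<le> (M_bound * (\<bar>p - q\<bar> * M_bound)) * 2"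
      proof (intro mult_mono)
        show "cmod (exp (\<i> * of_real ((p - q) * M x)) - 1) \<le> \<bar>p - q\<bar> * M_bound"
        proof (rule order_trans[OF exp_i_Taylor1])
          show "\<bar>(p - q) * M x\<bar> \<le> \<bar>p - q\<bar> * M_bound"
            unfolding abs_mult using M_le[of x] x by (intro mult_left_mono) auto
        qed
        show "cmod (phi j x) \<le> 2" using norm_phi_le[of j x] sqrt2_less_2 by simp
      qed (use M_le[of x] x M_bound_nonneg in auto)
      finally show ?thesis by (simp add: power2_eq_square mult_ac)
    qed
    ultimately show ?thesis using norm_L2_inner_phi_le[OF L, of "2 * M_bound\<^sup>2 * \<bar>p - q\<bar>" k] by simp
  qed
qed (simp_all)

section \<open>The gauged profile as an approximate solution\<close>

definition profile :: "nat \<Rightarrow> (real \<Rightarrow> real) \<Rightarrow> real \<Rightarrow> real \<Rightarrow> complex" where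
  "profile j s t x = exp (- \<i> * of_real (eig j * t)) * gauged j (s t) x"

definition profile_resid :: "nat \<Rightarrow> (real \<Rightarrow> real) \<Rightarrow> real \<Rightarrow> real \<Rightarrow> complex" where
  "profile_resid j s t x = exp (- \<i> * of_real (eig j * t)) * resid j (s t) x"

lemma profile_L2: "profile j s t \<in> L2 I01"
  unfolding profile_def by (rule L2_scale[OF gauged_L2])

lemma profile_resid_L2: "profile_resid j s t \<in> L2 I01"
  unfolding profile_resid_def by (rule L2_scale[OF resid_L2])

lemma M_mult_L2:
  fixes f :: "real \<Rightarrow> complex"
  assumes "f \<in> L2 I01"
  shows "(\<lambda>x. of_real (M x) * f x) \<in> L2 I01"
proof (rule L2_mult_bounded[OF assms])
  show "(\<lambda>x. complex_of_real (M x)) \<in> borel_measurable M01"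
    by (intro continuous_on_measurable_M01 continuous_intros M_continuous)
  show "AE x in M01. cmod (of_real (M x)) \<le> M_bound" using M_le by (intro AE_I2) auto
qed

lemma L2_norm_M_mult_le:
  fixes f :: "real \<Rightarrow> complex"
  assumes "f \<in> L2 I01"
  shows "L2_norm I01 (\<lambda>x. of_real (M x) * f x) \<le> M_bound * L2_norm I01 f"
proof (rule L2_norm_mult_bounded[OF assms])
  show "(\<lambda>x. complex_of_real (M x)) \<in> borel_measurable M01"
    by (intro continuous_on_measurable_M01 continuous_intros M_continuous)
  show "AE x in M01. cmod (of_real (M x)) \<le> M_bound" using M_le by (intro AE_I2) auto
qed (rule M_bound_nonneg)

text \<open>The controlled equation with the additional forcing \<open>\<i> * profile_resid\<close>.
  The rotating factors leave the frequency \<open>eig k - eig j\<close>, and this multiple of the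
  coefficient of \<open>gauged\<close> is the coefficient of \<open>resid\<close>.\<close>

lemma profile_primitive_on:
  assumes u: "integrable (leb T) u"
    and s: "\<And>t. t \<in> {0..T} \<Longrightarrow> s t = (\<integral>x. u x \<partial>leb t)"
  shows "primitive_on T (\<lambda>t. exp (\<i> * of_real (eig k * t)) * L2_inner (profile j s t) (phi k))
    (\<lambda>t. exp (\<i> * of_real (eig k * t)) *
      L2_inner (\<lambda>x. \<i> * of_real (u t) * (of_real (M x) * profile j s t x) + \<i> * profile_resid j s t x) (phi k))"
proof -
  define w where "w = eig k - eig j"
  have rot: "exp (\<i> * of_real (eig k * t)) * (exp (- \<i> * of_real (eig j * t)) * z) = exp (\<i> * of_real (w * t)) * z" for t z
  proof -
    have "\<i> * complex_of_real (w * t) = \<i> * of_real (eig k * t) + - \<i> * of_real (eig j * t)"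
      by (simp add: w_def algebra_simps)
    then show ?thesis by (simp only: exp_add mult.assoc)
  qed
  have e: "primitive_on T (\<lambda>t. exp (\<i> * of_real (w * t))) (\<lambda>t. \<i> * of_real w * exp (\<i> * of_real (w * t)))"
  proof (rule primitive_on_vector_derivative)
    fix t :: real
    have "((\<lambda>t. w * t) has_vector_derivative w) (at t within {0..T})"
      by (auto intro!: derivative_eq_intros simp flip: has_real_derivative_iff_has_vector_derivative)
    then show "((\<lambda>t. exp (\<i> * of_real (w * t))) has_vector_derivative \<i> * of_real w * exp (\<i> * of_real (w * t))) (at t within {0..T})"
      by (rule has_vector_derivative_exp_i)
  qed (intro continuous_intros)
  show ?thesis
  proof (rule primitive_on_cong[OF primitive_on_mult[OF e gauged_coefficient_chain[OF u s, of j k]]])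
    fix t
    show "exp (\<i> * of_real (w * t)) * L2_inner (gauged j (s t)) (phi k)
      = exp (\<i> * of_real (eig k * t)) * L2_inner (profile j s t) (phi k)"
      unfolding profile_def L2_inner_scale_left rot ..
    have "L2_inner (\<lambda>x. \<i> * of_real (u t) * (of_real (M x) * profile j s t x) + \<i> * profile_resid j s t x) (phi k)
      = \<i> * of_real (u t) * L2_inner (\<lambda>x. of_real (M x) * profile j s t x) (phi k) + \<i> * L2_inner (profile_resid j s t) (phi k)"
      by (simp only: L2_inner_add_left L2_scale M_mult_L2 profile_L2 profile_resid_L2 phi_L2 L2_inner_scale_left)
    also have "L2_inner (\<lambda>x. of_real (M x) * profile j s t x) (phi k)
      = exp (- \<i> * of_real (eig j * t)) * L2_inner (\<lambda>x. of_real (M x) * gauged j (s t) x) (phi k)"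
      unfolding profile_def mult.left_commute[of "of_real (M _)"] by (rule L2_inner_scale_left)
    also have "L2_inner (profile_resid j s t) (phi k) = exp (- \<i> * of_real (eig j * t)) * (of_real w * L2_inner (gauged j (s t)) (phi k))"
      unfolding profile_resid_def L2_inner_scale_left resid_coefficient w_def ..
    finally have "exp (\<i> * of_real (eig k * t)) * L2_inner (\<lambda>x. \<i> * of_real (u t) * (of_real (M x) * profile j s t x) + \<i> * profile_resid j s t x) (phi k)
      = \<i> * of_real (u t) * (exp (\<i> * of_real (eig k * t)) * (exp (- \<i> * of_real (eig j * t)) * L2_inner (\<lambda>x. of_real (M x) * gauged j (s t) x) (phi k)))
      + \<i> * (exp (\<i> * of_real (eig k * t)) * (exp (- \<i> * of_real (eig j * t)) * (of_real w * L2_inner (gauged j (s t)) (phi k))))"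
      by (simp only: distrib_left mult_ac)
    also have "\<dots> = \<i> * of_real (u t) * (exp (\<i> * of_real (w * t)) * L2_inner (\<lambda>x. of_real (M x) * gauged j (s t) x) (phi k))
      + \<i> * (exp (\<i> * of_real (w * t)) * (of_real w * L2_inner (gauged j (s t)) (phi k)))"
      unfolding rot ..
    also have "L2_inner (\<lambda>x. \<i> * of_real (M x) * gauged j (s t) x) (phi k) = \<i> * L2_inner (\<lambda>x. of_real (M x) * gauged j (s t) x) (phi k)"
      unfolding mult.assoc by (rule L2_inner_scale_left)
    then have "\<i> * of_real (u t) * (exp (\<i> * of_real (w * t)) * L2_inner (\<lambda>x. of_real (M x) * gauged j (s t) x) (phi k))
      = exp (\<i> * of_real (w * t)) * (of_real (u t) * L2_inner (\<lambda>x. \<i> * of_real (M x) * gauged j (s t) x) (phi k))"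
      by (simp only: mult_ac)
    finally show "\<i> * of_real w * exp (\<i> * of_real (w * t)) * L2_inner (gauged j (s t)) (phi k)
      + exp (\<i> * of_real (w * t)) * (of_real (u t) * L2_inner (\<lambda>x. \<i> * of_real (M x) * gauged j (s t) x) (phi k))
      = exp (\<i> * of_real (eig k * t)) * L2_inner (\<lambda>x. \<i> * of_real (u t) * (of_real (M x) * profile j s t x) + \<i> * profile_resid j s t x) (phi k)"
      by (simp only: mult_ac add.commute)
  qed
qed

end

subsection \<open>Mild solutions in the eigenbasis\<close>

lemma eig_powr: "k \<ge> 1 \<Longrightarrow> eig k powr (3 / 2) = pi ^ 3 * real k ^ 3"
proof -
  assume k: "k \<ge> 1"
  have pos: "0 < real k * pi" using k by simp
  have "eig k powr (3 / 2) = ((real k * pi) powr 2) powr (3 / 2)"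
    unfolding eig_def using powr_realpow[OF pos, of 2] by simp
  also have "\<dots> = (real k * pi) powr 3" by (simp only: powr_powr) simp
  also have "\<dots> = (real k * pi) ^ 3" using powr_realpow[OF pos, of 3] by simp
  finally show ?thesis by (simp add: power_mult_distrib mult.commute)
qed

text \<open>The operator weights are \<open>pi^3 * k^3\<close>, so up to a constant they agree with
  the weights in \<open>H3_0_norm\<close>.\<close>

lemma H3_0_iff:
  "f \<in> H3_0 \<longleftrightarrow> f \<in> L2 I01 \<and> (\<lambda>k. (cmod (of_nat k ^ 3 * L2_inner f (phi k)))\<^sup>2) summable_on {1..}"
proof -
  have "(\<lambda>k. (cmod (complex_of_real (eig k powr (3 / 2)) * L2_inner f (phi k)))\<^sup>2) summable_on {1..}
    \<longleftrightarrow> (\<lambda>k. (pi ^ 3)\<^sup>2 * (cmod (of_nat k ^ 3 * L2_inner f (phi k)))\<^sup>2) summable_on {1..}"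
    by (rule summable_on_cong) (simp add: eig_powr norm_mult norm_power power_mult_distrib)
  also have "\<dots> \<longleftrightarrow> (\<lambda>k. (cmod (of_nat k ^ 3 * L2_inner f (phi k)))\<^sup>2) summable_on {1..}"
    by (rule summable_on_cmult_right') simp
  finally show ?thesis unfolding H3_0_def A_power_domain_def by simp
qed

lemma H3_0_imp_L2: "f \<in> H3_0 \<Longrightarrow> f \<in> L2 I01"
  by (simp add: H3_0_iff)

lemma H3_0_diff:
  assumes f: "f \<in> H3_0" and g: "g \<in> H3_0"
  shows "(\<lambda>x. f x - g x) \<in> H3_0"
proof -
  note L = H3_0_imp_L2[OF f] H3_0_imp_L2[OF g]
  have "(\<lambda>k. 2 * (cmod (of_nat k ^ 3 * L2_inner f (phi k)))\<^sup>2 + 2 * (cmod (of_nat k ^ 3 * L2_inner g (phi k)))\<^sup>2) summable_on {1..}"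
    using f g by (intro summable_on_add summable_on_cmult_right) (auto simp: H3_0_iff)
  then have "(\<lambda>k. (cmod (of_nat k ^ 3 * L2_inner (\<lambda>x. f x - g x) (phi k)))\<^sup>2) summable_on {1..}"
  proof (rule summable_on_comparison_test)
    fix k :: nat
    let ?a = "of_nat k ^ 3 * L2_inner f (phi k)" and ?b = "of_nat k ^ 3 * L2_inner g (phi k)"
    have "cmod (of_nat k ^ 3 * L2_inner (\<lambda>x. f x - g x) (phi k)) \<le> cmod ?a + cmod ?b"
      unfolding L2_inner_diff_left[OF L phi_L2] right_diff_distrib by (rule norm_triangle_ineq4)
    then have "(cmod (of_nat k ^ 3 * L2_inner (\<lambda>x. f x - g x) (phi k)))\<^sup>2 \<le> (cmod ?a + cmod ?b)\<^sup>2"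
      by (intro power_mono) auto
    also have "\<dots> \<le> 2 * (cmod ?a)\<^sup>2 + 2 * (cmod ?b)\<^sup>2"
      using sum_squares_bound[of "cmod ?a" "cmod ?b"] by (simp add: power2_sum)
    finally show "(cmod (of_nat k ^ 3 * L2_inner (\<lambda>x. f x - g x) (phi k)))\<^sup>2 \<le> 2 * (cmod ?a)\<^sup>2 + 2 * (cmod ?b)\<^sup>2" .
  qed simp
  then show ?thesis using L2_diff[OF L] by (simp add: H3_0_iff)
qed

text \<open>Parseval, since every weight \<open>k^3\<close> is at least 1.\<close>

lemma L2_norm_le_H3_0_norm:
  assumes f: "f \<in> H3_0"
  shows "L2_norm I01 f \<le> H3_0_norm f"
proof -
  note L = H3_0_imp_L2[OF f]
  have "(\<lambda>n. Re (\<Sum>k=1..n. L2_inner f (phi k) * cnj (L2_inner f (phi k)))) \<longlonglongrightarrow> Re (L2_inner f f)"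
    by (intro tendsto_Re parseval L)
  then have lim: "(\<lambda>n. \<Sum>k=1..n. (cmod (L2_inner f (phi k)))\<^sup>2) \<longlonglongrightarrow> (L2_norm I01 f)\<^sup>2"
    by (simp add: L2_inner_self complex_norm_square[symmetric])
  have "(L2_norm I01 f)\<^sup>2 \<le> (\<Sum>\<^sub>\<infinity>k\<in>{1..}. (cmod (of_nat k ^ 3 * L2_inner f (phi k)))\<^sup>2)"
  proof (rule LIMSEQ_le_const2[OF lim], intro exI allI impI)
    fix n :: nat
    have "(\<Sum>k=1..n. (cmod (L2_inner f (phi k)))\<^sup>2) \<le> (\<Sum>k=1..n. (cmod (of_nat k ^ 3 * L2_inner f (phi k)))\<^sup>2)"
    proof (intro sum_mono power_mono)
      fix k assume "k \<in> {1..n}"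
      then have "1 \<le> real k ^ 3" by (intro one_le_power) simp
      then show "cmod (L2_inner f (phi k)) \<le> cmod (of_nat k ^ 3 * L2_inner f (phi k))"
        using mult_right_mono[of 1 "real k ^ 3" "cmod (L2_inner f (phi k))"] by (simp add: norm_mult norm_power)
    qed simp
    also have "\<dots> \<le> (\<Sum>\<^sub>\<infinity>k\<in>{1..}. (cmod (of_nat k ^ 3 * L2_inner f (phi k)))\<^sup>2)"
      using f by (intro finite_sum_le_infsum) (auto simp: H3_0_iff)
    finally show "(\<Sum>k=1..n. (cmod (L2_inner f (phi k)))\<^sup>2) \<le> (\<Sum>\<^sub>\<infinity>k\<in>{1..}. (cmod (of_nat k ^ 3 * L2_inner f (phi k)))\<^sup>2)" .
  qed
  then show ?thesis unfolding H3_0_norm_def by (rule real_le_rsqrt)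
qed

text \<open>Supplies the a priori bound that makes the majorants of the pairing argument and the
  supremum of the deviation finite; the \<open>L^2\<close> norm is continuous in time because the
  stronger norm dominates it.\<close>

lemma continuous_H3_0_bounded:
  assumes "continuous_H3_0 T \<psi>"
  shows "\<exists>K. \<forall>t\<in>{0..T}. L2_norm I01 (\<psi> t) \<le> K"
proof -
  have H: "\<psi> t \<in> H3_0" if "t \<in> {0..T}" for t using assms that by (simp add: continuous_H3_0_def)
  have "continuous_on {0..T} (\<lambda>t. L2_norm I01 (\<psi> t))"
    unfolding continuous_on_def
  proof
    fix t assume t: "t \<in> {0..T}"
    have lim: "((\<lambda>r. H3_0_norm (\<lambda>x. \<psi> r x - \<psi> t x)) \<longlongrightarrow> 0) (at t within {0..T})"
      using assms t by (simp add: continuous_H3_0_def)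
    have "((\<lambda>r. L2_norm I01 (\<psi> r) - L2_norm I01 (\<psi> t)) \<longlongrightarrow> 0) (at t within {0..T})"
    proof (rule Lim_null_comparison[OF _ lim])
      have "norm (L2_norm I01 (\<psi> r) - L2_norm I01 (\<psi> t)) \<le> H3_0_norm (\<lambda>x. \<psi> r x - \<psi> t x)" if r: "r \<in> {0..T}" for r
      proof -
        note L = H3_0_imp_L2[OF H[OF r]] H3_0_imp_L2[OF H[OF t]]
        have "L2_norm I01 (\<lambda>x. (\<psi> r x - \<psi> t x) + \<psi> t x) \<le> L2_norm I01 (\<lambda>x. \<psi> r x - \<psi> t x) + L2_norm I01 (\<psi> t)"
          by (rule L2_norm_triangle[OF L2_diff[OF L] L(2)])
        moreover have "L2_norm I01 (\<lambda>x. (\<psi> t x - \<psi> r x) + \<psi> r x) \<le> L2_norm I01 (\<lambda>x. \<psi> t x - \<psi> r x) + L2_norm I01 (\<psi> r)"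
          by (rule L2_norm_triangle[OF L2_diff[OF L(2,1)] L(1)])
        ultimately have "norm (L2_norm I01 (\<psi> r) - L2_norm I01 (\<psi> t)) \<le> L2_norm I01 (\<lambda>x. \<psi> r x - \<psi> t x)"
          using L2_norm_minus_commute[of I01 "\<psi> r" "\<psi> t"] by simp
        then show ?thesis using L2_norm_le_H3_0_norm[OF H3_0_diff[OF H[OF r] H[OF t]]] by linarith
      qed
      then show "\<forall>\<^sub>F r in at t within {0..T}. norm (L2_norm I01 (\<psi> r) - L2_norm I01 (\<psi> t)) \<le> H3_0_norm (\<lambda>x. \<psi> r x - \<psi> t x)"
        by (auto simp: eventually_at_filter)
    qed
    then show "((\<lambda>r. L2_norm I01 (\<psi> r)) \<longlongrightarrow> L2_norm I01 (\<psi> t)) (at t within {0..T})"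
      by (rule LIM_zero_cancel)
  qed
  then have "bounded ((\<lambda>t. L2_norm I01 (\<psi> t)) ` {0..T})"
    by (intro compact_imp_bounded compact_continuous_image) auto
  then obtain K where "\<And>t. t \<in> {0..T} \<Longrightarrow> norm (L2_norm I01 (\<psi> t)) \<le> K" unfolding bounded_iff by blast
  then show ?thesis by (intro exI[of _ K]) auto
qed

context potential
begin

text \<open>The Duhamel integral is defined by duality, so it can be tested with
  \<open>phi k\<close>. The propagator becomes a phase, and after rotation by
  \<open>exp (\<i> * eig k * t)\<close> the outer time disappears from the integrand, which leaves
  an indefinite integral.\<close>

lemma mild_solution_coefficient:
  assumes sol: "mild_solution \<mu> u T (phi j) \<psi>" and T: "0 \<le> T" and k: "k \<ge> 1"
    and \<mu>: "\<mu> \<in> borel_measurable M01" "AE x in M01. \<mu> x = M x"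
  shows "primitive_on T (\<lambda>t. exp (\<i> * of_real (eig k * t)) * L2_inner (\<psi> t) (phi k))
      (\<lambda>t. exp (\<i> * of_real (eig k * t)) * L2_inner (\<lambda>x. \<i> * of_real (u t) * (of_real (M x) * \<psi> t x)) (phi k))"
    and "L2_inner (\<psi> 0) (phi k) = L2_inner (phi j) (phi k)"
proof -
  have \<psi>: "\<psi> t \<in> L2 I01" if "t \<in> {0..T}" for t
    using sol that by (auto simp: mild_solution_def continuous_H3_0_def intro: H3_0_imp_L2)
  define F where "F = (\<lambda>\<tau> x. complex_of_real (u \<tau> * \<mu> x) * \<psi> \<tau> x)"
  define f where "f = (\<lambda>\<tau>. exp (\<i> * of_real (eig k * \<tau>)) * L2_inner (\<lambda>x. \<i> * of_real (u \<tau>) * (of_real (M x) * \<psi> \<tau> x)) (phi k))"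
  have FL2: "F \<tau> \<in> L2 I01" and Fc: "f \<tau> = exp (\<i> * of_real (eig k * \<tau>)) * (\<i> * L2_inner (F \<tau>) (phi k))"
    if \<tau>: "\<tau> \<in> {0..T}" for \<tau>
  proof -
    let ?F = "\<lambda>x. of_real (u \<tau>) * (of_real (M x) * \<psi> \<tau> x)"
    have L: "?F \<in> L2 I01" by (intro L2_scale M_mult_L2 \<psi> \<tau>)
    \<comment> \<open>At this point the given potential is exchanged for its regular
      representative.\<close>
    have ae: "AE x in M01. ?F x = F \<tau> x" using \<mu>(2) by eventually_elim (simp add: F_def)
    have m: "F \<tau> \<in> borel_measurable M01"
      unfolding F_def using \<mu>(1) L2_measurable[OF \<psi>[OF \<tau>]] by measurable
    show "F \<tau> \<in> L2 I01" by (rule L2_cong_AE[OF L m ae])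
    have "L2_inner ?F (phi k) = L2_inner (F \<tau>) (phi k)"
      by (rule L2_inner_cong_AE[OF ae _ L2_measurable[OF L] _ m]) auto
    then show "f \<tau> = exp (\<i> * of_real (eig k * \<tau>)) * (\<i> * L2_inner (F \<tau>) (phi k))"
      unfolding f_def mult.assoc[of \<i>] L2_inner_scale_left[of \<i>] by simp
  qed
  have main: "integrable (leb t) f \<and>
      exp (\<i> * of_real (eig k * t)) * L2_inner (\<psi> t) (phi k) = L2_inner (phi j) (phi k) + (\<integral>x. f x \<partial>leb t)"
    if t: "t \<in> {0..T}" for t
  proof -
    obtain J where J: "has_L2_integral (\<lambda>\<tau>. free_prop (t - \<tau>) (F \<tau>)) J {0..t}"
      and eq: "L2_eq (\<psi> t) (\<lambda>x. free_prop t (phi j) x + \<i> * J x)"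
      using sol t unfolding mild_solution_def F_def by blast
    have JL2: "J \<in> L2 I01" using J by (simp add: has_L2_integral_def)
    have fL2: "free_prop t (phi j) \<in> L2 I01" by (rule free_prop_L2[OF phi_L2])
    let ?e = "exp (\<i> * of_real (eig k * t))" and ?m = "exp (- \<i> * of_real (eig k * t))"
    have em1: "?e * ?m = 1" by (simp flip: exp_add)
    then have em: "?e * (?m * z) = z" for z by (simp only: mult.assoc[symmetric]) simp
    have hb: "has_bochner_integral (leb t) (\<lambda>\<tau>. L2_inner (free_prop (t - \<tau>) (F \<tau>)) (phi k)) (L2_inner J (phi k))"
      using J phi_L2 by (simp add: has_L2_integral_def)
    have "L2_inner (free_prop (t - \<tau>) (F \<tau>)) (phi k) = ?m * (- \<i> * f \<tau>)" if \<tau>: "\<tau> \<in> {0..t}" for \<tau>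
    proof -
      have \<tau>': "\<tau> \<in> {0..T}" using \<tau> t by auto
      have "exp (- \<i> * of_real (eig k * (t - \<tau>))) = ?m * exp (\<i> * of_real (eig k * \<tau>))"
        by (simp add: algebra_simps flip: exp_add)
      moreover have "- \<i> * f \<tau> = exp (\<i> * of_real (eig k * \<tau>)) * L2_inner (F \<tau>) (phi k)"
        unfolding Fc[OF \<tau>'] by (simp add: mult.left_commute)
      ultimately show ?thesis
        unfolding free_prop_coefficient[OF FL2[OF \<tau>'] k] by simp
    qed
    then have "has_bochner_integral (leb t) (\<lambda>\<tau>. ?m * (- \<i> * f \<tau>)) (L2_inner J (phi k))"
      using hb by (subst (asm) has_bochner_integral_cong[OF refl _ refl]) auto
    \<comment> \<open>The factor \<open>\<i> * ?e\<close> undoes both the outer phase and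
      \<open>- \<i>\<close>, so that the integrand no longer depends on \<open>t\<close>.\<close>
    then have "has_bochner_integral (leb t) (\<lambda>\<tau>. (\<i> * ?e) * (?m * (- \<i> * f \<tau>))) ((\<i> * ?e) * L2_inner J (phi k))"
      by (intro has_bochner_integral_mult_right) auto
    moreover have "(\<i> * ?e) * (?m * (- \<i> * z)) = z" for z
    proof -
      have "(\<i> * ?e) * (?m * (- \<i> * z)) = (\<i> * - \<i>) * ((?e * ?m) * z)" by (simp only: mult_ac)
      then show ?thesis unfolding em1 by simp
    qed
    ultimately have hf: "has_bochner_integral (leb t) f (\<i> * ?e * L2_inner J (phi k))" by simp
    have "L2_inner (\<psi> t) (phi k) = L2_inner (\<lambda>x. free_prop t (phi j) x + \<i> * J x) (phi k)"
      by (rule L2_inner_cong_AE) (use eq L2_measurable[OF \<psi>[OF t]] L2_measurable[OF L2_add[OF fL2 L2_scale[OF JL2]]]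
          in \<open>auto simp: L2_eq_def\<close>)
    also have "\<dots> = ?m * L2_inner (phi j) (phi k) + \<i> * L2_inner J (phi k)"
      unfolding L2_inner_add_left[OF fL2 L2_scale[OF JL2] phi_L2] L2_inner_scale_left free_prop_coefficient[OF phi_L2 k] ..
    finally have "?e * L2_inner (\<psi> t) (phi k) = L2_inner (phi j) (phi k) + \<i> * ?e * L2_inner J (phi k)"
      by (simp only: distrib_left em) (simp only: mult_ac)
    then show ?thesis using hf by (simp add: has_bochner_integral_iff)
  qed
  show P: "primitive_on T (\<lambda>t. exp (\<i> * of_real (eig k * t)) * L2_inner (\<psi> t) (phi k))
      (\<lambda>t. exp (\<i> * of_real (eig k * t)) * L2_inner (\<lambda>x. \<i> * of_real (u t) * (of_real (M x) * \<psi> t x)) (phi k))"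
    unfolding f_def[symmetric]
    by (rule primitive_on_indefinite_integral[where c = "L2_inner (phi j) (phi k)"]) (use main T in auto)
  have "(\<integral>x. f x \<partial>lebesgue_on {0..0}) = 0"
    using integral_combine_Icc[OF conjunct1[OF main[of T]], of 0 0] T by simp
  then show "L2_inner (\<psi> 0) (phi k) = L2_inner (phi j) (phi k)" using main[of 0] T by simp
qed

end

subsection \<open>The phases at the final time\<close>

text \<open>Pure algebra on three approximate equations. \<open>S\<close> is the final value of
  \<open>s\<close>, \<open>\<theta>\<close> the common smallness, \<open>L\<close> the constant in
  \<open>\<bar>S\<bar> \<le> L * \<sigma>\<close>, and \<open>k * \<theta> * \<sigma>\<close> the
  error once the factors \<open>1 - \<i> * S * a\<close> have been inverted.\<close>

lemma phase_contradiction: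
  fixes a1 a2 a3 m1 m2 m3 A m E G L k d B S \<sigma> T \<theta> \<delta> \<beta> :: real and c \<rho> :: complex
  assumes A: "\<bar>a1\<bar> \<le> A" "\<bar>a2\<bar> \<le> A" "\<bar>a3\<bar> \<le> A" and m: "\<bar>m1\<bar> \<le> m" "\<bar>m2\<bar> \<le> m" "\<bar>m3\<bar> \<le> m"
    and EG: "0 \<le> E" "0 \<le> G" and d: "d = \<bar>a2 - a1\<bar>" "0 < d" and L: "L = 4 * (m + E) / d"
    and k: "k = 2 * (E + G * L) + m * A + A\<^sup>2 * L"
    and B: "B = (a3 - a2) * m1 + (a1 - a3) * m2 + (a2 - a1) * m3" "B \<noteq> 0"
    and \<theta>: "0 < \<theta>" "\<theta> \<le> 1" "4 * G * \<theta> \<le> d" "A * \<theta> \<le> 1" "6 * A * k * \<theta> \<le> \<bar>B\<bar>" "(k + m + A) * \<theta> \<le> 1 / 4"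
    and S: "\<bar>S\<bar> \<le> \<theta>" and \<sigma>: "0 \<le> \<sigma>" "\<sigma> \<le> \<theta>" and T: "0 \<le> T" "T \<le> \<theta>"
    and c: "cmod c = 1" and \<rho>: "\<rho> = of_real (sqrt (1 - \<delta>\<^sup>2)) + \<i> * of_real (\<beta> * \<delta>)" "0 < \<delta>" "\<delta> \<le> 1"
    and \<beta>: "\<beta> = sgn (B * (a2 - a1))"
    and e1: "cmod (c * (1 - \<i> * of_real (S * a1)) - (1 - \<i> * of_real (m1 * \<sigma>))) \<le> E * T * \<sigma> + G * S\<^sup>2"
    and e2: "cmod (c * (1 - \<i> * of_real (S * a2)) - (1 - \<i> * of_real (m2 * \<sigma>))) \<le> E * T * \<sigma> + G * S\<^sup>2"
    and e3: "cmod (c * \<rho> * (1 - \<i> * of_real (S * a3)) - (1 - \<i> * of_real (m3 * \<sigma>))) \<le> E * T * \<sigma> + G * S\<^sup>2"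
  shows False
proof -
  have A0: "0 \<le> A" and m0: "0 \<le> m" using A(1) m(1) by auto
  have L0: "0 \<le> L" unfolding L using m0 EG d by simp
  have k0: "0 \<le> k" unfolding k using m0 EG L0 A0 by simp
  define r where "r = E * T * \<sigma> + G * S\<^sup>2"
  \<comment> \<open>The first two targets carry the same phase, so subtraction leaves a term linear
    in \<open>S\<close> with the nonzero factor \<open>a2 - a1\<close>.\<close>
  have "c * \<i> * of_real (S * (a2 - a1)) = (c * (1 - \<i> * of_real (S * a1)) - (1 - \<i> * of_real (m1 * \<sigma>)))
    - (c * (1 - \<i> * of_real (S * a2)) - (1 - \<i> * of_real (m2 * \<sigma>))) - \<i> * of_real ((m1 - m2) * \<sigma>)"
    by (simp add: algebra_simps)
  also have "cmod \<dots> \<le> r + r + \<bar>m1 - m2\<bar> * \<sigma>"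
    by (rule order_trans[OF norm_triangle_ineq4 add_mono[OF order_trans[OF norm_triangle_ineq4 add_mono]]])
       (use e1 e2 \<sigma> in \<open>auto simp: r_def norm_mult abs_mult simp del: of_real_mult\<close>)
  finally have "\<bar>S\<bar> * d \<le> 2 * r + \<bar>m1 - m2\<bar> * \<sigma>"
    using c by (simp add: norm_mult abs_mult d del: of_real_mult of_real_diff)
  also have "\<dots> \<le> 2 * r + 2 * m * \<sigma>"
    using m \<sigma> by (intro add_left_mono mult_right_mono) auto
  \<comment> \<open>The quadratic part of \<open>r\<close> is absorbed: by the choice of
    \<open>\<theta>\<close> it is at most a quarter of \<open>d * \<bar>S\<bar>\<close>, and its two
    copies cost half of the left side. Hence the 4 in \<open>L\<close>.\<close>
  also have "r \<le> E * \<sigma> + (d / 4) * \<bar>S\<bar>"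
  proof -
    have "E * T * \<sigma> \<le> E * 1 * \<sigma>" using T \<theta> EG \<sigma> by (intro mult_right_mono mult_left_mono) auto
    moreover have "G * S\<^sup>2 \<le> (d / 4) * \<bar>S\<bar>"
    proof -
      have "G * S\<^sup>2 = (G * \<bar>S\<bar>) * \<bar>S\<bar>" by (simp add: power2_eq_square mult.assoc)
      also have "\<dots> \<le> (G * \<theta>) * \<bar>S\<bar>" using S EG by (intro mult_right_mono mult_left_mono) auto
      also have "\<dots> \<le> (d / 4) * \<bar>S\<bar>" using \<theta> by (intro mult_right_mono) auto
      finally show ?thesis .
    qed
    ultimately show ?thesis by (simp add: r_def)
  qed
  finally have "\<bar>S\<bar> * d \<le> 2 * (E * \<sigma> + (d / 4) * \<bar>S\<bar>) + 2 * m * \<sigma>" by simp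
  then have "\<bar>S\<bar> * d \<le> 4 * (m + E) * \<sigma>" by (simp add: algebra_simps)
  then have SL: "\<bar>S\<bar> \<le> L * \<sigma>" unfolding L using d by (simp add: field_simps)
  have S2: "S\<^sup>2 \<le> L * \<theta> * \<sigma>"
  proof -
    have "S\<^sup>2 = \<bar>S\<bar> * \<bar>S\<bar>" by (simp add: power2_eq_square)
    also have "\<dots> \<le> \<theta> * (L * \<sigma>)" using S SL \<theta> by (intro mult_mono) auto
    finally show ?thesis by (simp add: mult_ac)
  qed
  have r: "r \<le> (E + G * L) * \<theta> * \<sigma>"
  proof -
    have "E * T * \<sigma> \<le> E * \<theta> * \<sigma>" using T EG \<sigma> by (intro mult_right_mono mult_left_mono) auto
    moreover have "G * S\<^sup>2 \<le> G * (L * \<theta> * \<sigma>)" using S2 EG by (intro mult_left_mono) auto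
    ultimately show ?thesis by (simp add: r_def algebra_simps)
  qed
  have r0: "0 \<le> r" using EG T \<sigma> by (simp add: r_def)
  have est: "cmod (z - (1 - \<i> * of_real (n * \<sigma>) + \<i> * of_real (S * a))) \<le> k * \<theta> * \<sigma>"
    if z: "cmod z = 1" and a: "\<bar>a\<bar> \<le> A" and n: "\<bar>n\<bar> \<le> m"
      and le: "cmod (z * (1 - \<i> * of_real (S * a)) - (1 - \<i> * of_real (n * \<sigma>))) \<le> r" for z a n
  proof -
    define y where "y = z * (1 - \<i> * of_real (S * a)) - (1 - \<i> * of_real (n * \<sigma>))"
    have Sa: "\<bar>S * a\<bar> \<le> A * \<theta>" unfolding abs_mult using mult_mono[OF S a] \<theta> by (simp add: mult.commute)
    have ii: "\<i> * (\<i> * w) = - w" for w by (simp flip: mult.assoc)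
    \<comment> \<open>Multiplication by \<open>1 + \<i> * S * a\<close> inverts
      \<open>1 - \<i> * S * a\<close> up to \<open>(S * a)^2\<close>, so every correction is of
      order \<open>\<theta> * \<sigma>\<close>.\<close>
    have "z - (1 - \<i> * of_real (n * \<sigma>) + \<i> * of_real (S * a))
      = y * (1 + \<i> * of_real (S * a)) + of_real (n * \<sigma>) * of_real (S * a) - z * of_real ((S * a)\<^sup>2)"
      unfolding y_def by (simp add: algebra_simps power2_eq_square ii)
    also have "cmod \<dots> \<le> r * 2 + m * A * \<theta> * \<sigma> + A\<^sup>2 * (L * \<theta> * \<sigma>)"
    proof (rule order_trans[OF norm_triangle_ineq4 add_mono[OF order_trans[OF norm_triangle_ineq add_mono]]])
      have "cmod (1 + \<i> * of_real (S * a)) \<le> 1 + \<bar>S * a\<bar>"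
        by (rule order_trans[OF norm_triangle_ineq]) (simp add: norm_mult del: of_real_mult)
      then have "cmod (1 + \<i> * of_real (S * a)) \<le> 2" using Sa \<theta> by simp
      then show "cmod (y * (1 + \<i> * of_real (S * a))) \<le> r * 2"
        unfolding norm_mult using le r0 by (intro mult_mono) (auto simp: y_def)
      have "\<bar>n * \<sigma>\<bar> * \<bar>S * a\<bar> \<le> (m * \<sigma>) * (A * \<theta>)"
        using n \<sigma> Sa m0 by (intro mult_mono) (auto simp: abs_mult mult_right_mono)
      then show "cmod (of_real (n * \<sigma>) * of_real (S * a)) \<le> m * A * \<theta> * \<sigma>"
        unfolding norm_mult norm_of_real by (simp add: mult_ac)
      have "(S * a)\<^sup>2 \<le> (L * \<theta> * \<sigma>) * A\<^sup>2"
        unfolding power_mult_distrib using S2 a L0 \<theta> \<sigma> by (intro mult_mono) (auto simp: abs_le_square_iff[symmetric])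
      then show "cmod (z * of_real ((S * a)\<^sup>2)) \<le> A\<^sup>2 * (L * \<theta> * \<sigma>)"
        unfolding norm_mult norm_of_real z by (simp add: mult.commute)
    qed
    also have "\<dots> \<le> (E + G * L) * \<theta> * \<sigma> * 2 + m * A * \<theta> * \<sigma> + A\<^sup>2 * (L * \<theta> * \<sigma>)"
      using r by simp
    also have "\<dots> = k * \<theta> * \<sigma>" unfolding k by (simp add: algebra_simps)
    finally show ?thesis .
  qed
  have \<beta>2: "\<beta> * \<beta> = 1" using B(2) d by (simp add: \<beta> sgn_if)
  have \<delta>2: "\<delta>\<^sup>2 \<le> 1" using \<rho> by (simp add: power_le_one)
  have \<rho>1: "cmod \<rho> = 1"
  proof -
    have "(\<beta> * \<delta>)\<^sup>2 = \<delta>\<^sup>2" using \<beta>2 by (simp add: power_mult_distrib power2_eq_square)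
    then show ?thesis unfolding \<rho> cmod_def using \<delta>2 by simp
  qed
  have c\<rho>: "cmod (c * \<rho>) = 1" using c \<rho>1 by (simp add: norm_mult)
  have est1: "cmod (c - (1 - \<i> * of_real (m1 * \<sigma>) + \<i> * of_real (S * a1))) \<le> k * \<theta> * \<sigma>"
    by (rule est[OF c A(1) m(1)]) (use e1 in \<open>simp only: r_def\<close>)
  have est2: "cmod (c - (1 - \<i> * of_real (m2 * \<sigma>) + \<i> * of_real (S * a2))) \<le> k * \<theta> * \<sigma>"
    by (rule est[OF c A(2) m(2)]) (use e2 in \<open>simp only: r_def\<close>)
  have est3: "cmod (c * \<rho> - (1 - \<i> * of_real (m3 * \<sigma>) + \<i> * of_real (S * a3))) \<le> k * \<theta> * \<sigma>"
    by (rule est[OF c\<rho> A(3) m(3)]) (use e3 in \<open>simp only: r_def\<close>)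
  define x1 x2 x3 where "x1 = Im c + m1 * \<sigma> - S * a1" and "x2 = Im c + m2 * \<sigma> - S * a2"
    and "x3 = Im (c * \<rho>) + m3 * \<sigma> - S * a3"
  have x: "\<bar>x1\<bar> \<le> k * \<theta> * \<sigma>" "\<bar>x2\<bar> \<le> k * \<theta> * \<sigma>" "\<bar>x3\<bar> \<le> k * \<theta> * \<sigma>"
    using order_trans[OF abs_Im_le_cmod est1] order_trans[OF abs_Im_le_cmod est2] order_trans[OF abs_Im_le_cmod est3]
    by (simp_all add: x1_def x2_def x3_def algebra_simps)
  \<comment> \<open>The weights \<open>a3 - a2\<close>, \<open>a1 - a3\<close>,
    \<open>a2 - a1\<close> sum to zero and are orthogonal to \<open>(a1, a2, a3)\<close>: the terms
    in \<open>S\<close> drop out, and of the phases only the difference of the two imaginary parts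
    remains.\<close>
  have comb: "(a2 - a1) * (Im (c * \<rho>) - Im c) + B * \<sigma> = (a3 - a2) * x1 + (a1 - a3) * x2 + (a2 - a1) * x3"
    unfolding B x1_def x2_def x3_def by algebra
  have xle: "\<bar>(a3 - a2) * x1 + (a1 - a3) * x2 + (a2 - a1) * x3\<bar> \<le> 6 * A * (k * \<theta> * \<sigma>)"
  proof -
    have a: "\<bar>a3 - a2\<bar> \<le> 2 * A" "\<bar>a1 - a3\<bar> \<le> 2 * A" "\<bar>a2 - a1\<bar> \<le> 2 * A" "0 \<le> 2 * A"
      using A A0 by linarith+
    have "\<bar>(a3 - a2) * x1\<bar> \<le> 2 * A * (k * \<theta> * \<sigma>)"
      unfolding abs_mult by (rule mult_mono[OF a(1) x(1) a(4) abs_ge_zero])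
    moreover have "\<bar>(a1 - a3) * x2\<bar> \<le> 2 * A * (k * \<theta> * \<sigma>)"
      unfolding abs_mult by (rule mult_mono[OF a(2) x(2) a(4) abs_ge_zero])
    moreover have "\<bar>(a2 - a1) * x3\<bar> \<le> 2 * A * (k * \<theta> * \<sigma>)"
      unfolding abs_mult by (rule mult_mono[OF a(3) x(3) a(4) abs_ge_zero])
    moreover have "6 * A * (k * \<theta> * \<sigma>) = 2 * A * (k * \<theta> * \<sigma>) + 2 * A * (k * \<theta> * \<sigma>) + 2 * A * (k * \<theta> * \<sigma>)"
      by simp
    ultimately show ?thesis by linarith
  qed
  \<comment> \<open>With \<open>c\<close> close to 1, multiplication by \<open>c\<close> cannot
    reverse the sign of the imaginary part contributed by \<open>\<rho>\<close>.\<close>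
  have cnear: "cmod (c - 1) \<le> 1 / 4"
  proof -
    have "c - 1 = (c - (1 - \<i> * of_real (m1 * \<sigma>) + \<i> * of_real (S * a1))) + (\<i> * of_real (S * a1) - \<i> * of_real (m1 * \<sigma>))" by simp
    also have "cmod \<dots> \<le> k * \<theta> * \<sigma> + (\<bar>S * a1\<bar> + \<bar>m1 * \<sigma>\<bar>)"
      by (rule order_trans[OF norm_triangle_ineq add_mono[OF est1 order_trans[OF norm_triangle_ineq4]]])
         (simp add: norm_mult del: of_real_mult)
    also have "\<dots> \<le> k * \<theta> * 1 + (\<theta> * A + m * \<theta>)"
    proof (intro add_mono)
      have "\<sigma> \<le> 1" "\<bar>\<sigma>\<bar> \<le> \<theta>" "0 \<le> k * \<theta>" "0 \<le> \<theta>" using \<sigma> \<theta> k0 by auto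
      then show "k * \<theta> * \<sigma> \<le> k * \<theta> * 1" "\<bar>m1 * \<sigma>\<bar> \<le> m * \<theta>" "\<bar>S * a1\<bar> \<le> \<theta> * A"
        unfolding abs_mult using mult_mono[OF m(1) _ m0 abs_ge_zero] mult_mono[OF S A(1) _ abs_ge_zero] mult_left_mono[of \<sigma> 1 "k * \<theta>"]
        by auto
    qed
    also have "\<dots> = (k + m + A) * \<theta>" by (simp add: algebra_simps)
    finally show ?thesis using \<theta> by simp
  qed
  have "\<bar>Re (c - 1)\<bar> \<le> 1 / 4" by (rule order_trans[OF abs_Re_le_cmod cnear])
  then have Rec: "Re c \<ge> 3 / 4" unfolding minus_complex.sel one_complex.sel by linarith
  have "\<bar>Im (c - 1)\<bar> \<le> 1 / 4" by (rule order_trans[OF abs_Im_le_cmod cnear])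
  then have Imc: "\<bar>Im c\<bar> \<le> 1 / 4" by simp
  have pos: "0 < \<beta> * (Im (c * \<rho>) - Im c)"
  proof -
    \<comment> \<open>The defect of the real part of \<open>\<rho>\<close> from 1. It is at most
      \<open>\<delta>\<close>, which keeps the lower bound linear in \<open>\<delta>\<close> on the
      whole range up to 1.\<close>
    define q where "q = 1 - sqrt (1 - \<delta>\<^sup>2)"
    have q: "0 \<le> q" "q \<le> \<delta>"
    proof -
      have "\<delta> * \<delta> \<le> \<delta> * 1" using \<rho> by (intro mult_left_mono) auto
      then have d2: "\<delta>\<^sup>2 \<le> \<delta>" by (simp add: power2_eq_square)
      have "(1 - \<delta>)\<^sup>2 \<le> 1 - \<delta>\<^sup>2" using d2 by (simp add: power2_eq_square algebra_simps)
      then have "1 - \<delta> \<le> sqrt (1 - \<delta>\<^sup>2)" by (rule real_le_rsqrt)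
      then show "q \<le> \<delta>" by (simp add: q_def)
      show "0 \<le> q" unfolding q_def using \<delta>2 by simp
    qed
    have "Im (c * \<rho>) - Im c = Re c * (\<beta> * \<delta>) - Im c * q"
      unfolding \<rho> q_def by (simp add: algebra_simps)
    then have "\<beta> * (Im (c * \<rho>) - Im c) = (\<beta> * \<beta>) * (Re c * \<delta>) - \<beta> * Im c * q"
      by (simp only:) (simp add: algebra_simps)
    also have "\<dots> = Re c * \<delta> - \<beta> * Im c * q" using \<beta>2 by simp
    also have "\<dots> \<ge> 3 / 4 * \<delta> - 1 / 4 * \<delta>"
    proof (rule diff_mono)
      show "3 / 4 * \<delta> \<le> Re c * \<delta>" using Rec \<rho> by (intro mult_right_mono) auto
      have "\<bar>\<beta>\<bar> = 1" using B(2) d by (simp add: \<beta> abs_sgn_eq)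
      then have "\<bar>\<beta> * Im c * q\<bar> \<le> 1 / 4 * \<delta>"
        unfolding abs_mult using Imc q by (intro mult_mono) auto
      then show "\<beta> * Im c * q \<le> 1 / 4 * \<delta>" by linarith
    qed
    finally show ?thesis using \<rho> by simp
  qed
  have Bd: "B * (a2 - a1) = \<beta> * \<bar>B * (a2 - a1)\<bar>" unfolding \<beta> by (simp add: sgn_mult_abs)
  have "B * ((a2 - a1) * (Im (c * \<rho>) - Im c)) = (B * (a2 - a1)) * (Im (c * \<rho>) - Im c)"
    by (simp only: mult.assoc)
  also have "\<dots> = (\<beta> * \<bar>B * (a2 - a1)\<bar>) * (Im (c * \<rho>) - Im c)"
    by (simp only: Bd[symmetric])
  also have "\<dots> = \<bar>B * (a2 - a1)\<bar> * (\<beta> * (Im (c * \<rho>) - Im c))"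
    by (simp only: mult_ac)
  also have "\<dots> > 0" by (rule mult_pos_pos[OF _ pos]) (use B(2) d in auto)
  finally have gt: "0 < B * ((a2 - a1) * (Im (c * \<rho>) - Im c))" .
  \<comment> \<open>The quantity just shown to be positive is bounded by \<open>\<bar>B\<bar> *
    \<sigma> * (6 * A * k * \<theta> - \<bar>B\<bar>)\<close>, which is nonpositive by the choice of
    \<open>\<theta>\<close>; \<open>\<sigma> = 0\<close> is covered as well.\<close>
  have "B * ((a2 - a1) * (Im (c * \<rho>) - Im c)) = B * ((a3 - a2) * x1 + (a1 - a3) * x2 + (a2 - a1) * x3) - B * B * \<sigma>"
    unfolding comb[symmetric] by (simp add: algebra_simps)
  also have "\<dots> \<le> \<bar>B\<bar> * (6 * A * (k * \<theta> * \<sigma>)) - B * B * \<sigma>"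
  proof -
    have "B * ((a3 - a2) * x1 + (a1 - a3) * x2 + (a2 - a1) * x3) \<le> \<bar>B\<bar> * \<bar>(a3 - a2) * x1 + (a1 - a3) * x2 + (a2 - a1) * x3\<bar>"
      unfolding abs_mult[symmetric] by (rule abs_ge_self)
    also have "\<dots> \<le> \<bar>B\<bar> * (6 * A * (k * \<theta> * \<sigma>))" using xle by (intro mult_left_mono) auto
    finally show ?thesis by (rule diff_right_mono)
  qed
  also have "\<dots> = \<bar>B\<bar> * \<sigma> * (6 * A * k * \<theta> - \<bar>B\<bar>)"
    by (simp add: algebra_simps)
  also have "\<dots> \<le> 0" using \<theta>(5) \<sigma> by (intro mult_nonneg_nonpos) auto
  finally show False using gt by simp
qed

section \<open>Energy estimate and phase of the solution\<close>

lemma primitive_on_cong_Icc: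
  assumes F: "primitive_on T F f"
    and eq: "\<And>x. x \<in> {0..T} \<Longrightarrow> F x = F' x" "\<And>x. x \<in> {0..T} \<Longrightarrow> f x = f' x"
  shows "primitive_on T F' f'"
proof (rule primitive_onI)
  show "integrable (leb T) f'"
    using primitive_on_integrable[OF F] eq(2) by (subst (asm) Bochner_Integration.integrable_cong[OF refl, of _ _ f']) auto
  fix t assume t: "0 \<le> t" "t \<le> T"
  have "(\<integral>x. f x \<partial>leb t) = (\<integral>x. f' x \<partial>leb t)"
    by (rule Bochner_Integration.integral_cong[OF refl]) (use eq(2) t in auto)
  then show "F' t = F' 0 + (\<integral>x. f' x \<partial>leb t)"
    using primitive_on_eq[OF F t] eq(1)[of t] eq(1)[of 0] t by simp
qed

lemma L2_norm_phi: "j \<ge> 1 \<Longrightarrow> L2_norm I01 (phi j) = 1"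
proof -
  assume "j \<ge> 1"
  then have "complex_of_real ((L2_norm I01 (phi j))\<^sup>2) = of_real 1"
    unfolding L2_inner_self[symmetric] by (simp add: phi_orthonormal)
  then have "(L2_norm I01 (phi j))\<^sup>2 = 1\<^sup>2" unfolding of_real_eq_iff by simp
  then show ?thesis by (rule power2_eq_imp_eq) auto
qed

text \<open>Meant for the initial deviation, since the initial condition was extracted from the mild
  formulation coefficient by coefficient.\<close>

lemma L2_inner_eq_0_of_coefficients:
  assumes f: "f \<in> L2 I01" and 0: "\<And>k. k \<ge> 1 \<Longrightarrow> L2_inner f (phi k) = 0"
  shows "L2_inner f f = 0"
proof -
  have "(\<Sum>k=1..n. L2_inner f (phi k) * cnj (L2_inner f (phi k))) = 0" for n
    by (rule sum.neutral) (use 0 in auto)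
  then have "(\<lambda>n. 0) \<longlonglongrightarrow> L2_inner f f" using parseval[OF f f] by (simp only:)
  then show ?thesis by (simp add: LIMSEQ_const_iff)
qed

context potential
begin

lemma L2_norm_profile_le:
  assumes j: "j \<ge> 1"
  shows "L2_norm I01 (profile j s t) \<le> 1"
proof -
  have "L2_norm I01 (profile j s t) = L2_norm I01 (gauged j (s t))"
    unfolding profile_def L2_norm_scale norm_exp_minus_i by simp
  also have "\<dots> \<le> 1 * L2_norm I01 (phi j)"
    unfolding gauged_def by (rule L2_norm_mult_bounded[OF phi_L2 gauge_measurable]) auto
  finally show ?thesis using L2_norm_phi[OF j] by simp
qed

lemma L2_norm_profile_resid_le:
  "\<bar>s t\<bar> \<le> 1 \<Longrightarrow> L2_norm I01 (profile_resid j s t) \<le> resid_bound j * \<bar>s t\<bar>"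
  unfolding profile_resid_def L2_norm_scale norm_exp_minus_i using norm_resid_le by simp

lemma L2_inner_profile_resid:
  "L2_inner (profile j s t) (profile_resid j s t) = of_real ((s t)\<^sup>2 * diag (\<lambda>x. (N x)\<^sup>2) j)"
proof -
  have ex: "exp (- \<i> * of_real r) * cnj (exp (- \<i> * of_real r)) = 1" for r :: real
    by (simp only: complex_norm_square[symmetric] norm_exp_minus_i) simp
  have "L2_inner (profile j s t) (profile_resid j s t) =
    (exp (- \<i> * of_real (eig j * t)) * cnj (exp (- \<i> * of_real (eig j * t)))) * L2_inner (gauged j (s t)) (resid j (s t))"
    unfolding profile_def profile_resid_def L2_inner_scale_left L2_inner_scale_right by (simp only: mult_ac)
  then show ?thesis unfolding ex L2_inner_gauged_resid by simp
qed

lemma L2_inner_M_mult: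
  "L2_inner (\<lambda>x. of_real (M x) * f x) h = L2_inner f (\<lambda>x. of_real (M x) * h x)"
  unfolding L2_inner_def by (simp add: mult_ac)

text \<open>Multiplication by a real function is symmetric, so the control term cannot change norms.
  This removes \<open>u\<close> from the energy estimate.\<close>

lemma Im_L2_inner_M_mult: "Im (L2_inner (\<lambda>x. of_real (M x) * f x) f) = 0"
proof -
  have "L2_inner (\<lambda>x. of_real (M x) * f x) f = L2_inner f (\<lambda>x. of_real (M x) * f x)"
    by (rule L2_inner_M_mult)
  also have "\<dots> = cnj (L2_inner (\<lambda>x. of_real (M x) * f x) f)"
    by (rule L2_inner_commute)
  finally have "Im (L2_inner (\<lambda>x. of_real (M x) * f x) f) = Im (cnj (L2_inner (\<lambda>x. of_real (M x) * f x) f))"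
    by (rule arg_cong)
  then show ?thesis by simp
qed

text \<open>The deviation of the solution from the gauged profile obeys the equation with the source
  \<open>profile_resid\<close>, whence it is bounded by the \<open>L\<^sup>1\<close> norm in time of that source.  The phase is
  therefore determined up to an error that is quadratic in that norm.\<close>

lemma phase_expansion:
  assumes sol: "mild_solution \<mu> u T (phi j) \<psi>" and T: "0 < T" and j: "j \<ge> 1"
    and \<mu>: "\<mu> \<in> borel_measurable M01" "AE x in M01. \<mu> x = M x"
    and u: "integrable (leb T) u"
    and s: "\<And>t. t \<in> {0..T} \<Longrightarrow> s t = (\<integral>x. u x \<partial>leb t)"
    and s1: "\<And>t. t \<in> {0..T} \<Longrightarrow> \<bar>s t\<bar> \<le> 1"
  shows "cmod (L2_inner (\<psi> T) (profile j s T)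
      - (1 - \<i> * of_real (diag (\<lambda>x. (N x)\<^sup>2) j * (\<integral>t. (s t)\<^sup>2 \<partial>leb T))))
    \<le> 2 * (resid_bound j)\<^sup>2 * T * (\<integral>t. (s t)\<^sup>2 \<partial>leb T)"
proof -
  define X where "X = profile j s"
  define R where "R = profile_resid j s"
  define C where "C = resid_bound j"
  define n where "n = diag (\<lambda>x. (N x)\<^sup>2) j"
  define w where "w = (\<lambda>t x. \<psi> t x - X t x)"
  define P where "P = (\<lambda>t x. \<i> * of_real (u t) * (of_real (M x) * \<psi> t x))"
  define Q where "Q = (\<lambda>t x. \<i> * of_real (u t) * (of_real (M x) * X t x) + \<i> * R t x)"
  \<comment> \<open>The forcing of the deviation \<open>w\<close>: the same control term, and the
    residual of the profile with opposite sign.\<close>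
  define D where "D = (\<lambda>t x. \<i> * of_real (u t) * (of_real (M x) * w t x) + (- \<i>) * R t x)"
  have C0: "0 \<le> C" unfolding C_def by (rule resid_bound_nonneg)
  have \<psi>L: "\<psi> t \<in> L2 I01" if "t \<in> {0..T}" for t
    using sol that by (auto simp: mild_solution_def continuous_H3_0_def intro: H3_0_imp_L2)
  have XL: "X t \<in> L2 I01" for t unfolding X_def by (rule profile_L2)
  have RL: "R t \<in> L2 I01" for t unfolding R_def by (rule profile_resid_L2)
  have wL: "w t \<in> L2 I01" if "t \<in> {0..T}" for t unfolding w_def by (rule L2_diff[OF \<psi>L[OF that] XL])
  have PL: "P t \<in> L2 I01" if "t \<in> {0..T}" for t unfolding P_def by (intro L2_scale M_mult_L2 \<psi>L that)
  have QL: "Q t \<in> L2 I01" for t unfolding Q_def by (rule L2_add[OF L2_scale[OF M_mult_L2[OF XL]] L2_scale[OF RL]])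
  have DL: "D t \<in> L2 I01" if "t \<in> {0..T}" for t
    unfolding D_def by (rule L2_add[OF L2_scale[OF M_mult_L2[OF wL[OF that]]] L2_scale[OF RL]])
  have D: "D t = (\<lambda>x. P t x - Q t x)" for t
    unfolding D_def P_def Q_def w_def by (rule ext) (simp add: algebra_simps)
  obtain K0 where K0: "\<And>t. t \<in> {0..T} \<Longrightarrow> L2_norm I01 (\<psi> t) \<le> K0"
    using continuous_H3_0_bounded[of T \<psi>] sol unfolding mild_solution_def by blast
  \<comment> \<open>One bound for the solution, the profile and their difference, as the pairing
    argument asks for a common constant.\<close>
  define K where "K = K0 + 1"
  have K0_nonneg: "0 \<le> K0" by (rule order_trans[OF L2_norm_nonneg K0[of 0]]) (use T in simp)
  have X1: "L2_norm I01 (X t) \<le> 1" for t unfolding X_def by (rule L2_norm_profile_le[OF j])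
  have RC: "L2_norm I01 (R t) \<le> C * \<bar>s t\<bar>" if "t \<in> {0..T}" for t
    unfolding R_def C_def by (rule L2_norm_profile_resid_le[of s t j, OF s1[OF that]])
  have \<psi>K: "L2_norm I01 (\<psi> t) \<le> K" if "t \<in> {0..T}" for t using K0[OF that] by (simp add: K_def)
  have XK: "L2_norm I01 (X t) \<le> K" for t using X1[of t] K0_nonneg by (simp add: K_def)
  have wK: "L2_norm I01 (w t) \<le> K" if t: "t \<in> {0..T}" for t
  proof -
    have "L2_norm I01 (\<lambda>x. \<psi> t x + (- 1) * X t x) \<le> L2_norm I01 (\<psi> t) + L2_norm I01 (\<lambda>x. (- 1) * X t x)"
      by (rule L2_norm_triangle[OF \<psi>L[OF t] L2_scale[OF XL]])
    also have "L2_norm I01 (\<lambda>x. (- 1) * X t x) = L2_norm I01 (X t)" unfolding L2_norm_scale by simp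
    finally show ?thesis using K0[OF t] X1[of t] by (simp add: w_def K_def)
  qed
  have Mf: "L2_norm I01 (\<lambda>x. \<i> * of_real (u t) * (of_real (M x) * f x)) \<le> M_bound * K * \<bar>u t\<bar>"
    if f: "f \<in> L2 I01" "L2_norm I01 f \<le> K" for f t
  proof -
    have "L2_norm I01 (\<lambda>x. \<i> * of_real (u t) * (of_real (M x) * f x)) = \<bar>u t\<bar> * L2_norm I01 (\<lambda>x. of_real (M x) * f x)"
      unfolding L2_norm_scale by (simp add: norm_mult)
    also have "\<dots> \<le> \<bar>u t\<bar> * (M_bound * K)"
      using order_trans[OF L2_norm_M_mult_le[OF f(1)] mult_left_mono[OF f(2) M_bound_nonneg]]
      by (intro mult_left_mono) auto
    finally show ?thesis by (simp add: mult_ac)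
  qed
  \<comment> \<open>A majorant for all forcing terms. The control enters it only to justify limits;
    the final constants depend on the residual alone.\<close>
  define p where "p = (\<lambda>t. M_bound * K * \<bar>u t\<bar> + C * \<bar>s t\<bar>)"
  have sc: "continuous_on {0..T} s"
    by (rule continuous_on_eq[OF indefinite_integral_continuous_real[OF u]]) (use s in auto)
  have asi: "integrable (leb T) (\<lambda>t. \<bar>s t\<bar>)"
    by (intro integrable_continuous_Icc continuous_intros sc)
  have pint: "integrable (leb T) p" unfolding p_def using u asi by simp
  have pP: "L2_norm I01 (P t) \<le> p t" if "t \<in> {0..T}" for t
    using Mf[OF \<psi>L[OF that] \<psi>K[OF that], of t] C0 unfolding P_def p_def by (simp add: add_increasing2)
  have pQ: "L2_norm I01 (Q t) \<le> p t" if t: "t \<in> {0..T}" for t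
  proof -
    have "L2_norm I01 (Q t) \<le> L2_norm I01 (\<lambda>x. \<i> * of_real (u t) * (of_real (M x) * X t x)) + L2_norm I01 (\<lambda>x. \<i> * R t x)"
      unfolding Q_def by (rule L2_norm_triangle[OF L2_scale[OF M_mult_L2[OF XL]] L2_scale[OF RL]])
    also have "L2_norm I01 (\<lambda>x. \<i> * R t x) = L2_norm I01 (R t)" unfolding L2_norm_scale by simp
    finally show ?thesis using Mf[OF XL XK, of t t] RC[OF t] unfolding p_def by linarith
  qed
  have pD: "L2_norm I01 (D t) \<le> p t" if t: "t \<in> {0..T}" for t
  proof -
    have "L2_norm I01 (D t) \<le> L2_norm I01 (\<lambda>x. \<i> * of_real (u t) * (of_real (M x) * w t x)) + L2_norm I01 (\<lambda>x. (- \<i>) * R t x)"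
      unfolding D_def by (rule L2_norm_triangle[OF L2_scale[OF M_mult_L2[OF wL[OF t]]] L2_scale[OF RL]])
    also have "L2_norm I01 (\<lambda>x. (- \<i>) * R t x) = L2_norm I01 (R t)" unfolding L2_norm_scale by simp
    finally show ?thesis using Mf[OF wL[OF t] wK[OF t], of t] RC[OF t] unfolding p_def by linarith
  qed
  have \<psi>c: "primitive_on T (\<lambda>t. exp (\<i> * of_real (eig k * t)) * L2_inner (\<psi> t) (phi k))
      (\<lambda>t. exp (\<i> * of_real (eig k * t)) * L2_inner (P t) (phi k))" if k: "k \<ge> 1" for k
    unfolding P_def by (rule mild_solution_coefficient(1)[OF sol _ k \<mu>]) (use T in simp)
  have Xc: "primitive_on T (\<lambda>t. exp (\<i> * of_real (eig k * t)) * L2_inner (X t) (phi k))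
      (\<lambda>t. exp (\<i> * of_real (eig k * t)) * L2_inner (Q t) (phi k))" for k
    unfolding X_def Q_def R_def by (rule profile_primitive_on[OF u s])
  have wc: "primitive_on T (\<lambda>t. exp (\<i> * of_real (eig k * t)) * L2_inner (w t) (phi k))
      (\<lambda>t. exp (\<i> * of_real (eig k * t)) * L2_inner (D t) (phi k))" if k: "k \<ge> 1" for k
  proof (rule primitive_on_cong_Icc[OF primitive_on_diff[OF \<psi>c[OF k] Xc]])
    fix t assume t: "t \<in> {0..T}"
    show "exp (\<i> * of_real (eig k * t)) * L2_inner (\<psi> t) (phi k) - exp (\<i> * of_real (eig k * t)) * L2_inner (X t) (phi k)
      = exp (\<i> * of_real (eig k * t)) * L2_inner (w t) (phi k)"
      unfolding w_def L2_inner_diff_left[OF \<psi>L[OF t] XL phi_L2] right_diff_distrib ..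
    show "exp (\<i> * of_real (eig k * t)) * L2_inner (P t) (phi k) - exp (\<i> * of_real (eig k * t)) * L2_inner (Q t) (phi k)
      = exp (\<i> * of_real (eig k * t)) * L2_inner (D t) (phi k)"
      unfolding D L2_inner_diff_left[OF PL[OF t] QL phi_L2] right_diff_distrib ..
  qed
  have s0: "s 0 = 0"
    using s[of 0] integral_combine_Icc[OF u, of 0 0] T by simp
  have X0: "X 0 = phi j" unfolding X_def profile_def gauged_def by (rule ext) (simp add: s0)
  have \<psi>0: "L2_inner (\<psi> 0) (phi k) = L2_inner (phi j) (phi k)" if "k \<ge> 1" for k
    by (rule mild_solution_coefficient(2)[OF sol _ that \<mu>]) (use T in simp)
  have T0: "0 \<in> {0..T}" "T \<in> {0..T}" using T by auto
  have w0: "L2_inner (w 0) (w 0) = 0"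
  proof (rule L2_inner_eq_0_of_coefficients[OF wL[OF T0(1)]])
    show "L2_inner (w 0) (phi k) = 0" if "k \<ge> 1" for k
    proof -
      have "L2_inner (w 0) (phi k) = L2_inner (\<psi> 0) (phi k) - L2_inner (X 0) (phi k)"
        unfolding w_def by (rule L2_inner_diff_left[OF \<psi>L[OF T0(1)] XL phi_L2])
      then show ?thesis using \<psi>0[OF that] by (simp add: X0)
    qed
  qed
  \<comment> \<open>Working with the supremum closes the estimate without dividing by a norm that
    may vanish at some times: it yields \<open>W^2 \<le> 2 * C * l * W\<close>.\<close>
  define W where "W = (SUP t\<in>{0..T}. L2_norm I01 (w t))"
  have bdd: "bdd_above ((\<lambda>t. L2_norm I01 (w t)) ` {0..T})"
    by (rule bdd_aboveI[of _ K]) (use wK in auto)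
  have wW: "L2_norm I01 (w t) \<le> W" if "t \<in> {0..T}" for t
    unfolding W_def by (rule cSUP_upper[OF that bdd])
  have W0: "0 \<le> W" by (rule order_trans[OF L2_norm_nonneg wW[OF T0(1)]])
  define l where "l = (\<integral>t. \<bar>s t\<bar> \<partial>leb T)"
  have l0: "0 \<le> l" unfolding l_def by simp
  have ww: "primitive_on T (\<lambda>t. L2_inner (w t) (w t)) (\<lambda>t. L2_inner (D t) (w t) + L2_inner (w t) (D t))"
    by (rule pairing_primitive_on[OF wL wL DL DL wK wK pD pD pint wc wc])
  have wRle: "cmod (L2_inner (w t) (R t)) \<le> C * W * \<bar>s t\<bar>" if t: "t \<in> {0..T}" for t
  proof -
    have "cmod (L2_inner (w t) (R t)) \<le> L2_norm I01 (w t) * L2_norm I01 (R t)"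
      by (rule L2_cauchy_schwarz[OF wL[OF t] RL])
    also have "\<dots> \<le> W * (C * \<bar>s t\<bar>)"
      by (rule mult_mono[OF wW[OF t] RC[OF t] W0 L2_norm_nonneg])
    finally show ?thesis by (simp add: mult_ac)
  qed
  have dle: "cmod (L2_inner (D t) (w t) + L2_inner (w t) (D t)) \<le> 2 * C * W * \<bar>s t\<bar>" if t: "t \<in> {0..T}" for t
  proof -
    have Dw: "L2_inner (D t) (w t) = \<i> * of_real (u t) * L2_inner (\<lambda>x. of_real (M x) * w t x) (w t) + (- \<i>) * L2_inner (R t) (w t)"
      unfolding D_def L2_inner_add_left[OF L2_scale[OF M_mult_L2[OF wL[OF t]]] L2_scale[OF RL] wL[OF t]] L2_inner_scale_left ..
    have "L2_inner (D t) (w t) + L2_inner (w t) (D t) = L2_inner (D t) (w t) + cnj (L2_inner (D t) (w t))"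
      by (simp add: L2_inner_commute[of "w t" "D t"])
    also have "\<dots> = of_real (2 * Re (L2_inner (D t) (w t)))" by (rule complex_add_cnj)
    \<comment> \<open>The control part of this pairing is purely imaginary and contributes nothing
      to the derivative of the squared norm.\<close>
    also have "Re (L2_inner (D t) (w t)) = Im (L2_inner (R t) (w t))"
      unfolding Dw using Im_L2_inner_M_mult[of "w t"] by simp
    finally have "cmod (L2_inner (D t) (w t) + L2_inner (w t) (D t)) = 2 * \<bar>Im (L2_inner (R t) (w t))\<bar>"
      by (simp only: norm_of_real abs_mult abs_numeral)
    also have "\<dots> \<le> 2 * cmod (L2_inner (R t) (w t))" using abs_Im_le_cmod by simp
    also have "cmod (L2_inner (R t) (w t)) = cmod (L2_inner (w t) (R t))"
      by (subst L2_inner_commute) (rule complex_mod_cnj)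
    finally show ?thesis using wRle[OF t] by simp
  qed
  have wsq: "(L2_norm I01 (w t))\<^sup>2 \<le> 2 * C * l * W" if t: "t \<in> {0..T}" for t
  proof -
    have t': "0 \<le> t" "t \<le> T" using t by auto
    have bi: "integrable (leb T) (\<lambda>t. 2 * C * W * \<bar>s t\<bar>)" using asi by simp
    have "(L2_norm I01 (w t))\<^sup>2 = cmod (L2_inner (w t) (w t))"
      unfolding L2_inner_self norm_of_real by simp
    also have "L2_inner (w t) (w t) = (\<integral>x. L2_inner (D x) (w x) + L2_inner (w x) (D x) \<partial>leb t)"
      using primitive_on_eq[OF ww t'] w0 by simp
    also have "cmod \<dots> \<le> (\<integral>x. 2 * C * W * \<bar>s x\<bar> \<partial>leb t)"
    proof (rule norm_integral_le_increment)
      show "integrable (leb t) (\<lambda>x. L2_inner (D x) (w x) + L2_inner (w x) (D x))"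
        by (rule integrable_subinterval_Icc[OF primitive_on_integrable[OF ww]]) (use t' in auto)
      show "integrable (leb t) (\<lambda>x. 2 * C * W * \<bar>s x\<bar>)"
        by (rule integrable_subinterval_Icc[OF bi]) (use t' in auto)
      show "cmod (L2_inner (D x) (w x) + L2_inner (w x) (D x)) \<le> 2 * C * W * \<bar>s x\<bar>" if "x \<in> {0..t}" for x
        by (rule dle) (use that t' in auto)
    qed
    also have "\<dots> \<le> (\<integral>x. 2 * C * W * \<bar>s x\<bar> \<partial>leb T)"
      by (rule integral_nonneg_mono_Icc[OF bi]) (use C0 W0 t' in auto)
    also have "\<dots> = 2 * C * W * l" by (simp add: l_def)
    finally show ?thesis by (simp add: mult_ac)
  qed
  have Wl: "W \<le> 2 * C * l"
  proof (cases "W = 0")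
    case False
    have "W \<le> sqrt (2 * C * l * W)"
      unfolding W_def[symmetric] by (subst W_def, rule cSUP_least) (use T wsq in \<open>auto intro: real_le_rsqrt\<close>)
    then have "W\<^sup>2 \<le> (sqrt (2 * C * l * W))\<^sup>2" using W0 by (rule power_mono)
    also have "\<dots> = 2 * C * l * W" using C0 l0 W0 by simp
    finally show ?thesis using False W0 by (simp add: power2_eq_square)
  qed (use C0 l0 in simp)
  define \<sigma> where "\<sigma> = (\<integral>t. (s t)\<^sup>2 \<partial>leb T)"
  have s2i: "integrable (leb T) (\<lambda>t. (s t)\<^sup>2)"
    by (intro integrable_continuous_Icc continuous_intros sc)
  have \<sigma>0: "0 \<le> \<sigma>" unfolding \<sigma>_def by simp
  \<comment> \<open>Cauchy-Schwarz in time against the constant 1; the factor \<open>T\<close> of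
    the remainder originates here.\<close>
  have l2: "l\<^sup>2 \<le> T * \<sigma>"
  proof -
    have "(\<integral>x. norm (s x) * norm (1::real) \<partial>leb T) \<le>
      sqrt (\<integral>x. (norm (s x))\<^sup>2 \<partial>leb T) * sqrt (\<integral>x. (norm (1::real))\<^sup>2 \<partial>leb T)"
      using s2i continuous_on_measurable_Icc[OF sc] by (intro cauchy_schwarz_integral) auto
    also have "(\<integral>x. (norm (1::real))\<^sup>2 \<partial>leb T) = T"
      using T by (simp add: measure_restrict_space)
    finally have "l \<le> sqrt \<sigma> * sqrt T" unfolding l_def \<sigma>_def by simp
    then have "l\<^sup>2 \<le> (sqrt \<sigma> * sqrt T)\<^sup>2" using l0 by (rule power_mono)
    then show ?thesis using \<sigma>0 T by (simp add: power_mult_distrib mult.commute)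
  qed
  have \<psi>X: "primitive_on T (\<lambda>t. L2_inner (\<psi> t) (X t)) (\<lambda>t. L2_inner (P t) (X t) + L2_inner (\<psi> t) (Q t))"
    by (rule pairing_primitive_on[OF \<psi>L XL PL QL \<psi>K XK pP pQ pint \<psi>c Xc])
  \<comment> \<open>The control terms of \<open>P\<close> and \<open>Q\<close> cancel by symmetry.
    Splitting the solution into profile and deviation in the pairing with \<open>R\<close>, the
    profile gives the main term with \<open>n\<close>, and the deviation is left as error.\<close>
  have deriv: "L2_inner (P t) (X t) + L2_inner (\<psi> t) (Q t) + \<i> * of_real n * of_real ((s t)\<^sup>2) = - \<i> * L2_inner (w t) (R t)"
    if t: "t \<in> {0..T}" for t
  proof -
    have 1: "L2_inner (P t) (X t) = \<i> * of_real (u t) * L2_inner (\<psi> t) (\<lambda>x. of_real (M x) * X t x)"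
      unfolding P_def L2_inner_scale_left L2_inner_M_mult[of "\<psi> t" "X t"] ..
    have 2: "L2_inner (\<psi> t) (Q t) = - \<i> * of_real (u t) * L2_inner (\<psi> t) (\<lambda>x. of_real (M x) * X t x) - \<i> * L2_inner (\<psi> t) (R t)"
      unfolding Q_def L2_inner_add_right[OF L2_scale[OF M_mult_L2[OF XL]] L2_scale[OF RL] \<psi>L[OF t]] L2_inner_scale_right by simp
    have 3: "L2_inner (w t) (R t) = L2_inner (\<psi> t) (R t) - of_real ((s t)\<^sup>2 * n)"
      unfolding w_def L2_inner_diff_left[OF \<psi>L[OF t] XL RL] unfolding X_def R_def n_def L2_inner_profile_resid ..
    show ?thesis unfolding 1 2 3 by (simp add: algebra_simps)
  qed
  have dint: "integrable (leb T) (\<lambda>t. L2_inner (P t) (X t) + L2_inner (\<psi> t) (Q t))"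
    by (rule primitive_on_integrable[OF \<psi>X])
  have nint: "integrable (leb T) (\<lambda>t. \<i> * of_real n * of_real ((s t)\<^sup>2))"
    using s2i by (intro integrable_mult_right integrable_of_real) auto
  have "L2_inner (\<psi> T) (X T) - (1 - \<i> * of_real (n * \<sigma>))
    = (\<integral>t. L2_inner (P t) (X t) + L2_inner (\<psi> t) (Q t) \<partial>leb T) + \<i> * of_real n * of_real \<sigma>"
    using primitive_on_eq[OF \<psi>X, of T] T \<psi>0[OF j] j unfolding X0 by (simp add: phi_orthonormal)
  also have "\<i> * of_real n * of_real \<sigma> = (\<integral>t. \<i> * of_real n * of_real ((s t)\<^sup>2) \<partial>leb T)"
    unfolding \<sigma>_def by (simp only: integral_mult_right_zero integral_complex_of_real)
  also have "(\<integral>t. L2_inner (P t) (X t) + L2_inner (\<psi> t) (Q t) \<partial>leb T) + (\<integral>t. \<i> * of_real n * of_real ((s t)\<^sup>2) \<partial>leb T)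
    = (\<integral>t. L2_inner (P t) (X t) + L2_inner (\<psi> t) (Q t) + \<i> * of_real n * of_real ((s t)\<^sup>2) \<partial>leb T)"
    by (rule Bochner_Integration.integral_add[OF dint nint, symmetric])
  also have "cmod \<dots> \<le> (\<integral>t. C * W * \<bar>s t\<bar> \<partial>leb T)"
  proof (rule norm_integral_le_increment)
    show "integrable (leb T) (\<lambda>t. L2_inner (P t) (X t) + L2_inner (\<psi> t) (Q t) + \<i> * of_real n * of_real ((s t)\<^sup>2))"
      by (rule Bochner_Integration.integrable_add[OF dint nint])
    show "integrable (leb T) (\<lambda>t. C * W * \<bar>s t\<bar>)" using asi by simp
    show "cmod (L2_inner (P t) (X t) + L2_inner (\<psi> t) (Q t) + \<i> * of_real n * of_real ((s t)\<^sup>2)) \<le> C * W * \<bar>s t\<bar>"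
      if t: "t \<in> {0..T}" for t
      unfolding deriv[OF t] norm_mult using wRle[OF t] by simp
  qed
  also have "\<dots> = C * W * l" by (simp add: l_def)
  \<comment> \<open>One factor \<open>l\<close> comes from the residual, the other from the bound on
    the deviation, which makes the remainder quadratic.\<close>
  also have "\<dots> \<le> C * (2 * C * l) * l" using Wl C0 l0 by (intro mult_right_mono mult_left_mono) auto
  also have "\<dots> = 2 * C\<^sup>2 * l\<^sup>2" by (simp add: power2_eq_square mult_ac)
  also have "\<dots> \<le> 2 * C\<^sup>2 * (T * \<sigma>)" using l2 by (intro mult_left_mono) auto
  finally show ?thesis unfolding X_def n_def C_def \<sigma>_def by (simp add: mult_ac)
qed

text \<open>The target replaces the solution at the final time, and its pairing with the profile is
  \<open>c\<close> times a coefficient of the gauged eigenfunction. Expanding this at gauge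
  parameter 0 turns the phase expansion into an equation for \<open>c\<close>.\<close>

lemma terminal_phase:
  assumes sol: "mild_solution \<mu> u T (phi j) \<psi>" and T: "0 < T" and j: "j \<ge> 1"
    and \<mu>: "\<mu> \<in> borel_measurable M01" "AE x in M01. \<mu> x = M x"
    and u: "integrable (leb T) u"
    and s: "\<And>t. t \<in> {0..T} \<Longrightarrow> s t = (\<integral>x. u x \<partial>leb t)"
    and s1: "\<And>t. t \<in> {0..T} \<Longrightarrow> \<bar>s t\<bar> \<le> 1"
    and c: "cmod c = 1" and target: "L2_eq (\<psi> T) (\<lambda>x. c * Phi j T x)"
    and E: "2 * (resid_bound j)\<^sup>2 \<le> E"
  shows "cmod (c * (1 - \<i> * of_real (s T * diag M j))
      - (1 - \<i> * of_real (diag (\<lambda>x. (N x)\<^sup>2) j * (\<integral>t. (s t)\<^sup>2 \<partial>leb T))))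
    \<le> E * T * (\<integral>t. (s t)\<^sup>2 \<partial>leb T) + 4 * M_bound\<^sup>2 * (s T)\<^sup>2"
proof -
  let ?e = "exp (- \<i> * of_real (eig j * T))"
  let ?S = "s T"
  define \<sigma> where "\<sigma> = (\<integral>t. (s t)\<^sup>2 \<partial>leb T)"
  have \<sigma>0: "0 \<le> \<sigma>" unfolding \<sigma>_def by simp
  have ex: "?e * cnj ?e = 1"
    by (simp only: complex_norm_square[symmetric] norm_exp_minus_i) simp
  have \<psi>L: "\<psi> T \<in> L2 I01"
    using sol T by (auto simp: mild_solution_def continuous_H3_0_def intro: H3_0_imp_L2)
  have Phi_eq: "Phi j T = (\<lambda>x. ?e * phi j x)" by (rule ext) (simp add: Phi_def mult.commute)
  have PhiL: "(\<lambda>x. c * Phi j T x) \<in> L2 I01"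
    unfolding Phi_eq by (intro L2_scale phi_L2)
  have "L2_inner (\<psi> T) (profile j s T) = L2_inner (\<lambda>x. c * Phi j T x) (profile j s T)"
    by (rule L2_inner_cong_AE) (use target \<psi>L PhiL profile_L2 in \<open>auto simp: L2_eq_def intro: L2_measurable\<close>)
  also have "\<dots> = c * ((?e * cnj ?e) * L2_inner (phi j) (gauged j ?S))"
    unfolding Phi_eq profile_def L2_inner_scale_right L2_inner_scale_left by (simp only: mult_ac)
  finally have y: "L2_inner (\<psi> T) (profile j s T) = c * L2_inner (phi j) (gauged j ?S)"
    unfolding ex by simp
  have g0: "gauged j 0 = phi j" unfolding gauged_def by (rule ext) simp
  have "L2_inner (\<lambda>x. \<i> * of_real (M x) * gauged j 0 x) (phi j) = \<i> * of_real (diag M j)"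
  proof -
    have "L2_inner (\<lambda>x. of_real (M x) * phi j x) (phi j) = of_real (diag M j)"
      unfolding diag_def using Im_L2_inner_M_mult[of "phi j"] by (simp add: complex_eq_iff)
    then show ?thesis unfolding g0 mult.assoc L2_inner_scale_left by simp
  qed
  then have "cmod (L2_inner (gauged j ?S) (phi j) - (1 + \<i> * of_real (?S * diag M j))) \<le> 4 * M_bound\<^sup>2 * ?S\<^sup>2"
    using gauged_coefficient_Taylor[of j ?S j 0] j by (simp add: g0 phi_orthonormal algebra_simps)
  \<comment> \<open>Conjugation swaps the arguments of the inner product and changes the sign of the
    imaginary term.\<close>
  then have "cmod (cnj (L2_inner (gauged j ?S) (phi j) - (1 + \<i> * of_real (?S * diag M j)))) \<le> 4 * M_bound\<^sup>2 * ?S\<^sup>2"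
    by (simp only: complex_mod_cnj)
  then have "cmod (L2_inner (phi j) (gauged j ?S) - (1 - \<i> * of_real (?S * diag M j))) \<le> 4 * M_bound\<^sup>2 * ?S\<^sup>2"
    by (simp add: L2_inner_commute[of "phi j"])
  then have "cmod (c * (L2_inner (phi j) (gauged j ?S) - (1 - \<i> * of_real (?S * diag M j)))) \<le> 4 * M_bound\<^sup>2 * ?S\<^sup>2"
    unfolding norm_mult c by simp
  moreover have "cmod (c * L2_inner (phi j) (gauged j ?S) - (1 - \<i> * of_real (diag (\<lambda>x. (N x)\<^sup>2) j * \<sigma>))) \<le> E * T * \<sigma>"
  proof -
    have "2 * (resid_bound j)\<^sup>2 * T * \<sigma> \<le> E * T * \<sigma>" using E T \<sigma>0 by (intro mult_right_mono) auto
    then show ?thesis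
      using phase_expansion[OF sol T j \<mu> u s s1] unfolding y \<sigma>_def[symmetric] by simp
  qed
  moreover have "c * (1 - \<i> * of_real (?S * diag M j)) - (1 - \<i> * of_real (diag (\<lambda>x. (N x)\<^sup>2) j * \<sigma>))
    = (c * L2_inner (phi j) (gauged j ?S) - (1 - \<i> * of_real (diag (\<lambda>x. (N x)\<^sup>2) j * \<sigma>)))
      - c * (L2_inner (phi j) (gauged j ?S) - (1 - \<i> * of_real (?S * diag M j)))"
    by (simp add: algebra_simps)
  ultimately show ?thesis unfolding \<sigma>_def[symmetric]
    by (simp only:) (rule order_trans[OF norm_triangle_ineq4 add_mono])
qed

end

section \<open>Choice of the constants and conclusion\<close>

lemma diag_cong_AE:
  assumes "f \<in> borel_measurable M01" "g \<in> borel_measurable M01" "AE x in M01. f x = g x"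
  shows "diag f k = diag g k"
proof -
  have "L2_inner (\<lambda>x. complex_of_real (f x) * phi k x) (phi k) = L2_inner (\<lambda>x. complex_of_real (g x) * phi k x) (phi k)"
  proof (rule L2_inner_cong_AE)
    show "AE x in M01. complex_of_real (f x) * phi k x = complex_of_real (g x) * phi k x"
      using assms(3) by eventually_elim simp
    show "(\<lambda>x. complex_of_real (f x) * phi k x) \<in> borel_measurable M01" "(\<lambda>x. complex_of_real (g x) * phi k x) \<in> borel_measurable M01"
      using assms(1,2) by measurable
  qed auto
  then show ?thesis by (simp add: diag_def)
qed

text \<open>Cauchy-Schwarz against the constant 1 gives a factor \<open>sqrt T\<close>, which
  \<open>T \<le> 1\<close> allows to be dropped. Smallness of the control thus becomes uniform
  smallness of its primitive.\<close>

lemma primitive_of_small_control: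
  fixes u :: "real \<Rightarrow> real"
  assumes u: "u \<in> L2 {0<..<T}" and T: "0 < T" "T \<le> 1" and t: "t \<in> {0..T}"
  shows "integrable (leb T) u" "\<bar>\<integral>x. u x \<partial>leb t\<bar> \<le> L2_norm {0<..<T} u"
proof -
  have one: "(\<lambda>x. 1::real) \<in> L2 {0<..<T}"
    by (simp add: L2_def finite_measure.integrable_const[OF finite_measure_lebesgue_on])
  have "integrable (lebesgue_on {0<..<T}) (\<lambda>x. u x * 1)" by (rule L2_integrable_mult[OF u one])
  then show ui: "integrable (leb T) u" by (simp add: integrable_Icc_iff_Ioo)
  have ai: "integrable (leb T) (\<lambda>x. \<bar>u x\<bar>)" using ui by simp
  have "norm (\<integral>x. u x \<partial>leb t) \<le> (\<integral>x. \<bar>u x\<bar> \<partial>leb t)"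
    by (rule norm_integral_le_increment)
       (use t in \<open>auto intro!: integrable_subinterval_Icc[OF ui] integrable_subinterval_Icc[OF ai]\<close>)
  also have "\<dots> \<le> (\<integral>x. \<bar>u x\<bar> \<partial>leb T)"
    by (rule integral_nonneg_mono_Icc[OF ai]) (use t in auto)
  also have "\<dots> = (\<integral>x. norm (u x) * norm (1::real) \<partial>lebesgue_on {0<..<T})"
    using integral_Icc_eq_Ioo[OF ai] by simp
  also have "\<dots> \<le> sqrt (\<integral>x. (norm (u x))\<^sup>2 \<partial>lebesgue_on {0<..<T}) * sqrt (\<integral>x. (norm (1::real))\<^sup>2 \<partial>lebesgue_on {0<..<T})"
    using u one by (intro cauchy_schwarz_integral) (auto simp: L2_def)
  also have "(\<integral>x. (norm (1::real))\<^sup>2 \<partial>lebesgue_on {0<..<T}) = T"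
    using T by (simp add: measure_restrict_space)
  also have "sqrt (\<integral>x. (norm (u x))\<^sup>2 \<partial>lebesgue_on {0<..<T}) * sqrt T \<le> L2_norm {0<..<T} u * 1"
    unfolding L2_norm_def using T by (intro mult_left_mono) auto
  finally show "\<bar>\<integral>x. u x \<partial>leb t\<bar> \<le> L2_norm {0<..<T} u" by simp
qed

text \<open>Finitely many linear conditions hold together near 0; the four are those imposed on
  \<open>\<theta>\<close> in \<open>phase_contradiction\<close>.\<close>

lemma small_parameter:
  fixes c1 c2 c3 c4 e1 e2 e3 e4 :: real
  assumes "0 \<le> c1" "0 \<le> c2" "0 \<le> c3" "0 \<le> c4" "0 < e1" "0 < e2" "0 < e3" "0 < e4"
  shows "\<exists>\<theta>>0. \<theta> \<le> 1 \<and> c1 * \<theta> \<le> e1 \<and> c2 * \<theta> \<le> e2 \<and> c3 * \<theta> \<le> e3 \<and> c4 * \<theta> \<le> e4"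
proof -
  have ev: "\<forall>\<^sub>F \<theta> in at_right 0. c * \<theta> \<le> e" if "0 < e" for c e :: real
  proof -
    have "((\<lambda>\<theta>. c * \<theta>) \<longlongrightarrow> c * 0) (at_right 0)" by (intro tendsto_intros)
    then have "\<forall>\<^sub>F \<theta> in at_right 0. c * \<theta> < e" by (rule order_tendstoD(2)) (use that in simp)
    then show ?thesis by eventually_elim simp
  qed
  have "\<forall>\<^sub>F \<theta> in at_right (0::real). 0 < \<theta>" by (rule eventually_at_right_less)
  moreover have "\<forall>\<^sub>F \<theta> in at_right (0::real). 1 * \<theta> \<le> 1" by (rule ev) simp
  ultimately have "\<forall>\<^sub>F \<theta> in at_right 0. 0 < \<theta> \<and> 1 * \<theta> \<le> 1 \<and> c1 * \<theta> \<le> e1 \<and> c2 * \<theta> \<le> e2 \<and> c3 * \<theta> \<le> e3 \<and> c4 * \<theta> \<le> e4"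
    by (intro eventually_conj ev assms) auto
  from eventually_happens[OF this] show ?thesis by auto
qed

theorem theorem1p4:
  fixes \<mu> \<mu>' :: "real \<Rightarrow> real" and \<beta> :: real
  assumes "\<mu> \<in> sobolev_H 3"
    and "has_weak_deriv 1 \<mu> \<mu>'"
    and "B_coeff \<mu> \<mu>' \<noteq> 0"
    and "diag \<mu> 1 \<noteq> diag \<mu> 2"
    and "\<beta> = sgn (B_coeff \<mu> \<mu>' * (diag \<mu> 2 - diag \<mu> 1))"
  shows "\<exists>Tmax>0. \<exists>\<epsilon>>0. \<forall>T. 0 < T \<and> T < Tmax \<longrightarrow>
    (\<forall>u :: real \<Rightarrow> real. u \<in> L2 {0<..<T} \<and> L2_norm {0<..<T} u < \<epsilon> \<longrightarrow>
      (\<forall>\<psi> :: nat \<Rightarrow> real \<Rightarrow> real \<Rightarrow> complex.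
        (\<forall>j\<in>{1, 2, 3}. mild_solution \<mu> u T (phi j) (\<psi> j)) \<longrightarrow>
        (\<forall>\<delta>\<in>{0<..1::real}. \<forall>\<nu>::real.
          \<not> (L2_eq (\<psi> 1 T) (\<lambda>x. exp (\<i> * of_real \<nu>) * Phi 1 T x) \<and>
             L2_eq (\<psi> 2 T) (\<lambda>x. exp (\<i> * of_real \<nu>) * Phi 2 T x) \<and>
             L2_eq (\<psi> 3 T) (\<lambda>x. exp (\<i> * of_real \<nu>) *
               ((of_real (sqrt (1 - \<delta>\<^sup>2)) + \<i> * of_real (\<beta> * \<delta>)) * Phi 3 T x))))))"
proof -
  obtain M N g where MN: "AE x in M01. \<mu> x = M x" "AE x in M01. \<mu>' x = N x"
    and g: "g \<in> L2 I01"
    and M: "\<And>x. x \<in> {0..1} \<Longrightarrow> (M has_vector_derivative N x) (at x within {0..1})"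
    and N: "primitive_on 1 (\<lambda>x. of_real (N x)) (\<lambda>x. of_real (g x))"
    by (rule sobolev_representative[OF assms(1) _ assms(2)]) auto
  interpret potential M N g by unfold_locales (fact M N g)+
  have \<mu>m: "\<mu> \<in> borel_measurable M01" "\<mu>' \<in> borel_measurable M01"
    using assms(2) by (auto simp: has_weak_deriv_def intro: L2_measurable)
  have MNm: "M \<in> borel_measurable M01" "N \<in> borel_measurable M01"
    by (intro continuous_on_measurable_M01 M_continuous N_continuous)+
  \<comment> \<open>The coefficients do not see the passage to the regular representatives, so the
    hypotheses on \<open>\<mu>\<close> carry over to \<open>M\<close> and \<open>N\<close>.\<close>
  have a: "diag \<mu> k = diag M k" for k by (rule diag_cong_AE[OF \<mu>m(1) MNm(1) MN(1)])
  have m: "diag (\<lambda>x. (\<mu>' x)\<^sup>2) k = diag (\<lambda>x. (N x)\<^sup>2) k" for k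
  proof (rule diag_cong_AE)
    show "AE x in M01. (\<mu>' x)\<^sup>2 = (N x)\<^sup>2" using MN(2) by eventually_elim simp
  qed (use \<mu>m MNm in measurable)
  \<comment> \<open>Sums of absolute values serve as joint bounds for the three indices.\<close>
  define A where "A = \<bar>diag M 1\<bar> + \<bar>diag M 2\<bar> + \<bar>diag M 3\<bar>"
  define b where "b = \<bar>diag (\<lambda>x. (N x)\<^sup>2) 1\<bar> + \<bar>diag (\<lambda>x. (N x)\<^sup>2) 2\<bar> + \<bar>diag (\<lambda>x. (N x)\<^sup>2) 3\<bar>"
  define E where "E = 2 * (resid_bound 1)\<^sup>2 + 2 * (resid_bound 2)\<^sup>2 + 2 * (resid_bound 3)\<^sup>2"
  define G where "G = 4 * M_bound\<^sup>2"
  define d where "d = \<bar>diag M 2 - diag M 1\<bar>"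
  define L where "L = 4 * (b + E) / d"
  define k where "k = 2 * (E + G * L) + b * A + A\<^sup>2 * L"
  define B where "B = B_coeff \<mu> \<mu>'"
  have A0: "0 \<le> A" "0 \<le> b" "0 \<le> E" "0 \<le> G" by (simp_all add: A_def b_def E_def G_def)
  have d0: "0 < d" using assms(4) by (simp add: d_def a)
  have L0: "0 \<le> L" unfolding L_def using A0 d0 by simp
  have k0: "0 \<le> k" unfolding k_def using A0 L0 by simp
  have B0: "B \<noteq> 0" using assms(3) by (simp add: B_def)
  have Beq: "B = (diag M 3 - diag M 2) * diag (\<lambda>x. (N x)\<^sup>2) 1 + (diag M 1 - diag M 3) * diag (\<lambda>x. (N x)\<^sup>2) 2
    + (diag M 2 - diag M 1) * diag (\<lambda>x. (N x)\<^sup>2) 3"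
    unfolding B_def B_coeff_def a m ..
  obtain \<theta> where \<theta>: "0 < \<theta>" "\<theta> \<le> 1" "4 * G * \<theta> \<le> d" "A * \<theta> \<le> 1" "6 * A * k * \<theta> \<le> \<bar>B\<bar>" "(k + b + A) * \<theta> \<le> 1 / 4"
    using small_parameter[of "4 * G" A "6 * A * k" "k + b + A" d 1 "\<bar>B\<bar>" "1 / 4"] A0 k0 d0 B0 by auto
  show ?thesis
  \<comment> \<open>The same \<open>\<theta>\<close> is the time horizon and the bound on the
    control.\<close>
  proof (intro exI[of _ \<theta>] conjI allI impI ballI notI \<theta>(1))
    fix T u \<delta> \<nu> and \<psi> :: "nat \<Rightarrow> real \<Rightarrow> real \<Rightarrow> complex"
    assume T: "0 < T \<and> T < \<theta>" and u: "u \<in> L2 {0<..<T} \<and> L2_norm {0<..<T} u < \<theta>"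
      and sol: "\<forall>j\<in>{1, 2, 3}. mild_solution \<mu> u T (phi j) (\<psi> j)" and \<delta>: "\<delta> \<in> {0<..1}"
      and target: "L2_eq (\<psi> 1 T) (\<lambda>x. exp (\<i> * of_real \<nu>) * Phi 1 T x) \<and>
        L2_eq (\<psi> 2 T) (\<lambda>x. exp (\<i> * of_real \<nu>) * Phi 2 T x) \<and>
        L2_eq (\<psi> 3 T) (\<lambda>x. exp (\<i> * of_real \<nu>) * ((of_real (sqrt (1 - \<delta>\<^sup>2)) + \<i> * of_real (\<beta> * \<delta>)) * Phi 3 T x))"
    define c \<rho> where "c = exp (\<i> * complex_of_real \<nu>)" and "\<rho> = complex_of_real (sqrt (1 - \<delta>\<^sup>2)) + \<i> * of_real (\<beta> * \<delta>)"
    define s where "s = (\<lambda>t. \<integral>x. u x \<partial>leb t)"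
    define \<sigma> where "\<sigma> = (\<integral>t. (s t)\<^sup>2 \<partial>leb T)"
    have T': "0 < T" "T \<le> 1" "T \<le> \<theta>" using T \<theta> by auto
    have ui: "integrable (leb T) u"
      by (rule primitive_of_small_control(1)[OF conjunct1[OF u] T'(1,2), of T]) (use T' in simp)
    have s\<theta>: "\<bar>s t\<bar> \<le> \<theta>" if "t \<in> {0..T}" for t
      using primitive_of_small_control(2)[OF conjunct1[OF u] T'(1,2) that] u unfolding s_def by linarith
    have s1: "\<bar>s t\<bar> \<le> 1" if "t \<in> {0..T}" for t using s\<theta>[OF that] \<theta> by linarith
    have c1: "cmod c = 1" unfolding c_def by simp
    have \<rho>1: "cmod \<rho> = 1"
    proof -
      have "(\<beta> * \<delta>)\<^sup>2 = \<delta>\<^sup>2" using assms(3-5) by (auto simp: sgn_if power_mult_distrib)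
      moreover have "\<delta>\<^sup>2 \<le> 1" using \<delta> by (simp add: power_le_one)
      ultimately show ?thesis unfolding \<rho>_def cmod_def by simp
    qed
    have c\<rho>1: "cmod (c * \<rho>) = 1" using c1 \<rho>1 by (simp add: norm_mult)
    have \<sigma>0: "0 \<le> \<sigma>" unfolding \<sigma>_def by simp
    have \<sigma>\<theta>: "\<sigma> \<le> \<theta>"
    proof -
      have sc: "continuous_on {0..T} s"
        unfolding s_def by (rule indefinite_integral_continuous_real[OF ui])
      have "\<sigma> \<le> (\<integral>t. \<theta> \<partial>leb T)"
        unfolding \<sigma>_def
      proof (rule integral_mono)
        show "integrable (leb T) (\<lambda>t. (s t)\<^sup>2)"
          by (intro integrable_continuous_Icc continuous_intros sc)
        fix t assume "t \<in> space (leb T)"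
        then have t: "t \<in> {0..T}" by simp
        \<comment> \<open>One factor is bounded by \<open>\<theta>\<close> and the other by 1;
          integrating over a time of at most 1 gives the bound on \<open>\<sigma>\<close>.\<close>
        have "\<bar>s t\<bar> * \<bar>s t\<bar> \<le> \<theta> * 1" by (rule mult_mono[OF s\<theta>[OF t] s1[OF t]]) (use \<theta> in auto)
        then show "(s t)\<^sup>2 \<le> \<theta>" by (simp add: power2_eq_square)
      qed simp
      also have "\<dots> = T * \<theta>" using T' by (simp add: measure_restrict_space)
      also have "\<dots> \<le> 1 * \<theta>" using T' \<theta> by (intro mult_right_mono) auto
      finally show ?thesis by simp
    qed
    have sol': "mild_solution \<mu> u T (phi 1) (\<psi> 1)" "mild_solution \<mu> u T (phi 2) (\<psi> 2)" "mild_solution \<mu> u T (phi 3) (\<psi> 3)"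
      using sol by auto
    have target': "L2_eq (\<psi> 1 T) (\<lambda>x. c * Phi 1 T x)" "L2_eq (\<psi> 2 T) (\<lambda>x. c * Phi 2 T x)"
      "L2_eq (\<psi> 3 T) (\<lambda>x. (c * \<rho>) * Phi 3 T x)"
      using target by (simp_all only: c_def \<rho>_def mult.assoc)
    have E: "2 * (resid_bound 1)\<^sup>2 \<le> E" "2 * (resid_bound 2)\<^sup>2 \<le> E" "2 * (resid_bound 3)\<^sup>2 \<le> E"
      by (simp_all add: E_def)
    have s_eq: "s t = (\<integral>x. u x \<partial>leb t)" if "t \<in> {0..T}" for t by (simp add: s_def)
    have e1: "cmod (c * (1 - \<i> * of_real (s T * diag M 1)) - (1 - \<i> * of_real (diag (\<lambda>x. (N x)\<^sup>2) 1 * \<sigma>))) \<le> E * T * \<sigma> + G * (s T)\<^sup>2"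
      unfolding \<sigma>_def G_def
      by (rule terminal_phase[OF sol'(1) T'(1) _ \<mu>m(1) MN(1) ui s_eq s1 c1 target'(1) E(1)]) auto
    have e2: "cmod (c * (1 - \<i> * of_real (s T * diag M 2)) - (1 - \<i> * of_real (diag (\<lambda>x. (N x)\<^sup>2) 2 * \<sigma>))) \<le> E * T * \<sigma> + G * (s T)\<^sup>2"
      unfolding \<sigma>_def G_def
      by (rule terminal_phase[OF sol'(2) T'(1) _ \<mu>m(1) MN(1) ui s_eq s1 c1 target'(2) E(2)]) auto
    have e3: "cmod (c * \<rho> * (1 - \<i> * of_real (s T * diag M 3)) - (1 - \<i> * of_real (diag (\<lambda>x. (N x)\<^sup>2) 3 * \<sigma>))) \<le> E * T * \<sigma> + G * (s T)\<^sup>2"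
      unfolding \<sigma>_def G_def
      by (rule terminal_phase[OF sol'(3) T'(1) _ \<mu>m(1) MN(1) ui s_eq s1 c\<rho>1 target'(3) E(3)]) auto
    have Ab: "\<bar>diag M 1\<bar> \<le> A" "\<bar>diag M 2\<bar> \<le> A" "\<bar>diag M 3\<bar> \<le> A"
      by (simp_all add: A_def)
    have mb: "\<bar>diag (\<lambda>x. (N x)\<^sup>2) 1\<bar> \<le> b" "\<bar>diag (\<lambda>x. (N x)\<^sup>2) 2\<bar> \<le> b" "\<bar>diag (\<lambda>x. (N x)\<^sup>2) 3\<bar> \<le> b"
      by (simp_all add: b_def)
    have sT: "\<bar>s T\<bar> \<le> \<theta>" by (rule s\<theta>) (use T' in simp)
    have \<delta>': "0 < \<delta>" "\<delta> \<le> 1" using \<delta> by auto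
    have \<beta>: "\<beta> = sgn (B * (diag M 2 - diag M 1))" using assms(5) by (simp add: B_def a)
    show False
      by (rule phase_contradiction[OF Ab mb A0(3,4) d_def d0 L_def k_def Beq B0 \<theta> sT \<sigma>0 \<sigma>\<theta>
            less_imp_le[OF T'(1)] T'(3) c1 \<rho>_def \<delta>' \<beta> e1 e2 e3])
  qed
qed

end
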